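(* Let $\Gamma$ be a compact connected metric graph, let $\kappa\in L_\infty(\Gamma)$ satisfy $\operatorname{ess\,inf}_\Gamma\kappa\ge\kappa_0>0$, let $a:\Gamma\to\mathbb R$ be Lipschitz and positive with $a_0=\min_\Gamma a>0$, and let $\alpha\in\mathbb R$. Let $L$ be the operator on $L_2(\Gamma)$ acting on each edge by $(Lu)_e=-(a_eu_e')'+\kappa_e^2u_e$, endowed with the generalized Kirchhoff vertex conditions, i.e. with domain $$D(L)=\Big\{u\in\widetilde H^2(\Gamma): u\in C(\Gamma),\ a(v)\sum_{e\in\mathcal E_v}\partial_eu(v)=\alpha u(v)\ \ \forall v\in\mathcal V\Big\}.$$ Suppose that either $\alpha\ge 0$, or, with $S=|\alpha|/d_0$ and $d_0=\min_{v}d_v$, one has $\kappa_0^2>4S/\min_el_e$ and $2S\max_el_e\le a_0$. Then there exist constants $C_1,C_2>0$ such that $$\forall n\in\mathbb N:\qquad C_1n^2\le\lambda_n\le C_2n^2,$$ where $\{\lambda_n\}_{n\in\mathbb N}$ are the eigenvalues of $L$ in increasing order (repeated according to multiplicity).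
   Context: A compact metric graph $\Gamma$ consists of a finite vertex set $\mathcal V$ and a finite edge set $\mathcal E$ (loops and multiple edges allowed); each edge $e$ is identified with an interval $[0,l_e]$, $0<l_e<\infty$; $\Gamma$ carries the shortest-path metric. $\mathcal E_v$ is the set of edges incident to $v$ (a loop at $v$ counted twice, once per end) and $d_v=|\mathcal E_v|$. $u_e$ is the restriction of $u$ to $e$; $L_2(\Gamma)=\bigoplus_eL_2(e)$, $\widetilde H^2(\Gamma)=\bigoplus_eH^2(e)$, and $C(\Gamma)$ is the space of continuous functions on $\Gamma$. $\partial_eu(v)$ is the derivative of $u$ along $e$ at $v$ in the direction away from $v$: $u_e'(0)$ if $v$ sits at $0$, $-u_e'(l_e)$ if $v$ sits at $l_e$. Under the stated hypotheses $L$ is self-adjoint and positive definite with compact inverse, so it has a discrete spectrum. $\mathbb N=\{1,2,\dots\}$. *)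

theory Defs
  imports
    "HOL-Analysis.Analysis"
    "HOL-Library.Function_Algebras"
    "Graph_Theory.Digraph_Component"
begin

section \<open>Functions as a real vector space\<close>

instantiation "fun" :: (type, real_vector) real_vector
begin

definition scaleR_fun :: "real \<Rightarrow> ('a \<Rightarrow> 'b) \<Rightarrow> 'a \<Rightarrow> 'b"
  where "scaleR_fun c f = (\<lambda>x. c *\<^sub>R f x)"

instance
  by standard (simp_all add: scaleR_fun_def fun_eq_iff scaleR_add_right scaleR_add_left)

end


section \<open>Compact metric graphs\<close>

text \<open>
  The combinatorial graph is a finite multi-digraph; the direction of an edge \<open>e\<close> only fixes the
  identification of \<open>e\<close> with \<open>[0, len e]\<close>: the tail sits at \<open>0\<close>, the head at \<open>len e\<close>. At least one
  edge is required, so that the minima and maxima over edges make sense (the only connected graph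
  excluded is a single isolated point).
\<close>

definition compact_metric_graph :: "('v, 'e) pre_digraph \<Rightarrow> ('e \<Rightarrow> real) \<Rightarrow> bool" where
  "compact_metric_graph G len \<longleftrightarrow>
     fin_digraph G \<and> Digraph_Component.connected G \<and> arcs G \<noteq> {} \<and> (\<forall>e\<in>arcs G. 0 < len e)"

text \<open>A loop belongs to both \<^const>\<open>out_arcs\<close> and \<^const>\<open>in_arcs\<close>, hence is counted twice.\<close>

definition vdegree :: "('v, 'e) pre_digraph \<Rightarrow> 'v \<Rightarrow> nat" where
  "vdegree G v = out_degree G v + in_degree G v"

text \<open>
  Points of the graph are the vertices and the interior points of the edges, so that the gluing of
  the edges at their end points is built in; \<open>edge_pt G len e\<close> is the parametrisation of the closed
  edge \<open>e\<close> by \<open>[0, len e]\<close>.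
\<close>

datatype ('v, 'e) gpoint = Vertex 'v | Inner 'e real

definition edge_pt :: "('v, 'e) pre_digraph \<Rightarrow> ('e \<Rightarrow> real) \<Rightarrow> 'e \<Rightarrow> real \<Rightarrow> ('v, 'e) gpoint" where
  "edge_pt G len e x =
     (if x = 0 then Vertex (tail G e) else if x = len e then Vertex (head G e) else Inner e x)"

definition gpoints :: "('v, 'e) pre_digraph \<Rightarrow> ('e \<Rightarrow> real) \<Rightarrow> ('v, 'e) gpoint set" where
  "gpoints G len = Vertex ` verts G \<union> {Inner e x | e x. e \<in> arcs G \<and> 0 < x \<and> x < len e}"

text \<open>The restriction \<open>u\<^sub>e\<close> of a function on the graph to an edge; meaningful on \<open>[0, len e]\<close> only.\<close>

definition on_edge ::
  "('v, 'e) pre_digraph \<Rightarrow> ('e \<Rightarrow> real) \<Rightarrow> (('v, 'e) gpoint \<Rightarrow> real) \<Rightarrow> 'e \<Rightarrow> real \<Rightarrow> real" where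
  "on_edge G len u e x = u (edge_pt G len e x)"

text \<open>
  \<open>route G len p r q\<close>: there is a path from \<open>p\<close> to \<open>q\<close> of length \<open>r\<close> consisting of finitely many
  segments, each of which runs inside one closed edge.
\<close>

inductive route ::
  "('v, 'e) pre_digraph \<Rightarrow> ('e \<Rightarrow> real) \<Rightarrow> ('v, 'e) gpoint \<Rightarrow> real \<Rightarrow> ('v, 'e) gpoint \<Rightarrow> bool"
  for G len p where
  start: "p \<in> gpoints G len \<Longrightarrow> route G len p 0 p"
| step: "route G len p r (edge_pt G len e x) \<Longrightarrow> e \<in> arcs G \<Longrightarrow> x \<in> {0..len e} \<Longrightarrow> y \<in> {0..len e}
    \<Longrightarrow> route G len p (r + \<bar>x - y\<bar>) (edge_pt G len e y)"

definition gdist ::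
  "('v, 'e) pre_digraph \<Rightarrow> ('e \<Rightarrow> real) \<Rightarrow> ('v, 'e) gpoint \<Rightarrow> ('v, 'e) gpoint \<Rightarrow> real" where
  "gdist G len p q = Inf {r. route G len p r q}"

definition graph_lipschitz ::
  "('v, 'e) pre_digraph \<Rightarrow> ('e \<Rightarrow> real) \<Rightarrow> (('v, 'e) gpoint \<Rightarrow> real) \<Rightarrow> bool" where
  "graph_lipschitz G len f \<longleftrightarrow>
     (\<exists>K. \<forall>p\<in>gpoints G len. \<forall>q\<in>gpoints G len. \<bar>f p - f q\<bar> \<le> K * gdist G len p q)"

definition graph_continuous ::
  "('v, 'e) pre_digraph \<Rightarrow> ('e \<Rightarrow> real) \<Rightarrow> (('v, 'e) gpoint \<Rightarrow> real) \<Rightarrow> bool" where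
  "graph_continuous G len f \<longleftrightarrow>
     (\<forall>p\<in>gpoints G len. \<forall>\<epsilon>>0. \<exists>\<delta>>0. \<forall>q\<in>gpoints G len. gdist G len p q < \<delta> \<longrightarrow> \<bar>f q - f p\<bar> < \<epsilon>)"

definition graph_Linf ::
  "('v, 'e) pre_digraph \<Rightarrow> ('e \<Rightarrow> real) \<Rightarrow> (('v, 'e) gpoint \<Rightarrow> real) \<Rightarrow> bool" where
  "graph_Linf G len f \<longleftrightarrow>
     (\<forall>e\<in>arcs G. on_edge G len f e \<in> borel_measurable (lebesgue_on {0<..<len e}) \<and>
        (\<exists>K. AE x in lebesgue_on {0<..<len e}. \<bar>on_edge G len f e x\<bar> \<le> K))"

text \<open>\<open>graph_ess_inf_ge G len f c\<close> says that the essential infimum of \<open>f\<close> is at least \<open>c\<close>.\<close>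

definition graph_ess_inf_ge ::
  "('v, 'e) pre_digraph \<Rightarrow> ('e \<Rightarrow> real) \<Rightarrow> (('v, 'e) gpoint \<Rightarrow> real) \<Rightarrow> real \<Rightarrow> bool" where
  "graph_ess_inf_ge G len f c \<longleftrightarrow>
     (\<forall>e\<in>arcs G. AE x in lebesgue_on {0<..<len e}. c \<le> on_edge G len f e x)"


section \<open>Sobolev spaces on an interval\<close>

definition L2_interval :: "real \<Rightarrow> (real \<Rightarrow> real) \<Rightarrow> bool" where
  "L2_interval l f \<longleftrightarrow> f \<in> borel_measurable (lebesgue_on {0<..<l}) \<and>
     integrable (lebesgue_on {0<..<l}) (\<lambda>x. (f x)\<^sup>2)"

definition loc_integrable :: "real \<Rightarrow> (real \<Rightarrow> real) \<Rightarrow> bool" where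
  "loc_integrable l f \<longleftrightarrow> (\<forall>c d. 0 < c \<and> d < l \<longrightarrow> set_integrable lebesgue {c..d} f)"

text \<open>
  \<open>\<phi>\<close> is a continuously differentiable function with compact support in \<open>(0, l)\<close> and derivative \<open>\<phi>'\<close>.
  Using \<open>C\<^sub>c\<^sup>1\<close> rather than \<open>C\<^sub>c\<^sup>\<infinity>\<close> test functions yields the same weak derivatives, by mollification
  (Brezis defines the Sobolev spaces on an interval in this way).
\<close>

definition test_function :: "real \<Rightarrow> (real \<Rightarrow> real) \<Rightarrow> (real \<Rightarrow> real) \<Rightarrow> bool" where
  "test_function l \<phi> \<phi>' \<longleftrightarrow>
     (\<forall>x. (\<phi> has_real_derivative \<phi>' x) (at x)) \<and> continuous_on UNIV \<phi>' \<and>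
     (\<exists>c d. 0 < c \<and> d < l \<and> (\<forall>x. x \<notin> {c..d} \<longrightarrow> \<phi> x = 0))"

definition has_weak_deriv :: "real \<Rightarrow> (real \<Rightarrow> real) \<Rightarrow> (real \<Rightarrow> real) \<Rightarrow> bool" where
  "has_weak_deriv l f g \<longleftrightarrow> loc_integrable l f \<and> loc_integrable l g \<and>
     (\<forall>\<phi> \<phi>'. test_function l \<phi> \<phi>' \<longrightarrow>
        (LINT x:{0<..<l}|lebesgue. f x * \<phi>' x) = - (LINT x:{0<..<l}|lebesgue. g x * \<phi> x))"

text \<open>The weak derivative is unique up to null sets; this picks a representative.\<close>

definition weak_deriv :: "real \<Rightarrow> (real \<Rightarrow> real) \<Rightarrow> real \<Rightarrow> real" where
  "weak_deriv l f = (SOME g. has_weak_deriv l f g)"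

definition H2_interval :: "real \<Rightarrow> (real \<Rightarrow> real) \<Rightarrow> bool" where
  "H2_interval l f \<longleftrightarrow> L2_interval l f \<and>
     (\<exists>g h. has_weak_deriv l f g \<and> L2_interval l g \<and> has_weak_deriv l g h \<and> L2_interval l h)"


section \<open>The operator and its eigenvalues\<close>

text \<open>
  The sum of the outgoing derivatives \<open>\<partial>\<^sub>e u(v)\<close> over all edge ends at \<open>v\<close>. It is used only for
  continuous \<open>u\<close> with \<open>u\<^sub>e\<close> in \<open>H\<^sup>2\<close>, for which these one-sided classical derivatives exist.
\<close>

definition outgoing_deriv_sum ::
  "('v, 'e) pre_digraph \<Rightarrow> ('e \<Rightarrow> real) \<Rightarrow> (('v, 'e) gpoint \<Rightarrow> real) \<Rightarrow> 'v \<Rightarrow> real" where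
  "outgoing_deriv_sum G len u v =
     (\<Sum>e\<in>out_arcs G v. vector_derivative (on_edge G len u e) (at 0 within {0..len e})) +
     (\<Sum>e\<in>in_arcs G v. - vector_derivative (on_edge G len u e) (at (len e) within {0..len e}))"

text \<open>
  Every element of the domain has a unique continuous representative, and \<open>L_domain\<close> is the set of
  these representatives. They are set to \<open>0\<close> at the elements of \<^typ>\<open>('v, 'e) gpoint\<close> that are
  not points of the graph, so that functions agreeing on the graph are equal.
\<close>

definition L_domain ::
  "('v, 'e) pre_digraph \<Rightarrow> ('e \<Rightarrow> real) \<Rightarrow> (('v, 'e) gpoint \<Rightarrow> real) \<Rightarrow> real
     \<Rightarrow> (('v, 'e) gpoint \<Rightarrow> real) set" where
  "L_domain G len a \<alpha> = {u.
     (\<forall>p. p \<notin> gpoints G len \<longrightarrow> u p = 0) \<and>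
     (\<forall>e\<in>arcs G. H2_interval (len e) (on_edge G len u e)) \<and>
     graph_continuous G len u \<and>
     (\<forall>v\<in>verts G. a (Vertex v) * outgoing_deriv_sum G len u v = \<alpha> * u (Vertex v))}"

text \<open>\<open>L_op G len a \<kappa> u e\<close> is a representative of \<open>(L u)\<^sub>e\<close>.\<close>

definition L_op ::
  "('v, 'e) pre_digraph \<Rightarrow> ('e \<Rightarrow> real) \<Rightarrow> (('v, 'e) gpoint \<Rightarrow> real) \<Rightarrow> (('v, 'e) gpoint \<Rightarrow> real)
     \<Rightarrow> (('v, 'e) gpoint \<Rightarrow> real) \<Rightarrow> 'e \<Rightarrow> real \<Rightarrow> real" where
  "L_op G len a \<kappa> u e x =
     - weak_deriv (len e) (\<lambda>y. on_edge G len a e y * weak_deriv (len e) (on_edge G len u e) y) x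
     + (on_edge G len \<kappa> e x)\<^sup>2 * on_edge G len u e x"

definition eigenspace ::
  "('v, 'e) pre_digraph \<Rightarrow> ('e \<Rightarrow> real) \<Rightarrow> (('v, 'e) gpoint \<Rightarrow> real) \<Rightarrow> (('v, 'e) gpoint \<Rightarrow> real)
     \<Rightarrow> real \<Rightarrow> real \<Rightarrow> (('v, 'e) gpoint \<Rightarrow> real) set" where
  "eigenspace G len a \<kappa> \<alpha> \<mu> = {u \<in> L_domain G len a \<alpha>.
     \<forall>e\<in>arcs G. AE x in lebesgue_on {0<..<len e}. L_op G len a \<kappa> u e x = \<mu> * on_edge G len u e x}"

text \<open>
  \<open>ev 1, ev 2, \<dots>\<close> lists all eigenvalues in increasing order, repeated according to multiplicity:
  each real \<open>\<mu>\<close> occurs exactly as often as the dimension of its eigenspace (which is \<open>0\<close> if \<open>\<mu>\<close> is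
  not an eigenvalue). The value \<open>ev 0\<close> is irrelevant.
\<close>

definition eigenvalue_sequence ::
  "('v, 'e) pre_digraph \<Rightarrow> ('e \<Rightarrow> real) \<Rightarrow> (('v, 'e) gpoint \<Rightarrow> real) \<Rightarrow> (('v, 'e) gpoint \<Rightarrow> real)
     \<Rightarrow> real \<Rightarrow> (nat \<Rightarrow> real) \<Rightarrow> bool" where
  "eigenvalue_sequence G len a \<kappa> \<alpha> ev \<longleftrightarrow> mono_on {1..} ev \<and>
     (\<forall>\<mu>. finite {n. 1 \<le> n \<and> ev n = \<mu>} \<and>
        (\<exists>B. finite B \<and> independent B \<and> span B = eigenspace G len a \<kappa> \<alpha> \<mu> \<and>
             card B = card {n. 1 \<le> n \<and> ev n = \<mu>}))"

end

theory Submission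
  imports Defs "HOL-Complex_Analysis.Great_Picard"
begin

text \<open>
  The eigenvalue problem is the Euler-Lagrange equation of the Rayleigh quotient of the form
  \<open>Q(u) = \<Sum>\<^sub>e \<integral> (a |u'|\<^sup>2 + \<kappa>\<^sup>2 |u|\<^sup>2) + \<alpha> \<Sum>\<^sub>v |u(v)|\<^sup>2\<close>, which the hypotheses make positive definite (for
  \<open>\<alpha> < 0\<close> by the trace inequality \<open>|u(0)|\<^sup>2 \<le> 2/l \<parallel>u\<parallel>\<^sup>2 + l \<parallel>u'\<parallel>\<^sup>2\<close>).

  Lower bound: some combination of the first \<open>n\<close> eigenfunctions vanishes at the points of a mesh with
  \<open>n - 1\<close> points that contains all vertices; on it the vertex term is absent and the Poincare inequality
  between mesh points bounds the quotient below by a multiple of \<open>n\<^sup>2\<close>, whereas orthogonality bounds it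
  above by \<open>\<lambda>\<^sub>n\<close>.

  Upper bound: among \<open>n\<close> sine functions on one edge some combination is orthogonal to the first \<open>n - 1\<close>
  eigenfunctions, and its quotient is at most \<open>C n\<^sup>2\<close>. If \<open>\<lambda>\<^sub>n\<close> were larger, the infimum of the quotient
  over that orthogonal complement would be below \<open>\<lambda>\<^sub>n\<close>. It is attained: a minimising sequence has
  a uniformly convergent subsequence by Arzela-Ascoli, and testing with functions \<open>v\<close> for which
  \<open>a v'\<close> is piecewise constant shows that the limit is an eigenfunction. This eigenfunction would be
  missing from the list of all eigenfunctions.
\<close>

section \<open>Primitives of integrable functions\<close>

text \<open>Everything is phrased through \<open>primitive_on\<close>, absolute continuity written
  as a pair of function and density. The equation prescribes the derivative of the flux
  \<open>a u'\<close>, not of \<open>u'\<close>; the latter is recovered by multiplying with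
  \<open>1 / a\<close>, which is again Lipschitz. The space of functions with bounded derivative on
  which the forms live is not complete, so Hilbert space arguments do not hand over a minimiser.
  Instead, a test function \<open>v\<close> with \<open>a v'\<close> constant turns the integral of
  \<open>a u' v'\<close> into differences of values of \<open>u\<close>: pointwise convergence
  suffices, and no convergence of derivatives is used. The limit lies in the space because it solves
  the equation. For \<open>\<alpha> < 0\<close> the trace inequality over full edges yields exactly
  the two smallness hypotheses, but may use up the derivative term entirely. A second application
  over shorter pieces keeps half of that term at the price of a large multiple of the
  \<open>L2\<close> norm; compactness rests on this second estimate.\<close>

text \<open>Summation over a fine uniform partition telescopes both \<open>H\<close> and
  \<open>M\<close>, so the total defect is at most \<open>\<epsilon> * (M B - M A)\<close>. This
  stands in for differentiation almost everywhere: comparing indefinite integrals only requires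
  increments over short intervals.\<close>

lemma increments_nonneg:
  fixes H M :: "real \<Rightarrow> real"
  assumes "A \<le> B"
    and inc: "\<And>\<epsilon>. \<epsilon> > 0 \<Longrightarrow> \<exists>\<delta>>0. \<forall>x y. A \<le> x \<and> x \<le> y \<and> y \<le> B \<and> y - x < \<delta>
      \<longrightarrow> H y - H x \<ge> - \<epsilon> * (M y - M x)"
  shows "H A \<le> H B"
proof (rule field_le_epsilon)
  fix e :: real assume "e > 0"
  define \<epsilon> where "\<epsilon> = e / (\<bar>M B - M A\<bar> + 1)"
  have "\<epsilon> > 0" using \<open>e > 0\<close> by (simp add: \<epsilon>_def)
  then obtain \<delta> where "\<delta> > 0" and \<delta>: "\<And>x y. \<lbrakk>A \<le> x; x \<le> y; y \<le> B; y - x < \<delta>\<rbrakk>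
      \<Longrightarrow> H y - H x \<ge> - \<epsilon> * (M y - M x)"
    using inc[OF \<open>\<epsilon> > 0\<close>] by metis
  obtain N :: nat where N: "(B - A) / \<delta> < real N" using reals_Archimedean2 by blast
  have "0 \<le> (B - A) / \<delta>" using \<open>A \<le> B\<close> \<open>\<delta> > 0\<close> by simp
  then have "N > 0" using N by (metis gr_zeroI linorder_not_less of_nat_0)
  have step: "(B - A) / N < \<delta>"
    using N \<open>N > 0\<close> \<open>\<delta> > 0\<close> by (simp add: field_simps)
  define x where "x i = A + real i * ((B - A) / N)" for i
  have xs: "x (Suc i) - x i = (B - A) / N" for i unfolding x_def of_nat_Suc by (simp add: distrib_right add_divide_distrib)
  have x0: "x 0 = A" and xN: "x N = B" using \<open>N > 0\<close> by (auto simp: x_def)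
  have mono: "x i \<le> x j" if "i \<le> j" for i j
    unfolding x_def using \<open>A \<le> B\<close> that by (intro add_left_mono mult_right_mono) auto
  have *: "H (x (Suc i)) - H (x i) \<ge> - \<epsilon> * (M (x (Suc i)) - M (x i))" if "i < N" for i
    using \<delta>[of "x i" "x (Suc i)"] mono[of 0 i] mono[of i "Suc i"] mono[of "Suc i" N] that xs[of i] step x0 xN
    by simp
  have "(\<Sum>i<N. H (x (Suc i)) - H (x i)) \<ge> (\<Sum>i<N. - \<epsilon> * (M (x (Suc i)) - M (x i)))"
    by (intro sum_mono *) auto
  then have "H B - H A \<ge> - \<epsilon> * (M B - M A)"
    unfolding sum_distrib_left[symmetric] sum_lessThan_telescope[where f="\<lambda>i. M (x i)"]
      sum_lessThan_telescope[where f="\<lambda>i. H (x i)"] x0 xN .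
  moreover have "\<epsilon> * (M B - M A) \<le> \<epsilon> * (\<bar>M B - M A\<bar> + 1)"
    using \<open>\<epsilon> > 0\<close> by (intro mult_left_mono) auto
  moreover have "\<epsilon> * (\<bar>M B - M A\<bar> + 1) = e" by (simp add: \<epsilon>_def)
  ultimately show "H A \<le> H B + e" by simp
qed

text \<open>Absolute continuity of \<open>F\<close> with density \<open>f\<close>, expressed by the
  fundamental theorem alone: \<open>f\<close> is an explicit representative, may be changed on null
  sets, and no pointwise derivative is demanded.\<close>

definition primitive_on :: "real \<Rightarrow> real \<Rightarrow> (real \<Rightarrow> real) \<Rightarrow> (real \<Rightarrow> real) \<Rightarrow> bool" where
  "primitive_on A B F f \<longleftrightarrow>
     f absolutely_integrable_on {A..B} \<and> (\<forall>x\<in>{A..B}. integral {A..x} f = F x - F A)"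

lemma ai_subinterval:
  fixes f :: "real \<Rightarrow> real"
  shows "f absolutely_integrable_on {A..B} \<Longrightarrow> A \<le> x \<Longrightarrow> y \<le> B \<Longrightarrow> f absolutely_integrable_on {x..y}"
  by (rule absolutely_integrable_on_subinterval) auto

lemma ai_integrable:
  fixes f :: "'a::euclidean_space \<Rightarrow> real"
  shows "f absolutely_integrable_on S \<Longrightarrow> f integrable_on S"
  using set_lebesgue_integral_eq_integral(1) by blast

lemma ai_mult_continuous:
  fixes f g :: "real \<Rightarrow> real"
  assumes "f absolutely_integrable_on {A..B}" "continuous_on {A..B} g"
  shows "(\<lambda>x. f x * g x) absolutely_integrable_on {A..B}"
proof -
  have "(\<lambda>x. g x * f x) absolutely_integrable_on {A..B}"
    using assms
    by (intro absolutely_integrable_bounded_measurable_product_real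
        continuous_imp_measurable_on_sets_lebesgue compact_imp_bounded compact_continuous_image) auto
  then show ?thesis by (simp add: mult.commute)
qed

lemma primitive_on_ai: "primitive_on A B F f \<Longrightarrow> f absolutely_integrable_on {A..B}"
  by (simp add: primitive_on_def)

lemma primitive_on_continuous: "primitive_on A B F f \<Longrightarrow> continuous_on {A..B} F"
proof -
  assume *: "primitive_on A B F f"
  have "continuous_on {A..B} (\<lambda>x. F A + integral {A..x} f)"
    using * by (intro continuous_intros indefinite_integral_continuous_1 ai_integrable)
      (auto simp: primitive_on_def)
  then show ?thesis
    by (rule continuous_on_eq) (use * in \<open>auto simp: primitive_on_def\<close>)
qed

lemma primitive_on_diff:
  assumes "primitive_on A B F f" "A \<le> x" "x \<le> y" "y \<le> B"
  shows "F y - F x = integral {x..y} f"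
proof -
  have "f integrable_on {A..y}"
    using ai_subinterval[where f=f and A=A and B=B and x=A and y=y] assms
    by (auto intro: ai_integrable simp: primitive_on_def)
  then have "integral {A..x} f + integral {x..y} f = integral {A..y} f"
    using assms by (intro Henstock_Kurzweil_Integration.integral_combine) auto
  moreover have "integral {A..x} f = F x - F A" "integral {A..y} f = F y - F A"
    using assms by (auto simp: primitive_on_def)
  ultimately show ?thesis by simp
qed

lemma primitive_on_subinterval:
  assumes "primitive_on A B F f" "A \<le> A'" "B' \<le> B"
  shows "primitive_on A' B' F f"
  unfolding primitive_on_def
proof (intro conjI ballI)
  show "f absolutely_integrable_on {A'..B'}"
    using assms ai_subinterval primitive_on_ai by blast
  show "integral {A'..x} f = F x - F A'" if "x \<in> {A'..B'}" for x
    using primitive_on_diff[OF assms(1), of A' x] that assms by auto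
qed

lemma primitive_on_cong:
  assumes "primitive_on A B F f" "\<And>x. x \<in> {A..B} \<Longrightarrow> G x = F x" "\<And>x. x \<in> {A..B} \<Longrightarrow> g x = f x"
  shows "primitive_on A B G g"
  unfolding primitive_on_def
proof (intro conjI ballI)
  show "g absolutely_integrable_on {A..B}"
    by (rule absolutely_integrable_spike[where f=f and T="{A..B}" and S="{}"]) (use assms in \<open>auto simp: primitive_on_def\<close>)
  show "integral {A..x} g = G x - G A" if "x \<in> {A..B}" for x
  proof -
    have "integral {A..x} g = integral {A..x} f"
      by (rule integral_cong) (use assms(3) that in auto)
    then show ?thesis using assms that by (auto simp: primitive_on_def)
  qed
qed

lemma primitive_on_integral:
  "f absolutely_integrable_on {A..B} \<Longrightarrow> primitive_on A B (\<lambda>x. c + integral {A..x} f) f"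
  by (auto simp: primitive_on_def)

lemma primitive_on_spike:
  assumes "primitive_on A B F f" "negligible N" "\<And>x. x \<in> {A..B} - N \<Longrightarrow> g x = f x"
  shows "primitive_on A B F g"
  unfolding primitive_on_def
proof (intro conjI ballI)
  show "g absolutely_integrable_on {A..B}"
    by (rule absolutely_integrable_spike[where f=f and T="{A..B}" and S=N]) (use assms in \<open>auto simp: primitive_on_def\<close>)
  show "integral {A..x} g = F x - F A" if "x \<in> {A..B}" for x
  proof -
    have "integral {A..x} g = integral {A..x} f"
      by (rule integral_spike[of N]) (use assms that in auto)
    then show ?thesis using assms that by (auto simp: primitive_on_def)
  qed
qed

lemma primitive_on_add:
  assumes "primitive_on A B F f" "primitive_on A B G g"
  shows "primitive_on A B (\<lambda>x. F x + G x) (\<lambda>x. f x + g x)"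
  unfolding primitive_on_def
proof (intro conjI ballI)
  show "(\<lambda>x. f x + g x) absolutely_integrable_on {A..B}"
    using assms by (auto simp: primitive_on_def)
  fix x assume x: "x \<in> {A..B}"
  have "f integrable_on {A..x}" "g integrable_on {A..x}"
    using x assms ai_subinterval[where A=A and B=B and x=A and y=x and f=f]
      ai_subinterval[where A=A and B=B and x=A and y=x and f=g]
    by (auto intro: ai_integrable simp: primitive_on_def)
  then have "integral {A..x} (\<lambda>x. f x + g x) = integral {A..x} f + integral {A..x} g"
    by (rule integral_add)
  then show "integral {A..x} (\<lambda>x. f x + g x) = F x + G x - (F A + G A)"
    using assms x by (auto simp: primitive_on_def)
qed

lemma primitive_on_cmult:
  assumes "primitive_on A B F f"
  shows "primitive_on A B (\<lambda>x. c * F x) (\<lambda>x. c * f x)"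
  unfolding primitive_on_def
proof (intro conjI ballI)
  show "(\<lambda>x. c * f x) absolutely_integrable_on {A..B}" using assms by (auto simp: primitive_on_def)
  fix x assume "x \<in> {A..B}"
  then have "integral {A..x} f = F x - F A" using assms unfolding primitive_on_def by blast
  then show "integral {A..x} (\<lambda>x. c * f x) = c * F x - c * F A"
    by (simp add: right_diff_distrib)
qed

lemma primitive_on_deriv:
  assumes "\<And>x. x \<in> {A..B} \<Longrightarrow> (F has_real_derivative f x) (at x within {A..B})"
    and "f absolutely_integrable_on {A..B}"
  shows "primitive_on A B F f"
  unfolding primitive_on_def
proof (intro conjI ballI)
  fix x assume x: "x \<in> {A..B}"
  have "(f has_integral F x - F A) {A..x}"
  proof (rule fundamental_theorem_of_calculus)
    fix y assume "y \<in> {A..x}"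
    then have "(F has_real_derivative f y) (at y within {A..x})"
      using x by (intro DERIV_subset[OF assms(1)]) auto
    then show "(F has_vector_derivative f y) (at y within {A..x})"
      by (simp add: has_real_derivative_iff_has_vector_derivative)
  qed (use x in auto)
  then show "integral {A..x} f = F x - F A" by (simp add: integral_unique)
qed fact

lemma primitive_on_C1:
  assumes "\<And>x. x \<in> {A..B} \<Longrightarrow> (F has_real_derivative f x) (at x within {A..B})"
    and "continuous_on {A..B} f"
  shows "primitive_on A B F f"
  by (rule primitive_on_deriv[OF assms(1) absolutely_integrable_continuous_real[OF assms(2)]])

lemma primitive_on_const: "primitive_on A B (\<lambda>x. c) (\<lambda>x. 0)"
  by (rule primitive_on_C1) auto

lemma primitive_on_has_derivative:
  assumes "primitive_on A B F f" "continuous_on {A..B} f" "x \<in> {A..B}"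
  shows "(F has_real_derivative f x) (at x within {A..B})"
proof -
  have "((\<lambda>u. integral {A..u} f) has_real_derivative f x) (at x within {A..B})"
    using integral_has_real_derivative[of A B f x] assms by auto
  then have "((\<lambda>u. F A + integral {A..u} f) has_real_derivative f x) (at x within {A..B})"
    by (auto intro!: derivative_eq_intros)
  then show ?thesis
    by (rule has_field_derivative_transform_within[where d=1])
       (use assms in \<open>auto simp: primitive_on_def\<close>)
qed

text \<open>Integration by parts for absolutely continuous functions. Freezing \<open>G\<close> at
  the right and \<open>F\<close> at the left end of a short interval gives the exact increment of
  \<open>F * G\<close>; the error against the integral of \<open>h\<close> is the oscillation of
  \<open>F\<close> and \<open>G\<close> times \<open>m\<close>, so \<open>increments_nonneg\<close>
  applies to \<open>H\<close> and to \<open>- H\<close>.\<close>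

lemma integral_product_rule:
  assumes F: "primitive_on A B F f" and G: "primitive_on A B G g" and "A \<le> B"
  shows "F B * G B - F A * G A = integral {A..B} (\<lambda>x. f x * G x + F x * g x)"
proof -
  define h where "h x = f x * G x + F x * g x" for x
  define m where "m x = \<bar>f x\<bar> + \<bar>g x\<bar>" for x
  define H where "H x = F x * G x - integral {A..x} h" for x
  define M where "M x = integral {A..x} m" for x
  have fai: "f absolutely_integrable_on {A..B}" and gai: "g absolutely_integrable_on {A..B}"
    using F G by (auto simp: primitive_on_def)
  have Fc: "continuous_on {A..B} F" and Gc: "continuous_on {A..B} G"
    using F G primitive_on_continuous by auto
  have hai: "h absolutely_integrable_on {A..B}"
    unfolding h_def using ai_mult_continuous[OF fai Gc] ai_mult_continuous[OF gai Fc]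
    by (auto simp: mult.commute)
  have mai: "m absolutely_integrable_on {A..B}"
    unfolding m_def using fai gai by (auto intro!: set_integrable_abs)
  have pM: "primitive_on A B M m" unfolding M_def using primitive_on_integral[OF mai, of 0] by simp
  have pH: "primitive_on A B (\<lambda>x. integral {A..x} h) h" using primitive_on_integral[OF hai, of 0] by simp
  have key: "\<exists>\<delta>>0. \<forall>x y. A \<le> x \<and> x \<le> y \<and> y \<le> B \<and> y - x < \<delta> \<longrightarrow> \<bar>H y - H x\<bar> \<le> \<epsilon> * (M y - M x)"
    if "\<epsilon> > 0" for \<epsilon> :: real
  proof -
    obtain d1 where d1: "d1 > 0" "\<And>x y. \<lbrakk>x \<in> {A..B}; y \<in> {A..B}; dist y x < d1\<rbrakk> \<Longrightarrow> dist (F y) (F x) < \<epsilon>"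
      using uniformly_continuous_onE[OF compact_uniformly_continuous[OF Fc compact_Icc] \<open>\<epsilon> > 0\<close>]
      by metis
    obtain d2 where d2: "d2 > 0" "\<And>x y. \<lbrakk>x \<in> {A..B}; y \<in> {A..B}; dist y x < d2\<rbrakk> \<Longrightarrow> dist (G y) (G x) < \<epsilon>"
      using uniformly_continuous_onE[OF compact_uniformly_continuous[OF Gc compact_Icc] \<open>\<epsilon> > 0\<close>]
      by metis
    have "\<bar>H y - H x\<bar> \<le> \<epsilon> * (M y - M x)" if xy: "A \<le> x" "x \<le> y" "y \<le> B" "y - x < min d1 d2" for x y
    proof -
      have sub: "k integrable_on {x..y}" if "k absolutely_integrable_on {A..B}" for k :: "real \<Rightarrow> real"
        using ai_subinterval[where f=k and A=A and B=B and x=x and y=y] that xy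
        by (auto intro: ai_integrable)
      note ints = sub[OF fai] sub[OF gai] sub[OF hai] sub[OF mai]
      have i1: "(\<lambda>t. f t * G y) integrable_on {x..y}" by (rule integrable_on_mult_left[OF ints(1)])
      have i2: "(\<lambda>t. F x * g t) integrable_on {x..y}" by (rule integrable_on_mult_right[OF ints(2)])
      note i3 = integrable_add[OF i1 i2]
      have "H y - H x = F y * G y - F x * G x - integral {x..y} h"
        using primitive_on_diff[OF pH, of x y] xy by (simp add: H_def)
      also have "F y * G y - F x * G x = (F y - F x) * G y + F x * (G y - G x)" by (simp add: algebra_simps)
      also have "\<dots> = integral {x..y} (\<lambda>t. f t * G y + F x * g t)"
        using ints primitive_on_diff[OF F, of x y] primitive_on_diff[OF G, of x y] xy
        by (subst integral_add[OF i1 i2]) simp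
      also have "\<dots> - integral {x..y} h = integral {x..y} (\<lambda>t. f t * G y + F x * g t - h t)"
        by (rule integral_diff[OF i3 ints(3), symmetric])
      finally have eq: "H y - H x = integral {x..y} (\<lambda>t. f t * G y + F x * g t - h t)" .
      have "norm (integral {x..y} (\<lambda>t. f t * G y + F x * g t - h t)) \<le> integral {x..y} (\<lambda>t. \<epsilon> * m t)"
      proof (rule integral_norm_bound_integral)
        show "(\<lambda>t. f t * G y + F x * g t - h t) integrable_on {x..y}"
          by (rule integrable_diff[OF i3 ints(3)])
        show "(\<lambda>t. \<epsilon> * m t) integrable_on {x..y}" by (rule integrable_on_mult_right[OF ints(4)])
        fix t assume t: "t \<in> {x..y}"
        have "f t * G y + F x * g t - h t = f t * (G y - G t) + (F x - F t) * g t"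
          by (simp add: h_def algebra_simps)
        also have "\<bar>\<dots>\<bar> \<le> \<bar>f t\<bar> * \<bar>G y - G t\<bar> + \<bar>F x - F t\<bar> * \<bar>g t\<bar>"
          by (metis abs_mult abs_triangle_ineq)
        also have "\<dots> \<le> \<bar>f t\<bar> * \<epsilon> + \<epsilon> * \<bar>g t\<bar>"
          using d1(2)[of t x] d2(2)[of t y] t xy
          by (intro add_mono mult_left_mono mult_right_mono) (auto simp: dist_real_def abs_minus_commute)
        finally show "norm (f t * G y + F x * g t - h t) \<le> \<epsilon> * m t"
          by (simp add: m_def algebra_simps)
      qed
      also have "\<dots> = \<epsilon> * (M y - M x)"
        using primitive_on_diff[OF pM, of x y] xy by simp
      finally show ?thesis using eq by simp
    qed
    then show ?thesis using d1(1) d2(1) by (intro exI[of _ "min d1 d2"]) auto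
  qed
  have "H A \<le> H B"
  proof (rule increments_nonneg[OF \<open>A \<le> B\<close>, where H=H and M=M])
    fix \<epsilon> :: real assume "\<epsilon> > 0"
    from key[OF this] obtain \<delta> where \<delta>: "\<delta> > 0"
      "\<And>x y. A \<le> x \<and> x \<le> y \<and> y \<le> B \<and> y - x < \<delta> \<Longrightarrow> \<bar>H y - H x\<bar> \<le> \<epsilon> * (M y - M x)" by metis
    show "\<exists>\<delta>>0. \<forall>x y. A \<le> x \<and> x \<le> y \<and> y \<le> B \<and> y - x < \<delta> \<longrightarrow> - \<epsilon> * (M y - M x) \<le> H y - H x"
    proof (intro exI[of _ \<delta>] conjI allI impI \<delta>(1))
      fix x y assume "A \<le> x \<and> x \<le> y \<and> y \<le> B \<and> y - x < \<delta>"
      from \<delta>(2)[OF this] show "- \<epsilon> * (M y - M x) \<le> H y - H x" by (simp add: abs_le_iff)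
    qed
  qed
  moreover have "- H A \<le> - H B"
  proof (rule increments_nonneg[OF \<open>A \<le> B\<close>, where H="\<lambda>x. - H x" and M=M])
    fix \<epsilon> :: real assume "\<epsilon> > 0"
    from key[OF this] obtain \<delta> where \<delta>: "\<delta> > 0"
      "\<And>x y. A \<le> x \<and> x \<le> y \<and> y \<le> B \<and> y - x < \<delta> \<Longrightarrow> \<bar>H y - H x\<bar> \<le> \<epsilon> * (M y - M x)" by metis
    show "\<exists>\<delta>>0. \<forall>x y. A \<le> x \<and> x \<le> y \<and> y \<le> B \<and> y - x < \<delta> \<longrightarrow> - \<epsilon> * (M y - M x) \<le> - H y - - H x"
    proof (intro exI[of _ \<delta>] conjI allI impI \<delta>(1))
      fix x y assume "A \<le> x \<and> x \<le> y \<and> y \<le> B \<and> y - x < \<delta>"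
      from \<delta>(2)[OF this] show "- \<epsilon> * (M y - M x) \<le> - H y - - H x" by (simp add: abs_le_iff)
    qed
  qed
  ultimately have "H A = H B" by simp
  then have "F B * G B - F A * G A = integral {A..B} h" unfolding H_def by simp
  then show ?thesis unfolding h_def .
qed

lemma primitive_on_mult:
  assumes F: "primitive_on A B F f" and G: "primitive_on A B G g"
  shows "primitive_on A B (\<lambda>x. F x * G x) (\<lambda>x. f x * G x + F x * g x)"
  unfolding primitive_on_def
proof (intro conjI ballI)
  show "(\<lambda>x. f x * G x + F x * g x) absolutely_integrable_on {A..B}"
    using set_integral_add(1)[OF ai_mult_continuous[OF primitive_on_ai[OF F] primitive_on_continuous[OF G]]
      ai_mult_continuous[OF primitive_on_ai[OF G] primitive_on_continuous[OF F]]]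
    by (simp add: mult.commute[of "g _"])
  fix x assume "x \<in> {A..B}"
  then have x: "A \<le> x" "x \<le> B" by auto
  show "integral {A..x} (\<lambda>x. f x * G x + F x * g x) = F x * G x - F A * G A"
    by (rule integral_product_rule[OF primitive_on_subinterval[OF F order_refl x(2)]
      primitive_on_subinterval[OF G order_refl x(2)] x(1), symmetric])
qed

text \<open>On a short interval \<open>\<psi>\<close> is replaced by its nonnegative value at the
  left end; the replacement costs at most \<open>\<epsilon>\<close> times the integral of the
  modulus of \<open>k\<close>.\<close>

lemma integral_mult_nonneg:
  fixes k \<psi> :: "real \<Rightarrow> real"
  assumes k: "k absolutely_integrable_on {A..B}" and "A \<le> B"
    and nn: "\<And>x y. A \<le> x \<Longrightarrow> x \<le> y \<Longrightarrow> y \<le> B \<Longrightarrow> 0 \<le> integral {x..y} k"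
    and \<psi>: "continuous_on {A..B} \<psi>" "\<And>x. x \<in> {A..B} \<Longrightarrow> 0 \<le> \<psi> x"
  shows "0 \<le> integral {A..B} (\<lambda>x. k x * \<psi> x)"
proof -
  define h where "h x = k x * \<psi> x" for x
  have hai: "h absolutely_integrable_on {A..B}"
    unfolding h_def by (rule ai_mult_continuous[OF k \<psi>(1)])
  have pH: "primitive_on A B (\<lambda>x. integral {A..x} h) h" using primitive_on_integral[OF hai, of 0] by simp
  have mai: "(\<lambda>x. \<bar>k x\<bar>) absolutely_integrable_on {A..B}" using k by (rule set_integrable_abs)
  have pM: "primitive_on A B (\<lambda>x. integral {A..x} (\<lambda>x. \<bar>k x\<bar>)) (\<lambda>x. \<bar>k x\<bar>)"
    using primitive_on_integral[OF mai, of 0] by simp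
  have "integral {A..A} h \<le> integral {A..B} h"
  proof (rule increments_nonneg[OF \<open>A \<le> B\<close>, where H="\<lambda>x. integral {A..x} h" and M="\<lambda>x. integral {A..x} (\<lambda>x. \<bar>k x\<bar>)"])
    fix \<epsilon> :: real assume "\<epsilon> > 0"
    obtain d where d: "d > 0" "\<And>x y. \<lbrakk>x \<in> {A..B}; y \<in> {A..B}; dist y x < d\<rbrakk> \<Longrightarrow> dist (\<psi> y) (\<psi> x) < \<epsilon>"
      using uniformly_continuous_onE[OF compact_uniformly_continuous[OF \<psi>(1) compact_Icc] \<open>\<epsilon> > 0\<close>]
      by metis
    have "- \<epsilon> * (integral {A..y} (\<lambda>x. \<bar>k x\<bar>) - integral {A..x} (\<lambda>x. \<bar>k x\<bar>))
        \<le> integral {A..y} h - integral {A..x} h"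
      if xy: "A \<le> x \<and> x \<le> y \<and> y \<le> B \<and> y - x < d" for x y
    proof -
      have sub: "f integrable_on {x..y}" if "f absolutely_integrable_on {A..B}" for f :: "real \<Rightarrow> real"
        using ai_subinterval[where f=f and A=A and B=B and x=x and y=y] that xy
        by (auto intro: ai_integrable)
      have i1: "(\<lambda>t. \<psi> x * k t) integrable_on {x..y}" by (rule integrable_on_mult_right[OF sub[OF k]])
      have i2: "(\<lambda>t. \<epsilon> * \<bar>k t\<bar>) integrable_on {x..y}" by (rule integrable_on_mult_right[OF sub[OF mai]])
      have "- \<epsilon> * integral {x..y} (\<lambda>x. \<bar>k x\<bar>) \<le> \<psi> x * integral {x..y} k - \<epsilon> * integral {x..y} (\<lambda>x. \<bar>k x\<bar>)"
        using nn[of x y] \<psi>(2)[of x] xy by auto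
      also have "\<dots> = integral {x..y} (\<lambda>t. \<psi> x * k t - \<epsilon> * \<bar>k t\<bar>)"
        by (subst integral_diff[OF i1 i2]) simp
      also have "\<dots> \<le> integral {x..y} h"
      proof (rule integral_le[OF integrable_diff[OF i1 i2] sub[OF hai]])
        fix t assume t: "t \<in> {x..y}"
        have "\<bar>k t * (\<psi> t - \<psi> x)\<bar> \<le> \<bar>k t\<bar> * \<epsilon>"
          unfolding abs_mult using d(2)[of x t] t xy by (intro mult_left_mono) (auto simp: dist_real_def)
        then have "- (\<bar>k t\<bar> * \<epsilon>) \<le> k t * (\<psi> t - \<psi> x)" by (simp add: abs_le_iff)
        then show "\<psi> x * k t - \<epsilon> * \<bar>k t\<bar> \<le> h t"
          by (simp add: h_def algebra_simps)
      qed
      finally show ?thesis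
        using primitive_on_diff[OF pH, of x y] primitive_on_diff[OF pM, of x y] xy by simp
    qed
    then show "\<exists>\<delta>>0. \<forall>x y. A \<le> x \<and> x \<le> y \<and> y \<le> B \<and> y - x < \<delta> \<longrightarrow>
      - \<epsilon> * (integral {A..y} (\<lambda>x. \<bar>k x\<bar>) - integral {A..x} (\<lambda>x. \<bar>k x\<bar>)) \<le> integral {A..y} h - integral {A..x} h"
      using d(1) by (intro exI[of _ d] conjI allI impI) auto
  qed
  then show ?thesis unfolding h_def by simp
qed

text \<open>The indicator function of the set where \<open>k < 0\<close> is almost everywhere a limit of continuous
  functions, which reduces the claim to integrals against continuous functions.\<close>
lemma nonneg_of_integral_nonneg:
  fixes k :: "real \<Rightarrow> real"
  assumes k: "k absolutely_integrable_on {A..B}"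
    and nn: "\<And>x y. A \<le> x \<Longrightarrow> x \<le> y \<Longrightarrow> y \<le> B \<Longrightarrow> 0 \<le> integral {x..y} k"
  shows "negligible {x \<in> {A..B}. k x < 0}"
proof (cases "A \<le> B")
  case True
  define S where "S = {x \<in> {A..B}. k x < 0}"
  have meas: "k \<in> borel_measurable (lebesgue_on {A..B})"
    using k by (intro absolutely_integrable_imp_borel_measurable) auto
  have "{x \<in> space (lebesgue_on {A..B}). k x < 0} \<in> sets (lebesgue_on {A..B})"
    using meas by measurable
  then have S: "S \<in> sets (lebesgue_on {A..B})" by (simp add: S_def)
  then have Sl: "S \<in> sets lebesgue"
    using sets_restrict_space_iff[of "{A..B}" lebesgue S] by auto
  have "indicat_real S \<in> borel_measurable lebesgue" using Sl by (rule borel_measurable_indicator)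
  then have "indicat_real S \<in> borel_measurable (lebesgue_on UNIV)" by simp
  then have "(indicat_real S) measurable_on UNIV"
    by (subst measurable_on_iff_borel_measurable) auto
  then obtain N F where N: "negligible N" and Fc: "\<And>n. continuous_on UNIV (F n)"
      and F: "\<And>x. x \<notin> N \<Longrightarrow> (\<lambda>n. F n x) \<longlonglongrightarrow> indicat_real S x"
    unfolding measurable_on_def by auto
  \<comment> \<open>Clipping to \<open>[0, 1]\<close> does not disturb the limit, which is an
    indicator, and makes the modulus of \<open>k\<close> a dominating function.\<close>
  define G where "G n x = max 0 (min 1 (F n x))" for n x
  have Gc: "continuous_on {A..B} (G n)" for n
    unfolding G_def using continuous_on_subset[OF Fc[of n], of "{A..B}"] by (auto intro!: continuous_intros)
  have G01: "0 \<le> G n x" "G n x \<le> 1" for n x by (auto simp: G_def)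
  have Glim: "(\<lambda>n. G n x) \<longlonglongrightarrow> indicat_real S x" if "x \<notin> N" for x
  proof -
    have "(\<lambda>n. max 0 (min 1 (F n x))) \<longlonglongrightarrow> max 0 (min 1 (indicat_real S x))"
      using F[OF that] by (intro tendsto_intros)
    then show ?thesis by (simp add: G_def[abs_def] indicator_def split: if_splits)
  qed
  define f where "f n x = (if x \<in> N then 0 else k x * G n x)" for n x
  have kG: "(\<lambda>x. k x * G n x) absolutely_integrable_on {A..B}" for n
    by (rule ai_mult_continuous[OF k Gc])
  have fint: "f n integrable_on {A..B}" for n
    by (rule integrable_spike[OF ai_integrable[OF kG[of n]] N]) (auto simp: f_def)
  have feq: "integral {A..B} (f n) = integral {A..B} (\<lambda>x. k x * G n x)" for n
    by (rule integral_spike[OF N]) (auto simp: f_def)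
  define g where "g x = (if x \<in> N then 0 else k x * indicat_real S x)" for x
  have fle: "norm (f n x) \<le> \<bar>k x\<bar>" for n x
    using G01[of n x] by (auto simp: f_def abs_mult intro!: mult_left_le)
  have flim: "(\<lambda>n. f n x) \<longlonglongrightarrow> g x" for x
    using Glim[of x] by (auto simp: f_def g_def intro!: tendsto_intros)
  note dc = dominated_convergence[where f=f and h="\<lambda>x. \<bar>k x\<bar>", OF fint
    ai_integrable[OF set_integrable_abs[OF k]] fle flim]
  have "0 \<le> integral {A..B} g"
    by (rule LIMSEQ_le_const[OF dc(2)])
       (use feq integral_mult_nonneg[OF k True nn Gc G01(1)] in auto)
  \<comment> \<open>Off \<open>N\<close>, \<open>g\<close> is \<open>k\<close> where
    \<open>k < 0\<close> and zero elsewhere; a nonpositive function with nonnegative integral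
    vanishes almost everywhere.\<close>
  moreover have gle: "g x \<le> 0" for x by (auto simp: g_def S_def indicator_def)
  then have "integral {A..B} g \<le> 0" using integral_le[OF dc(1) integrable_0] by auto
  ultimately have g0: "integral {A..B} (\<lambda>x. - g x) = 0" by simp
  have "(\<lambda>x. - g x) absolutely_integrable_on {A..B}"
    using dc(1) gle by (intro nonnegative_absolutely_integrable_1 integrable_neg) auto
  then have gi: "integrable (lebesgue_on {A..B}) (\<lambda>x. - g x)"
    by (rule absolutely_integrable_imp_integrable) auto
  then have "integral\<^sup>L (lebesgue_on {A..B}) (\<lambda>x. - g x) = 0"
    using g0 lebesgue_integral_eq_integral[OF gi] by simp
  then have "AE x in lebesgue_on {A..B}. - g x = 0"
    using gi gle by (subst (asm) integral_nonneg_eq_0_iff_AE) auto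
  then have "AE x in lebesgue. x \<in> {A..B} \<longrightarrow> g x = 0"
    by (simp add: AE_restrict_space_iff)
  then obtain N' where N': "N' \<in> null_sets lebesgue" "{x. \<not> (x \<in> {A..B} \<longrightarrow> g x = 0)} \<subseteq> N'"
    unfolding eventually_ae_filter by auto
  then have "negligible (N \<union> N')" using N by (intro negligible_Un) (simp_all add: negligible_iff_null_sets)
  then show ?thesis
  proof (rule negligible_subset, intro subsetI)
    fix x assume x: "x \<in> {x \<in> {A..B}. k x < 0}"
    show "x \<in> N \<union> N'"
    proof (rule ccontr)
      assume *: "x \<notin> N \<union> N'"
      then have "g x = 0" using N'(2) x by auto
      then show False using x * by (simp add: g_def S_def)
    qed
  qed
qed auto

lemma zero_of_integral_zero:
  fixes k :: "real \<Rightarrow> real"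
  assumes k: "k absolutely_integrable_on {A..B}"
    and z: "\<And>x y. A \<le> x \<Longrightarrow> x \<le> y \<Longrightarrow> y \<le> B \<Longrightarrow> integral {x..y} k = 0"
  shows "negligible {x \<in> {A..B}. k x \<noteq> 0}"
proof -
  have "negligible {x \<in> {A..B}. k x < 0}"
    using z by (intro nonneg_of_integral_nonneg[OF k]) auto
  moreover have "negligible {x \<in> {A..B}. - k x < 0}"
    using z set_integrable_mult_right[of "-1" lebesgue "{A..B}" k] k by (intro nonneg_of_integral_nonneg) auto
  ultimately have "negligible ({x \<in> {A..B}. k x < 0} \<union> {x \<in> {A..B}. - k x < 0})" by auto
  then show ?thesis by (rule negligible_subset) auto
qed

lemma primitive_on_unique:
  assumes "primitive_on A B F f" "primitive_on A B F g"
  shows "negligible {x \<in> {A..B}. f x \<noteq> g x}"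
proof -
  have fg: "f absolutely_integrable_on {A..B}" "g absolutely_integrable_on {A..B}"
    using assms primitive_on_ai by auto
  have "negligible {x \<in> {A..B}. f x - g x \<noteq> 0}"
  proof (rule zero_of_integral_zero)
    show "(\<lambda>x. f x - g x) absolutely_integrable_on {A..B}" using fg by auto
    fix x y assume xy: "A \<le> x" "x \<le> y" "y \<le> B"
    have "f integrable_on {x..y}" "g integrable_on {x..y}"
      using ai_integrable[OF ai_subinterval[OF fg(1) xy(1,3)]]
        ai_integrable[OF ai_subinterval[OF fg(2) xy(1,3)]] by auto
    from integral_diff[OF this] show "integral {x..y} (\<lambda>x. f x - g x) = 0"
      unfolding primitive_on_diff[OF assms(1) xy, symmetric] primitive_on_diff[OF assms(2) xy, symmetric]
      by simp
  qed
  then show ?thesis by simp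
qed

text \<open>The density is the Radon-Nikodym derivative of the push-forward of Lebesgue measure under the
  inverse of the bi-Lipschitz function \<open>x \<mapsto> a x + (K + 1) * x\<close>.\<close>
lemma lipschitz_primitive:
  fixes a :: "real \<Rightarrow> real"
  assumes "A < B" and lip: "\<And>x y. x \<in> {A..B} \<Longrightarrow> y \<in> {A..B} \<Longrightarrow> \<bar>a x - a y\<bar> \<le> K * \<bar>x - y\<bar>"
  obtains b where "primitive_on A B a b" "b \<in> borel_measurable borel" "\<And>x. \<bar>b x\<bar> \<le> K"
proof -
  have "0 \<le> K * \<bar>A - B\<bar>" using lip[of A B] \<open>A < B\<close> by auto
  then have K: "K \<ge> 0" using \<open>A < B\<close> by (simp add: zero_le_mult_iff)
  \<comment> \<open>Clamping extends \<open>a\<close> from \<open>[A, B]\<close> to the whole line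
    with the same Lipschitz constant.\<close>
  define c where "c x = max A (min B x)" for x
  have cAB: "c x \<in> {A..B}" for x using \<open>A < B\<close> by (auto simp: c_def)
  have cid: "c x = x" if "x \<in> {A..B}" for x using that by (auto simp: c_def)
  have clip: "\<bar>c x - c y\<bar> \<le> \<bar>x - y\<bar>" for x y using \<open>A < B\<close> by (auto simp: c_def)
  \<comment> \<open>The slope \<open>K + 1\<close> exceeds the steepest descent of \<open>a\<close>
    by 1: increments of \<open>F\<close> lie between 1 and \<open>2 * K + 1\<close> times those of
    the argument.\<close>
  define F where "F x = a (c x) + (K + 1) * x" for x
  have ac: "\<bar>a (c x) - a (c y)\<bar> \<le> K * \<bar>x - y\<bar>" for x y
    using lip[OF cAB cAB, of x y] mult_left_mono[OF clip K, of x y] by linarith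
  have Fl: "y - x \<le> F y - F x" and Fu: "F y - F x \<le> (2 * K + 1) * (y - x)" if "x \<le> y" for x y
    using ac[of x y] that by (auto simp: F_def abs_le_iff algebra_simps)
  have Flip: "\<bar>F y - F x\<bar> \<le> (2 * K + 1) * \<bar>y - x\<bar>" for x y
    using Fl[of x y] Fu[of x y] Fl[of y x] Fu[of y x] by (cases "x \<le> y") (auto simp: abs_if algebra_simps)
  have Fcont: "continuous_on UNIV F"
    by (rule lipschitz_on_continuous_on[where L="2 * K + 1"])
      (use K Flip in \<open>auto intro!: lipschitz_onI simp: dist_real_def\<close>)
  have mono: "F x \<le> F y \<longleftrightarrow> x \<le> y" for x y
    using Fl[of x y] Fl[of y x] by (cases "x \<le> y") auto
  have inj: "inj F" by (rule injI) (metis mono order_antisym order_refl)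
  have "\<exists>x. F x = z" for z
  proof -
    define w where "w = \<bar>F 0\<bar> + \<bar>z\<bar>"
    have "0 \<le> w" by (simp add: w_def)
    then have "F (- w) \<le> z" "z \<le> F w" using Fl[of "-w" 0] Fl[of 0 w] unfolding w_def by linarith+
    then show ?thesis
      using IVT'[of F "-w" z w] continuous_on_subset[OF Fcont, of "{-w..w}"] \<open>0 \<le> w\<close> by auto
  qed
  then have surj: "surj F" by (metis surjI)
  define G where "G = inv F"
  have FG: "F (G z) = z" and GF: "G (F x) = x" for z x
    using surj inj by (auto simp: G_def surj_f_inv_f)
  have "continuous_on UNIV G"
  proof (rule lipschitz_on_continuous_on[where L=1], rule lipschitz_onI)
    show "dist (G x) (G y) \<le> 1 * dist x y" for x y
      using Fl[of "G x" "G y"] Fl[of "G y" "G x"] by (cases "G x \<le> G y") (auto simp: FG dist_real_def)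
  qed auto
  then have Gm [measurable]: "G \<in> borel_measurable borel" by (rule borel_measurable_continuous_onI)
  have vimage: "G -` X = F ` X" for X using FG GF by (auto simp: image_iff vimage_def) metis
  define \<nu> where "\<nu> = distr lborel borel G"
  have em: "emeasure \<nu> X = emeasure lborel (F ` X)" and FX: "F ` X \<in> sets borel" if "X \<in> sets borel" for X
    using that measurable_sets[OF Gm that] by (auto simp: \<nu>_def emeasure_distr vimage)
  \<comment> \<open>\<open>\<nu>\<close> measures a Borel set by the Lebesgue measure of its image
    under \<open>F\<close>, and Lipschitz images of null sets are null.\<close>
  have "absolutely_continuous lborel \<nu>"
    unfolding absolutely_continuous_def
  proof
    fix X :: "real set" assume X: "X \<in> null_sets lborel"
    then have "X \<in> null_sets lebesgue" by (rule null_sets_completionI)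
    then have "negligible X" by (simp add: negligible_iff_null_sets)
    have lX: "\<exists>T B. open T \<and> x \<in> T \<and> (\<forall>y\<in>X \<inter> T. norm (F y - F x) \<le> B * norm (y - x))" for x
      by (rule exI[of _ UNIV], rule exI[of _ "2 * K + 1"]) (use Flip in simp)
    have "negligible (F ` X)"
      by (rule negligible_locally_Lipschitz_image[OF order_refl \<open>negligible X\<close> lX])
    moreover have Xb: "X \<in> sets borel" using X by auto
    have "F ` X \<in> sets borel" by (rule FX[OF Xb])
    ultimately have "emeasure lborel (F ` X) = 0"
      using \<open>F ` X \<in> sets borel\<close> null_sets_completion_iff[of "F ` X" lborel] by (auto simp: negligible_iff_null_sets)
    then show "X \<in> null_sets \<nu>"
      using em[OF Xb] Xb by (simp add: null_sets_def) (simp add: \<nu>_def)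
  qed
  then obtain f where f: "f \<in> borel_measurable lborel" "density lborel f = \<nu>"
    using sigma_finite_measure.Radon_Nikodym[OF sigma_finite_lborel, of \<nu>] by (auto simp: \<nu>_def)
  have fm [measurable]: "f \<in> borel_measurable borel" using f(1) by simp
  have fint: "(\<integral>\<^sup>+t. f t * indicator {x..y} t \<partial>lborel) = ennreal (F y - F x)" if "x \<le> y" for x y
  proof -
    have "F ` {x..y} = {F x..F y}"
    proof (intro equalityI subsetI)
      fix z assume z: "z \<in> {F x..F y}"
      then have "G z \<in> {x..y}" using mono[of x "G z"] mono[of "G z" y] by (simp add: FG)
      then show "z \<in> F ` {x..y}" using FG[of z] by (metis image_eqI)
    qed (use mono in auto)
    moreover have "F x \<le> F y" using mono that by blast
    ultimately have "emeasure \<nu> {x..y} = ennreal (F y - F x)"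
      using em[of "{x..y}"] by (simp only: emeasure_lborel_Icc atLeastAtMost_borel)
    moreover have "emeasure \<nu> {x..y} = (\<integral>\<^sup>+t. f t * indicator {x..y} t \<partial>lborel)"
      unfolding f(2)[symmetric] by (rule emeasure_density[OF f(1)]) simp
    ultimately show ?thesis by simp
  qed
  define r where "r t = enn2real (f t)" for t
  have rm [measurable]: "r \<in> borel_measurable borel" unfolding r_def by measurable
  \<comment> \<open>The density may be infinite, but only on a null subset of \<open>[A, B]\<close>,
    where its integral is finite.\<close>
  have "AE t in lborel. f t * indicator {A..B} t \<noteq> \<infinity>"
    using fint[of A B] \<open>A < B\<close> by (intro nn_integral_PInf_AE) auto
  then have fin: "AE t in lborel. t \<in> {A..B} \<longrightarrow> f t = ennreal (r t)"
    by eventually_elim (auto simp: r_def indicator_def less_top)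
  have rint: "(r has_integral F y - F x) {x..y}" if "A \<le> x" "x \<le> y" "y \<le> B" for x y
  proof -
    have "(\<integral>\<^sup>+t. ennreal (indicator {x..y} t * r t) \<partial>lborel) = (\<integral>\<^sup>+t. f t * indicator {x..y} t \<partial>lborel)"
      by (rule nn_integral_cong_AE, use fin in eventually_elim) (use that in \<open>auto simp: indicator_def\<close>)
    also have "\<dots> = ennreal (F y - F x)" using fint that by auto
    finally have "((\<lambda>t. indicator {x..y} t * r t) has_integral F y - F x) UNIV"
      using that mono by (intro nn_integral_has_integral) (auto simp: r_def)
    then have "((\<lambda>t. if t \<in> {x..y} then r t else 0) has_integral F y - F x) UNIV"
      by (rule has_integral_eq[rotated]) (auto simp: indicator_def)
    then show ?thesis by (simp only: has_integral_restrict_UNIV)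
  qed
  define b0 where "b0 t = r t - (K + 1)" for t
  have b0int: "(b0 has_integral a y - a x) {x..y}" if "A \<le> x" "x \<le> y" "y \<le> B" for x y
  proof -
    have "(b0 has_integral (F y - F x) - (K + 1) * (y - x)) {x..y}"
      unfolding b0_def using that has_integral_const_real[of "K + 1" x y]
      by (intro has_integral_diff rint) (auto simp: mult.commute)
    then show ?thesis using that by (simp add: F_def cid algebra_simps)
  qed
  have rai: "r absolutely_integrable_on {A..B}"
    using rint[of A B] \<open>A < B\<close> by (intro nonnegative_absolutely_integrable_1) (auto simp: r_def integrable_on_def)
  then have b0ai: "b0 absolutely_integrable_on {A..B}"
    unfolding b0_def by (intro set_integral_diff) (auto intro: absolutely_integrable_continuous_real)
  have b0p: "primitive_on A B a b0"
    unfolding primitive_on_def using b0ai b0int integral_unique by auto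
  \<comment> \<open>The means of \<open>b0\<close> over intervals are difference quotients of
    \<open>a\<close>, hence at most \<open>K\<close> in modulus;
    \<open>nonneg_of_integral_nonneg\<close> turns this into a bound almost everywhere, and
    truncation into one everywhere.\<close>
  have "negligible {t \<in> {A..B}. K - b0 t < 0}"
  proof (rule nonneg_of_integral_nonneg)
    show "(\<lambda>t. K - b0 t) absolutely_integrable_on {A..B}"
      using b0ai by (intro set_integral_diff) (auto intro: absolutely_integrable_continuous_real)
    fix x y assume xy: "A \<le> x" "x \<le> y" "y \<le> B"
    have "((\<lambda>t. K - b0 t) has_integral K * (y - x) - (a y - a x)) {x..y}"
      using xy has_integral_const_real[of K x y] by (intro has_integral_diff b0int) (auto simp: mult.commute)
    then show "0 \<le> integral {x..y} (\<lambda>t. K - b0 t)"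
      using lip[of x y] xy by (simp add: integral_unique abs_le_iff algebra_simps)
  qed
  moreover have "negligible {t \<in> {A..B}. K + b0 t < 0}"
  proof (rule nonneg_of_integral_nonneg)
    show "(\<lambda>t. K + b0 t) absolutely_integrable_on {A..B}"
      using b0ai by (intro set_integral_add) (auto intro: absolutely_integrable_continuous_real)
    fix x y assume xy: "A \<le> x" "x \<le> y" "y \<le> B"
    have "((\<lambda>t. K + b0 t) has_integral K * (y - x) + (a y - a x)) {x..y}"
      using xy has_integral_const_real[of K x y] by (intro has_integral_add b0int) (auto simp: mult.commute)
    then show "0 \<le> integral {x..y} (\<lambda>t. K + b0 t)"
      using lip[of x y] xy by (simp add: integral_unique abs_le_iff algebra_simps)
  qed
  ultimately have N: "negligible ({t \<in> {A..B}. K - b0 t < 0} \<union> {t \<in> {A..B}. K + b0 t < 0})" by auto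
  define b where "b t = max (- K) (min K (b0 t))" for t
  have "primitive_on A B a b"
    by (rule primitive_on_spike[OF b0p N]) (auto simp: b_def)
  moreover have "b \<in> borel_measurable borel" unfolding b_def b0_def by measurable
  moreover have "\<bar>b x\<bar> \<le> K" for x using K by (auto simp: b_def)
  ultimately show ?thesis by (rule that)
qed

section \<open>Weak derivatives on an interval\<close>

lemma AE_lebesgue_on_negligible:
  assumes "S \<in> sets lebesgue"
  shows "(AE x in lebesgue_on S. P x) \<longleftrightarrow> negligible {x \<in> S. \<not> P x}"
proof -
  have "(AE x in lebesgue_on S. P x) \<longleftrightarrow> (AE x in lebesgue. x \<in> S \<longrightarrow> P x)"
    using assms by (simp add: AE_restrict_space_iff)
  also have "\<dots> \<longleftrightarrow> {x. \<not> (x \<in> S \<longrightarrow> P x)} \<in> null_sets lebesgue"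
  proof
    assume "AE x in lebesgue. x \<in> S \<longrightarrow> P x"
    then obtain N where "N \<in> null_sets lebesgue" "{x. \<not> (x \<in> S \<longrightarrow> P x)} \<subseteq> N"
      unfolding eventually_ae_filter by auto
    then show "{x. \<not> (x \<in> S \<longrightarrow> P x)} \<in> null_sets lebesgue"
      by (metis negligible_iff_null_sets negligible_subset)
  qed (auto intro: AE_I')
  also have "{x. \<not> (x \<in> S \<longrightarrow> P x)} = {x \<in> S. \<not> P x}" by auto
  finally show ?thesis by (simp add: negligible_iff_null_sets)
qed

lemma continuous_eq_of_AE_eq:
  fixes F G :: "real \<Rightarrow> real"
  assumes "A < B" "continuous_on {A..B} F" "continuous_on {A..B} G"
    and neg: "negligible {x \<in> {A..B}. F x \<noteq> G x}" and x: "x \<in> {A..B}"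
  shows "F x = G x"
proof -
  have c: "continuous_on {A..B} (\<lambda>x. \<bar>F x - G x\<bar>)" using assms by (intro continuous_intros)
  have "integral {A..B} (\<lambda>x. \<bar>F x - G x\<bar>) = integral {A..B} (\<lambda>x. 0)"
    by (rule integral_spike[OF neg]) auto
  then have "integral {A..B} (\<lambda>x. \<bar>F x - G x\<bar>) = 0" by simp
  then have "\<forall>x\<in>{A..B}. \<bar>F x - G x\<bar> = 0"
    using integral_eq_0_iff[OF c \<open>A < B\<close>] by simp
  then show ?thesis using x by auto
qed

section \<open>Smoothed step functions and the du Bois-Reymond lemma\<close>

definition linear_step :: "real \<Rightarrow> real \<Rightarrow> real" where
  "linear_step \<epsilon> x = (max 0 x - max 0 (x - \<epsilon>)) / \<epsilon>"

text \<open>The antiderivative of \<open>linear_step \<epsilon>\<close> that vanishes on the left.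
  Squares of positive parts are continuously differentiable, so suitable combinations of ramps are
  admissible test functions.\<close>

definition C1_ramp :: "real \<Rightarrow> real \<Rightarrow> real" where
  "C1_ramp \<epsilon> x = ((max 0 x)\<^sup>2 - (max 0 (x - \<epsilon>))\<^sup>2) / (2 * \<epsilon>)"

lemma has_derivative_square_pos_part:
  "((\<lambda>x. (max 0 x)\<^sup>2) has_real_derivative 2 * max 0 x) (at x)" for x :: real
proof -
  consider "x < 0" | "x > 0" | "x = 0" by linarith
  then show ?thesis
  proof cases
    case 1
    have "((\<lambda>x. 0) has_real_derivative 2 * max 0 x) (at x)" using 1 by simp
    then show ?thesis
      by (rule has_field_derivative_transform_within_open[where S="{..<0}"]) (use 1 in auto)
  next
    case 2
    have "((\<lambda>x. x\<^sup>2) has_real_derivative 2 * max 0 x) (at x)"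
      using 2 by (auto intro!: derivative_eq_intros)
    then show ?thesis
      by (rule has_field_derivative_transform_within_open[where S="{0<..}"]) (use 2 in auto)
  next
    case 3
    have "((\<lambda>y. ((max 0 (0 + y))\<^sup>2 - (max 0 0)\<^sup>2) / y) \<longlongrightarrow> (0::real)) (at 0)"
    proof (rule Lim_null_comparison)
      show "\<forall>\<^sub>F y in at 0. norm (((max 0 (0 + y))\<^sup>2 - (max 0 0)\<^sup>2) / y) \<le> \<bar>y\<bar>"
        for y :: real
        by (intro always_eventually allI) (auto simp: max_def power2_eq_square)
      show "((\<lambda>y. \<bar>y\<bar>) \<longlongrightarrow> (0::real)) (at 0)" by (auto intro!: tendsto_eq_intros)
    qed
    then show ?thesis using 3 by (simp add: DERIV_def)
  qed
qed

lemma DERIV_translate: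
  fixes f :: "real \<Rightarrow> real"
  assumes "(f has_real_derivative D) (at (x - t))"
  shows "((\<lambda>x. f (x - t)) has_real_derivative D) (at x)"
proof -
  have "((\<lambda>x. x - t) has_real_derivative 1) (at x)" by (auto intro!: derivative_eq_intros)
  from DERIV_chain2[OF assms this] show ?thesis by simp
qed

lemma C1_ramp_deriv:
  assumes "\<epsilon> > 0"
  shows "(C1_ramp \<epsilon> has_real_derivative linear_step \<epsilon> x) (at x)"
proof -
  have "((\<lambda>x. (max 0 (x - \<epsilon>))\<^sup>2) has_real_derivative 2 * max 0 (x - \<epsilon>)) (at x)"
    by (rule DERIV_translate[OF has_derivative_square_pos_part])
  from DERIV_cdivide[OF DERIV_diff[OF has_derivative_square_pos_part[of x] this], of "2 * \<epsilon>"]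
  show ?thesis
    unfolding C1_ramp_def[abs_def] linear_step_def right_diff_distrib[symmetric]
      mult_divide_mult_cancel_left[OF zero_neq_numeral[symmetric]] .
qed

lemma linear_step_continuous: "\<epsilon> > 0 \<Longrightarrow> continuous_on S (linear_step \<epsilon>)"
  unfolding linear_step_def[abs_def] by (intro continuous_intros) auto

lemma linear_step_bounds: "\<epsilon> > 0 \<Longrightarrow> 0 \<le> linear_step \<epsilon> x" "\<epsilon> > 0 \<Longrightarrow> linear_step \<epsilon> x \<le> 1"
  by (auto simp: linear_step_def max_def)

lemma linear_step_eq: "\<epsilon> > 0 \<Longrightarrow> x \<le> 0 \<Longrightarrow> linear_step \<epsilon> x = 0" "\<epsilon> > 0 \<Longrightarrow> x \<ge> \<epsilon> \<Longrightarrow> linear_step \<epsilon> x = 1"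
  by (auto simp: linear_step_def max_def)

lemma C1_ramp_eq: "\<epsilon> > 0 \<Longrightarrow> x \<le> 0 \<Longrightarrow> C1_ramp \<epsilon> x = 0"
  "\<epsilon> > 0 \<Longrightarrow> x \<ge> \<epsilon> \<Longrightarrow> C1_ramp \<epsilon> x = x - \<epsilon> / 2"
  by (auto simp: C1_ramp_def max_def power2_eq_square field_simps)

lemma linear_step_tendsto:
  assumes e: "\<And>n. \<epsilon> n > 0" "\<epsilon> \<longlonglongrightarrow> 0"
  shows "(\<lambda>n. linear_step (\<epsilon> n) x) \<longlonglongrightarrow> (if 0 < x then 1 else 0)"
proof (cases "0 < x")
  case True
  have "\<forall>\<^sub>F n in sequentially. \<epsilon> n < x" using order_tendstoD(2)[OF e(2) True] .
  then have "\<forall>\<^sub>F n in sequentially. linear_step (\<epsilon> n) x = 1"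
    by eventually_elim (use e linear_step_eq in auto)
  then show ?thesis using True by (simp add: tendsto_eventually)
qed (use e linear_step_eq in \<open>auto simp: not_less\<close>)

lemma integral_linear_step_tendsto:
  fixes F :: "real \<Rightarrow> real"
  assumes F: "F absolutely_integrable_on {A..B}" and p: "A \<le> p" "p \<le> B"
    and e: "\<And>n. \<epsilon> n > 0" "\<epsilon> \<longlonglongrightarrow> 0"
  shows "(\<lambda>n. integral {A..B} (\<lambda>x. F x * linear_step (\<epsilon> n) (x - p))) \<longlonglongrightarrow> integral {p..B} F"
proof -
  have cs: "continuous_on {A..B} (\<lambda>x. linear_step (\<epsilon> n) (x - p))" for n
    by (rule continuous_on_compose2[OF linear_step_continuous[OF e(1), of UNIV]]) (auto intro!: continuous_intros)
  have "(\<lambda>n. integral {A..B} (\<lambda>x. F x * linear_step (\<epsilon> n) (x - p))) \<longlonglongrightarrow>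
      integral {A..B} (\<lambda>x. F x * (if 0 < x - p then 1 else 0))"
  proof (rule dominated_convergence(2)[where h="\<lambda>x. \<bar>F x\<bar>"])
    show "(\<lambda>x. F x * linear_step (\<epsilon> n) (x - p)) integrable_on {A..B}" for n
      by (rule ai_integrable[OF ai_mult_continuous[OF F cs]])
    show "(\<lambda>x. \<bar>F x\<bar>) integrable_on {A..B}" by (rule ai_integrable[OF set_integrable_abs[OF F]])
    show "norm (F x * linear_step (\<epsilon> n) (x - p)) \<le> \<bar>F x\<bar>" for n x
      using linear_step_bounds[OF e(1), of n "x - p"] by (auto simp: abs_mult intro!: mult_left_le)
    show "(\<lambda>n. F x * linear_step (\<epsilon> n) (x - p)) \<longlonglongrightarrow> F x * (if 0 < x - p then 1 else 0)" for x
      by (intro tendsto_intros linear_step_tendsto e)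
  qed
  also have "integral {A..B} (\<lambda>x. F x * (if 0 < x - p then 1 else 0)) = integral {A..B} (\<lambda>x. if x \<in> {p..B} then F x else 0)"
    by (rule integral_spike[of "{p}"]) auto
  also have "\<dots> = integral {p..B} F" using p by (subst integral_restrict_Int) simp
  finally show ?thesis .
qed

text \<open>The interval is free because functions with a weak derivative are a priori only locally
  integrable, so arguments must run on compact subintervals; for \<open>A = 0\<close> and
  \<open>B = l\<close> this is \<open>test_function l\<close>.\<close>

definition test_function_on :: "real \<Rightarrow> real \<Rightarrow> (real \<Rightarrow> real) \<Rightarrow> (real \<Rightarrow> real) \<Rightarrow> bool" where
  "test_function_on A B \<phi> \<phi>' \<longleftrightarrow>
     (\<forall>x. (\<phi> has_real_derivative \<phi>' x) (at x)) \<and> continuous_on UNIV \<phi>' \<and>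
     (\<exists>c d. A < c \<and> d < B \<and> (\<forall>x. x \<notin> {c..d} \<longrightarrow> \<phi> x = 0))"

text \<open>Derivatives of test functions that approximate the difference of two normalised indicator
  functions show that all means of \<open>F\<close> over subintervals agree.\<close>
lemma constant_of_orthogonal_to_derivatives:
  fixes F :: "real \<Rightarrow> real"
  assumes F: "F absolutely_integrable_on {A..B}" and "A < B"
    and orth: "\<And>\<phi> \<phi>'. test_function_on A B \<phi> \<phi>' \<Longrightarrow> integral {A..B} (\<lambda>x. F x * \<phi>' x) = 0"
  obtains C where "negligible {x \<in> {A..B}. F x \<noteq> C}"
proof -
  have mean: "integral {p..q} F / (q - p) = integral {r..s} F / (s - r)"
    if pq: "A < p" "p < q" "q < B" and rs: "A < r" "r < s" "s < B" for p q r s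
  proof -
    \<comment> \<open>A ramp starting at \<open>t\<close> bends until
      \<open>t + \<epsilon> n\<close>; \<open>\<epsilon> n < d\<close> keeps the support of the test
      function inside \<open>(A, B)\<close>.\<close>
    define d where "d = B - max q s"
    have "d > 0" using pq rs by (simp add: d_def)
    define \<epsilon> where "\<epsilon> n = d / 2 * inverse (real (Suc n))" for n
    have e0: "\<epsilon> n > 0" for n using \<open>d > 0\<close> by (simp add: \<epsilon>_def)
    have ed: "\<epsilon> n < d" for n
    proof -
      have "\<epsilon> n \<le> d / 2 * 1" unfolding \<epsilon>_def using \<open>d > 0\<close>
        by (intro mult_left_mono) (auto simp: field_simps)
      then show ?thesis using \<open>d > 0\<close> by simp
    qed
    have elim: "\<epsilon> \<longlonglongrightarrow> 0"
      unfolding \<epsilon>_def using tendsto_mult[OF tendsto_const LIMSEQ_inverse_real_of_nat, of "d / 2"] by simp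
    define T where "T n t = integral {A..B} (\<lambda>x. F x * linear_step (\<epsilon> n) (x - t))" for n t
    have cs: "continuous_on X (\<lambda>x. linear_step (\<epsilon> n) (x - t))" for n t X
      by (rule continuous_on_compose2[OF linear_step_continuous[OF e0, of UNIV]]) (auto intro!: continuous_intros)
    have eq: "(T n p - T n q) / (q - p) - (T n r - T n s) / (s - r) = 0" for n
    proof -
      \<comment> \<open>To the right of all bends the two differences of ramps are constant, equal
        to \<open>q - p\<close> and \<open>s - r\<close>; both quotients are then 1 and cancel,
        which makes the support compact.\<close>
      define \<phi> where "\<phi> x = (C1_ramp (\<epsilon> n) (x - p) - C1_ramp (\<epsilon> n) (x - q)) / (q - p)
        - (C1_ramp (\<epsilon> n) (x - r) - C1_ramp (\<epsilon> n) (x - s)) / (s - r)" for x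
      define \<phi>' where "\<phi>' x = (linear_step (\<epsilon> n) (x - p) - linear_step (\<epsilon> n) (x - q)) / (q - p)
        - (linear_step (\<epsilon> n) (x - r) - linear_step (\<epsilon> n) (x - s)) / (s - r)" for x
      have sd: "((\<lambda>x. C1_ramp (\<epsilon> n) (x - t)) has_real_derivative linear_step (\<epsilon> n) (x - t)) (at x)" for x t
        by (rule DERIV_translate[OF C1_ramp_deriv[OF e0]])
      have "\<phi> x = 0" if "x \<notin> {min p r..max q s + \<epsilon> n}" for x
      proof (cases "x < min p r")
        case True
        then show ?thesis using pq rs e0[of n] by (simp add: \<phi>_def C1_ramp_eq)
      next
        case False
        then have "x > max q s + \<epsilon> n" using that unfolding atLeastAtMost_iff by linarith
        then show ?thesis using pq rs e0[of n]
          by (simp add: \<phi>_def C1_ramp_eq(2))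
      qed
      moreover have "A < min p r" "max q s + \<epsilon> n < B" using ed[of n] pq rs by (auto simp: d_def)
      moreover have "(\<phi> has_real_derivative \<phi>' x) (at x)" for x
        unfolding \<phi>_def \<phi>'_def by (intro DERIV_diff DERIV_cdivide sd)
      moreover have "continuous_on UNIV \<phi>'"
        unfolding \<phi>'_def using pq rs by (intro continuous_intros cs) auto
      ultimately have "test_function_on A B \<phi> \<phi>'"
        unfolding test_function_on_def by blast
      then have "integral {A..B} (\<lambda>x. F x * \<phi>' x) = 0" by (rule orth)
      moreover have int: "(\<lambda>x. F x * linear_step (\<epsilon> n) (x - t)) integrable_on {A..B}" for t
        by (rule ai_integrable[OF ai_mult_continuous[OF F cs]])
      have "((\<lambda>x. (F x * linear_step (\<epsilon> n) (x - p) - F x * linear_step (\<epsilon> n) (x - q)) / (q - p)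
        - (F x * linear_step (\<epsilon> n) (x - r) - F x * linear_step (\<epsilon> n) (x - s)) / (s - r)) has_integral
        (T n p - T n q) / (q - p) - (T n r - T n s) / (s - r)) {A..B}"
        unfolding T_def by (intro has_integral_diff has_integral_divide integrable_integral int)
      moreover have "(\<lambda>x. (F x * linear_step (\<epsilon> n) (x - p) - F x * linear_step (\<epsilon> n) (x - q)) / (q - p)
        - (F x * linear_step (\<epsilon> n) (x - r) - F x * linear_step (\<epsilon> n) (x - s)) / (s - r)) = (\<lambda>x. F x * \<phi>' x)"
        by (simp add: \<phi>'_def right_diff_distrib fun_eq_iff)
      ultimately show ?thesis by (simp add: integral_unique)
    qed
    have "(\<lambda>n. (T n p - T n q) / (q - p) - (T n r - T n s) / (s - r)) \<longlonglongrightarrow>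
        (integral {p..B} F - integral {q..B} F) / (q - p) - (integral {r..B} F - integral {s..B} F) / (s - r)"
      unfolding T_def using pq rs
      by (intro tendsto_intros integral_linear_step_tendsto F e0 elim) auto
    then have "(integral {p..B} F - integral {q..B} F) / (q - p) - (integral {r..B} F - integral {s..B} F) / (s - r) = 0"
      unfolding eq by (simp add: LIMSEQ_const_iff)
    moreover have pB: "integral {p..q} F + integral {q..B} F = integral {p..B} F"
      using pq ai_integrable[OF ai_subinterval[OF F, of p B]]
      by (intro Henstock_Kurzweil_Integration.integral_combine) auto
    moreover have rB: "integral {r..s} F + integral {s..B} F = integral {r..B} F"
      using rs ai_integrable[OF ai_subinterval[OF F, of r B]]
      by (intro Henstock_Kurzweil_Integration.integral_combine) auto
    moreover have "integral {p..B} F - integral {q..B} F = integral {p..q} F"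
      "integral {r..B} F - integral {s..B} F = integral {r..s} F" using pB rB by linarith+
    ultimately show ?thesis by (simp only: right_minus_eq)
  qed
  define r where "r = A + (B - A) / 3"
  define s where "s = A + (B - A) / 2"
  have rs: "A < r" "r < s" "s < B" using \<open>A < B\<close> by (auto simp: r_def s_def field_simps)
  define C where "C = integral {r..s} F / (s - r)"
  define H where "H x = integral {A..x} F - C * x" for x
  have pF: "primitive_on A B (\<lambda>x. integral {A..x} F) F" using primitive_on_integral[OF F, of 0] by simp
  have FC: "integral {p..q} F = C * (q - p)" if "A < p" "p \<le> q" "q < B" for p q
    using mean[of p q r s] that rs by (cases "p = q") (auto simp: C_def field_simps)
  \<comment> \<open>The means are available for interior intervals only, so \<open>H\<close> is
    first constant on the open interval; continuity of the indefinite integral adds the end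
    points.\<close>
  have Hs: "H x = H s" if "x \<in> {A..B}" for x
  proof (rule continuous_constant_on_closure[where S="{A<..<B}" and f=H and a="H s"])
    show "continuous_on (closure {A<..<B}) H"
      unfolding H_def using \<open>A < B\<close> indefinite_integral_continuous_1[OF ai_integrable[OF F]]
      by (auto intro!: continuous_intros)
    show "H y = H s" if "y \<in> {A<..<B}" for y
    proof (cases "y \<le> s")
      case True
      then show ?thesis using FC[of y s] primitive_on_diff[OF pF, of y s] that rs
        by (auto simp: H_def algebra_simps)
    next
      case False
      then show ?thesis using FC[of s y] primitive_on_diff[OF pF, of s y] that rs
        by (auto simp: H_def algebra_simps)
    qed
  qed (use that \<open>A < B\<close> in auto)
  have "primitive_on A B (\<lambda>x. integral {A..x} F) (\<lambda>x. C)"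
    unfolding primitive_on_def
  proof (intro conjI ballI)
    fix x assume "x \<in> {A..B}"
    then show "integral {A..x} (\<lambda>x. C) = integral {A..x} F - integral {A..A} F"
      using Hs[of x] Hs[of A] \<open>A < B\<close> by (simp add: H_def algebra_simps)
  qed (auto intro: absolutely_integrable_continuous_real)
  from primitive_on_unique[OF pF this] show ?thesis by (rule that)
qed

lemma test_function_deriv_eq_0:
  assumes "\<And>x. (\<phi> has_real_derivative \<phi>' x) (at x)" "\<And>x. x \<notin> {c..d} \<Longrightarrow> \<phi> x = 0" "x \<notin> {c..d}"
  shows "\<phi>' x = 0"
proof -
  have "open (- {c..d})" by (simp add: open_Compl)
  then have "((\<lambda>_. 0) has_real_derivative \<phi>' x) (at x)"
    by (rule has_field_derivative_transform_within_open[OF assms(1)]) (use assms in auto)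
  then show ?thesis using DERIV_const DERIV_unique by blast
qed

lemma integral_eq_on_support:
  fixes h :: "real \<Rightarrow> real"
  assumes "\<And>x. x \<notin> {c..d} \<Longrightarrow> h x = 0" "{c..d} \<subseteq> S"
  shows "integral S h = integral {c..d} h"
proof -
  have "(\<lambda>x. if x \<in> S then h x else 0) = (\<lambda>x. if x \<in> {c..d} then h x else 0)"
    using assms by (auto simp: fun_eq_iff)
  then show ?thesis by (metis integral_restrict_UNIV)
qed

text \<open>The defining identity of weak derivatives is a Lebesgue integral over an open interval
  on which the function itself need not be integrable. The compact support of the test function
  turns it into a gauge integral over a compact interval.\<close>

lemma set_integral_eq_on_support:
  fixes h :: "real \<Rightarrow> real"
  assumes "\<And>x. x \<notin> {c..d} \<Longrightarrow> h x = 0" "{c..d} \<subseteq> S" "h absolutely_integrable_on {c..d}"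
  shows "(LINT x:S|lebesgue. h x) = integral {c..d} h"
proof -
  have "(\<lambda>x. indicat_real S x *\<^sub>R h x) = (\<lambda>x. indicat_real {c..d} x *\<^sub>R h x)"
    using assms(1,2) by (auto simp: fun_eq_iff indicator_def)
  then have "(LINT x:S|lebesgue. h x) = (LINT x:{c..d}|lebesgue. h x)"
    by (simp add: set_lebesgue_integral_def)
  then show ?thesis using set_lebesgue_integral_eq_integral(2)[OF assms(3)] by simp
qed

lemma test_function_onE:
  assumes "test_function_on A B \<phi> \<phi>'"
  obtains c d where "A < c" "d < B" "{c..d} \<subseteq> {A..B}" "\<And>x. x \<notin> {c..d} \<Longrightarrow> \<phi> x = 0" "\<And>x. x \<notin> {c..d} \<Longrightarrow> \<phi>' x = 0"
    "\<And>S. continuous_on S \<phi>" "\<And>S. continuous_on S \<phi>'" "\<And>A B. primitive_on A B \<phi> \<phi>'"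
proof -
  from assms obtain c d where cd: "A < c" "d < B" "\<And>x. x \<notin> {c..d} \<Longrightarrow> \<phi> x = 0"
    and der: "\<And>x. (\<phi> has_real_derivative \<phi>' x) (at x)" and c: "continuous_on UNIV \<phi>'"
    unfolding test_function_on_def by blast
  have c': "continuous_on S \<phi>'" for S using c by (rule continuous_on_subset) simp
  have "continuous_on S \<phi>" for S
    using der by (intro DERIV_continuous_on) (auto intro: DERIV_subset)
  moreover have "primitive_on A B \<phi> \<phi>'" for A B
    by (rule primitive_on_C1[OF _ c']) (auto intro: DERIV_subset[OF der])
  moreover have "{c..d} \<subseteq> {A..B}" using cd by auto
  ultimately show ?thesis
    using that[OF cd(1,2) _ cd(3) test_function_deriv_eq_0[OF der cd(3)]] c' by simp
qed

text \<open>Du Bois-Reymond: integration by parts shows that \<open>f\<close> minus the indefinite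
  integral of \<open>g\<close> is orthogonal to all derivatives of test functions, hence constant
  almost everywhere.\<close>

lemma weak_deriv_imp_primitive:
  assumes ai: "f absolutely_integrable_on {A..B}" "g absolutely_integrable_on {A..B}" and "A < B"
    and weak: "\<And>\<phi> \<phi>'. test_function_on A B \<phi> \<phi>' \<Longrightarrow>
      integral {A..B} (\<lambda>x. f x * \<phi>' x) = - integral {A..B} (\<lambda>x. g x * \<phi> x)"
  obtains C where "negligible {x \<in> {A..B}. f x \<noteq> C + integral {A..x} g}"
proof -
  define G where "G x = integral {A..x} g" for x
  have pG: "primitive_on A B G g" unfolding G_def using primitive_on_integral[OF ai(2), of 0] by simp
  note cG = primitive_on_continuous[OF pG]
  have Gai: "G absolutely_integrable_on {A..B}" using cG by (rule absolutely_integrable_continuous_real)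
  have "(\<lambda>x. f x - G x) absolutely_integrable_on {A..B}" using ai(1) Gai by auto
  then obtain C where "negligible {x \<in> {A..B}. f x - G x \<noteq> C}"
  proof (rule constant_of_orthogonal_to_derivatives[OF _ \<open>A < B\<close>])
    fix \<phi> \<phi>' assume t: "test_function_on A B \<phi> \<phi>'"
    obtain c d where cd: "A < c" "d < B" "\<And>x. x \<notin> {c..d} \<Longrightarrow> \<phi> x = 0"
      and c: "continuous_on {A..B} \<phi>" "continuous_on {A..B} \<phi>'" "primitive_on A B \<phi> \<phi>'"
      by (rule test_function_onE[OF t]) metis
    have "integral {A..B} (\<lambda>x. g x * \<phi> x + G x * \<phi>' x) = 0"
      using integral_product_rule[OF pG c(3)] cd(3)[of A] cd(3)[of B] cd(1,2) \<open>A < B\<close> by simp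
    moreover have i: "(\<lambda>x. g x * \<phi> x) integrable_on {A..B}" "(\<lambda>x. G x * \<phi>' x) integrable_on {A..B}"
      "(\<lambda>x. f x * \<phi>' x) integrable_on {A..B}"
      using ai_integrable[OF ai_mult_continuous[OF ai(2) c(1)]]
        ai_integrable[OF ai_mult_continuous[OF Gai c(2)]]
        ai_integrable[OF ai_mult_continuous[OF ai(1) c(2)]] by auto
    moreover have "integral {A..B} (\<lambda>x. (f x - G x) * \<phi>' x) =
        integral {A..B} (\<lambda>x. f x * \<phi>' x) - integral {A..B} (\<lambda>x. G x * \<phi>' x)"
      using integral_diff[OF i(3,2)] by (simp add: left_diff_distrib)
    ultimately show "integral {A..B} (\<lambda>x. (f x - G x) * \<phi>' x) = 0"
      using weak[OF t] integral_add[OF i(1,2)] by simp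
  qed
  moreover have "{x \<in> {A..B}. f x - G x \<noteq> C} = {x \<in> {A..B}. f x \<noteq> C + integral {A..x} g}"
    by (auto simp: G_def)
  ultimately show ?thesis by (intro that) simp
qed

text \<open>Test functions for a subinterval are test functions for \<open>(0, l)\<close>. The
  interval may be interior, where local integrability is enough, or all of \<open>[0, l]\<close>
  once \<open>f\<close> and \<open>g\<close> are known to be integrable up to the ends.\<close>

lemma has_weak_deriv_imp_primitive:
  assumes w: "has_weak_deriv l f g" and AB: "0 \<le> A" "A < B" "B \<le> l"
    and ai: "f absolutely_integrable_on {A..B}" "g absolutely_integrable_on {A..B}"
  obtains C where "negligible {x \<in> {A..B}. f x \<noteq> C + integral {A..x} g}"
proof (rule weak_deriv_imp_primitive[OF ai AB(2)])
  fix \<phi> \<phi>' assume t: "test_function_on A B \<phi> \<phi>'"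
  obtain c d where cd: "A < c" "d < B" "{c..d} \<subseteq> {A..B}" "\<And>x. x \<notin> {c..d} \<Longrightarrow> \<phi> x = 0" "\<And>x. x \<notin> {c..d} \<Longrightarrow> \<phi>' x = 0"
    and c: "continuous_on {c..d} \<phi>" "continuous_on {c..d} \<phi>'"
    by (rule test_function_onE[OF t]) metis
  have t': "test_function l \<phi> \<phi>'"
  proof -
    have "0 < c" "d < l" using cd AB by auto
    then show ?thesis using t cd(4) unfolding test_function_on_def test_function_def by blast
  qed
  have ai': "f absolutely_integrable_on {c..d}" "g absolutely_integrable_on {c..d}"
    using ai cd absolutely_integrable_on_subinterval by blast+
  have sub: "{c..d} \<subseteq> {0<..<l}" using cd AB by auto
  have "(LINT x:{0<..<l}|lebesgue. f x * \<phi>' x) = integral {c..d} (\<lambda>x. f x * \<phi>' x)"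
    using cd sub ai_mult_continuous[OF ai'(1) c(2)] by (intro set_integral_eq_on_support) auto
  moreover have "(LINT x:{0<..<l}|lebesgue. g x * \<phi> x) = integral {c..d} (\<lambda>x. g x * \<phi> x)"
    using cd sub ai_mult_continuous[OF ai'(2) c(1)] by (intro set_integral_eq_on_support) auto
  moreover have "integral {A..B} (\<lambda>x. f x * \<phi>' x) = integral {c..d} (\<lambda>x. f x * \<phi>' x)"
    using cd by (intro integral_eq_on_support) auto
  moreover have "integral {A..B} (\<lambda>x. g x * \<phi> x) = integral {c..d} (\<lambda>x. g x * \<phi> x)"
    using cd by (intro integral_eq_on_support) auto
  ultimately show "integral {A..B} (\<lambda>x. f x * \<phi>' x) = - integral {A..B} (\<lambda>x. g x * \<phi> x)"
    using w t' unfolding has_weak_deriv_def by simp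
qed (rule that)

text \<open>On a compact subinterval, \<open>f\<close> agrees almost everywhere with a primitive of
  either candidate; the two primitives are continuous, so they coincide and their densities agree.
  Countably many such intervals exhaust \<open>(0, l)\<close>, near whose ends integrability is not
  given.\<close>

lemma has_weak_deriv_unique:
  assumes "has_weak_deriv l f g" "has_weak_deriv l f h"
  shows "negligible {x \<in> {0<..<l}. g x \<noteq> h x}"
proof (cases "0 < l")
  case True
  have "negligible {x \<in> {A..B}. g x \<noteq> h x}" if AB: "0 < A" "A < B" "B < l" for A B
  proof -
    have ai: "f absolutely_integrable_on {A..B}" "g absolutely_integrable_on {A..B}"
        "h absolutely_integrable_on {A..B}"
      using assms AB unfolding has_weak_deriv_def loc_integrable_def by auto
    obtain C where C: "negligible {x \<in> {A..B}. f x \<noteq> C + integral {A..x} g}"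
      using has_weak_deriv_imp_primitive[OF assms(1) _ AB(2) _ ai(1,2)] AB by auto
    obtain D where D: "negligible {x \<in> {A..B}. f x \<noteq> D + integral {A..x} h}"
      using has_weak_deriv_imp_primitive[OF assms(2) _ AB(2) _ ai(1,3)] AB by auto
    have pg: "primitive_on A B (\<lambda>x. C + integral {A..x} g) g" by (rule primitive_on_integral[OF ai(2)])
    have ph: "primitive_on A B (\<lambda>x. D + integral {A..x} h) h" by (rule primitive_on_integral[OF ai(3)])
    have "negligible ({x \<in> {A..B}. f x \<noteq> C + integral {A..x} g} \<union> {x \<in> {A..B}. f x \<noteq> D + integral {A..x} h})"
      using C D by (rule negligible_Un)
    then have neg: "negligible {x \<in> {A..B}. C + integral {A..x} g \<noteq> D + integral {A..x} h}"
      by (rule negligible_subset) auto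
    have "primitive_on A B (\<lambda>x. C + integral {A..x} g) h"
      by (rule primitive_on_cong[OF ph continuous_eq_of_AE_eq[OF AB(2)
        primitive_on_continuous[OF pg] primitive_on_continuous[OF ph] neg]]) auto
    then show ?thesis by (rule primitive_on_unique[OF pg])
  qed note ** = this
  \<comment> \<open>The offset 3 keeps every interval nondegenerate.\<close>
  define I where "I n = {l / (real n + 3)..l - l / (real n + 3)}" for n :: nat
  have "negligible (\<Union>n. {x \<in> I n. g x \<noteq> h x})"
  proof (rule negligible_countable_Union, simp, clarify)
    fix n
    have "l / (real n + 3) * 3 \<le> l"
      using \<open>0 < l\<close> by (simp add: field_simps)
    then show "negligible {x \<in> I n. g x \<noteq> h x}"
      unfolding I_def using divide_pos_pos[OF \<open>0 < l\<close>, of "real n + 3"] by (intro **) linarith+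
  qed
  then show ?thesis
  proof (rule negligible_subset)
    show "{x \<in> {0<..<l}. g x \<noteq> h x} \<subseteq> (\<Union>n. {x \<in> I n. g x \<noteq> h x})"
    proof (clarify)
      fix x assume x: "x \<in> {0<..<l}" "g x \<noteq> h x"
      define m where "m = min x (l - x)"
      have "m > 0" using x by (auto simp: m_def)
      obtain n :: nat where n: "l / m < real n" using reals_Archimedean2 by blast
      then have "l / (real n + 3) \<le> m" using \<open>m > 0\<close> \<open>0 < l\<close> by (simp add: field_simps)
      then have "x \<in> I n" by (auto simp: I_def m_def)
      then show "x \<in> (\<Union>n. {x \<in> I n. g x \<noteq> h x})" using x by auto
    qed
  qed
qed auto

text \<open>Needed because \<open>weak_deriv\<close> returns an unspecified representative, so the
  function that the operator differentiates a second time is known only almost everywhere.\<close>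

lemma has_weak_deriv_cong:
  assumes w: "has_weak_deriv l f g"
    and f: "negligible {x \<in> {0<..<l}. f x \<noteq> f' x}" and g: "negligible {x \<in> {0<..<l}. g x \<noteq> g' x}"
  shows "has_weak_deriv l f' g'"
proof -
  have li: "loc_integrable l k'" if "loc_integrable l k" "negligible {x \<in> {0<..<l}. k x \<noteq> k' x}" for k k' :: "real \<Rightarrow> real"
    unfolding loc_integrable_def
  proof (intro allI impI)
    fix c d :: real assume cd: "0 < c \<and> d < l"
    show "k' absolutely_integrable_on {c..d}"
      by (rule absolutely_integrable_spike[where f=k and T="{c..d}", OF _ that(2)]) (use that(1) cd in \<open>auto simp: loc_integrable_def\<close>)
  qed
  have le: "(LINT x:{0<..<l}|lebesgue. k x * \<psi> x) = (LINT x:{0<..<l}|lebesgue. k' x * \<psi> x)"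
    if "loc_integrable l k" "negligible {x \<in> {0<..<l}. k x \<noteq> k' x}" "continuous_on UNIV \<psi>"
      "0 < c" "d < l" "\<And>x. x \<notin> {c..d} \<Longrightarrow> \<psi> x = 0" for k k' \<psi> c d
  proof -
    have k: "k absolutely_integrable_on {c..d}" "k' absolutely_integrable_on {c..d}"
      using that(1) li[OF that(1,2)] that(4,5) by (auto simp: loc_integrable_def)
    have \<psi>: "continuous_on {c..d} \<psi>" using that(3) by (rule continuous_on_subset) simp
    have "(LINT x:{0<..<l}|lebesgue. k x * \<psi> x) = integral {c..d} (\<lambda>x. k x * \<psi> x)"
      using that(4-6) ai_mult_continuous[OF k(1) \<psi>] by (intro set_integral_eq_on_support) auto
    also have "\<dots> = integral {c..d} (\<lambda>x. k' x * \<psi> x)"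
      by (rule integral_spike[OF that(2)]) (use that(4,5) in auto)
    also have "\<dots> = (LINT x:{0<..<l}|lebesgue. k' x * \<psi> x)"
      using that(4-6) ai_mult_continuous[OF k(2) \<psi>] by (intro set_integral_eq_on_support[symmetric]) auto
    finally show ?thesis .
  qed
  have lf: "loc_integrable l f" and lg: "loc_integrable l g"
    using w by (auto simp: has_weak_deriv_def)
  show ?thesis
    unfolding has_weak_deriv_def
  proof (intro conjI allI impI)
    show "loc_integrable l f'" "loc_integrable l g'" using li lf lg f g by blast+
    fix \<phi> \<phi>' assume t: "test_function l \<phi> \<phi>'"
    then have "test_function_on 0 l \<phi> \<phi>'"
      unfolding test_function_def test_function_on_def .
    then obtain c d where cd: "0 < c" "d < l" "\<And>x. x \<notin> {c..d} \<Longrightarrow> \<phi> x = 0" "\<And>x. x \<notin> {c..d} \<Longrightarrow> \<phi>' x = 0"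
      and c: "continuous_on UNIV \<phi>" "continuous_on UNIV \<phi>'"
      by (rule test_function_onE) metis
    show "(LINT x:{0<..<l}|lebesgue. f' x * \<phi>' x) = - (LINT x:{0<..<l}|lebesgue. g' x * \<phi> x)"
      using w t le[OF lf f c(2) cd(1,2,4)] le[OF lg g c(1) cd(1,2,3)]
      by (auto simp: has_weak_deriv_def)
  qed
qed

lemma primitive_imp_has_weak_deriv:
  assumes p: "primitive_on 0 l f g"
  shows "has_weak_deriv l f g"
  unfolding has_weak_deriv_def
proof (intro conjI allI impI)
  have gai: "g absolutely_integrable_on {0..l}" by (rule primitive_on_ai[OF p])
  have fai: "f absolutely_integrable_on {0..l}"
    by (rule absolutely_integrable_continuous_real[OF primitive_on_continuous[OF p]])
  show "loc_integrable l f" "loc_integrable l g"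
    unfolding loc_integrable_def
    using ai_subinterval[OF fai] ai_subinterval[OF gai] by auto
  fix \<phi> \<phi>' assume "test_function l \<phi> \<phi>'"
  then have "test_function_on 0 l \<phi> \<phi>'"
    unfolding test_function_def test_function_on_def .
  then obtain c d where cd: "0 < c" "d < l" "\<And>x. x \<notin> {c..d} \<Longrightarrow> \<phi> x = 0" "\<And>x. x \<notin> {c..d} \<Longrightarrow> \<phi>' x = 0"
    and c: "continuous_on {c..d} \<phi>" "continuous_on {c..d} \<phi>'"
    and c2: "continuous_on {0..l} \<phi>" "continuous_on {0..l} \<phi>'" and pr2: "primitive_on 0 l \<phi> \<phi>'"
    by (rule test_function_onE) metis
  have ai': "f absolutely_integrable_on {c..d}" "g absolutely_integrable_on {c..d}"
    using ai_subinterval[OF fai, of c d] ai_subinterval[OF gai, of c d] cd by auto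
  have sub: "{c..d} \<subseteq> {0<..<l}" "{c..d} \<subseteq> {0..l}" using cd by auto
  have f1: "(LINT x:{0<..<l}|lebesgue. f x * \<phi>' x) = integral {0..l} (\<lambda>x. f x * \<phi>' x)"
    using cd sub ai_mult_continuous[OF ai'(1) c(2)]
    by (subst set_integral_eq_on_support[where c=c and d=d]; (subst integral_eq_on_support[where c=c and d=d])?) auto
  have g1: "(LINT x:{0<..<l}|lebesgue. g x * \<phi> x) = integral {0..l} (\<lambda>x. g x * \<phi> x)"
    using cd sub ai_mult_continuous[OF ai'(2) c(1)]
    by (subst set_integral_eq_on_support[where c=c and d=d]; (subst integral_eq_on_support[where c=c and d=d])?) auto
  show "(LINT x:{0<..<l}|lebesgue. f x * \<phi>' x) = - (LINT x:{0<..<l}|lebesgue. g x * \<phi> x)"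
  proof (cases "0 \<le> l")
    case True
    have "integral {0..l} (\<lambda>x. g x * \<phi> x + f x * \<phi>' x) = 0"
      using integral_product_rule[OF p pr2 True] cd(3)[of 0] cd(3)[of l] cd(1,2) by simp
    moreover have "(\<lambda>x. g x * \<phi> x) integrable_on {0..l}" "(\<lambda>x. f x * \<phi>' x) integrable_on {0..l}"
      using ai_integrable[OF ai_mult_continuous[OF gai c2(1)]]
        ai_integrable[OF ai_mult_continuous[OF fai c2(2)]] by auto
    ultimately show ?thesis using f1 g1 integral_add[of "\<lambda>x. g x * \<phi> x" "{0..l}" "\<lambda>x. f x * \<phi>' x"] by simp
  qed (simp add: set_lebesgue_integral_def)
qed

section \<open>Bounded measurable functions and Sobolev inequalities\<close>

text \<open>Bounded at every point, not merely essentially: the class is closed under products and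
  consists of absolutely integrable functions, so the bilinear integrands below are integrable
  without recourse to Hoelder's inequality.\<close>

definition bmeas :: "real \<Rightarrow> real \<Rightarrow> (real \<Rightarrow> real) \<Rightarrow> bool" where
  "bmeas A B g \<longleftrightarrow> g \<in> borel_measurable (lebesgue_on {A..B}) \<and> bounded (g ` {A..B})"

lemma bmeasE:
  assumes "bmeas A B g"
  obtains K where "K \<ge> 0" "\<And>x. x \<in> {A..B} \<Longrightarrow> \<bar>g x\<bar> \<le> K"
proof -
  obtain K where K: "\<forall>x\<in>{A..B}. \<bar>g x\<bar> \<le> K"
    using assms by (auto simp: bmeas_def bounded_iff)
  show ?thesis by (rule that[of "max K 0"]) (use K in fastforce)+
qed

lemma bmeasI:
  assumes "g \<in> borel_measurable (lebesgue_on {A..B})" "\<And>x. x \<in> {A..B} \<Longrightarrow> \<bar>g x\<bar> \<le> K"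
  shows "bmeas A B g"
  using assms unfolding bmeas_def bounded_iff by (auto intro!: exI[of _ K])

lemma bmeas_continuous: "continuous_on {A..B} g \<Longrightarrow> bmeas A B g"
  unfolding bmeas_def
  by (auto intro!: continuous_imp_measurable_on_sets_lebesgue compact_imp_bounded compact_continuous_image)

lemma bmeas_add: "bmeas A B f \<Longrightarrow> bmeas A B g \<Longrightarrow> bmeas A B (\<lambda>x. f x + g x)"
  by (auto simp: bmeas_def intro!: bounded_plus_comp)

lemma bmeas_mult:
  assumes "bmeas A B f" "bmeas A B g"
  shows "bmeas A B (\<lambda>x. f x * g x)"
proof -
  obtain K L where K: "K \<ge> 0" "\<And>x. x \<in> {A..B} \<Longrightarrow> \<bar>f x\<bar> \<le> K"
    and L: "L \<ge> 0" "\<And>x. x \<in> {A..B} \<Longrightarrow> \<bar>g x\<bar> \<le> L"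
    using bmeasE[OF assms(1)] bmeasE[OF assms(2)] by metis
  show ?thesis
    by (rule bmeasI[where K="K * L"])
      (use assms K L in \<open>auto simp: bmeas_def abs_mult intro!: mult_mono\<close>)
qed

lemma bmeas_const: "bmeas A B (\<lambda>x. c)"
  by (rule bmeas_continuous) simp

lemma bmeas_diff: "bmeas A B f \<Longrightarrow> bmeas A B g \<Longrightarrow> bmeas A B (\<lambda>x. f x - g x)"
  using bmeas_add[of A B f "\<lambda>x. - 1 * g x"] bmeas_mult[OF bmeas_const[of A B "-1"], of g] by simp

lemma bmeas_ai: "bmeas A B g \<Longrightarrow> g absolutely_integrable_on {A..B}"
  using absolutely_integrable_bounded_measurable_product_real[of g "{A..B}" "\<lambda>x. 1"]
    absolutely_integrable_continuous_real[of A B "\<lambda>x. 1"]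
  by (simp add: bmeas_def)

lemma bmeas_integrable: "bmeas A B g \<Longrightarrow> g integrable_on {A..B}"
  by (rule ai_integrable[OF bmeas_ai])

lemma bmeas_subinterval: "bmeas A B g \<Longrightarrow> A \<le> A' \<Longrightarrow> B' \<le> B \<Longrightarrow> bmeas A' B' g"
  unfolding bmeas_def
  by (auto intro: measurable_restrict_mono[where A="{A..B}" and B="{A'..B'}"] bounded_subset)

section \<open>Sobolev functions on an interval as iterated primitives\<close>

lemma L2_interval_ai:
  assumes "L2_interval l h"
  shows "h absolutely_integrable_on {0..l}"
proof -
  have "h absolutely_integrable_on {0<..<l}"
  proof (rule measurable_bounded_by_integrable_imp_absolutely_integrable[where g="\<lambda>x. 1 + (h x)\<^sup>2"])
    have "(\<lambda>x. (h x)\<^sup>2) integrable_on {0<..<l}"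
      using assms by (intro integrable_on_lebesgue_on) (auto simp: L2_interval_def)
    moreover have "(\<lambda>x. 1) integrable_on {0<..<l}" by (rule integrable_on_const) simp
    ultimately show "(\<lambda>x. 1 + (h x)\<^sup>2) integrable_on {0<..<l}" by (intro integrable_add)
    show "norm (h x) \<le> 1 + (h x)\<^sup>2" for x
    proof -
      have "0 \<le> (\<bar>h x\<bar> - 1)\<^sup>2" by simp
      then have "2 * \<bar>h x\<bar> \<le> 1 + (h x)\<^sup>2" by (simp add: power2_diff)
      then show ?thesis by simp
    qed
  qed (use assms in \<open>auto simp: L2_interval_def\<close>)
  then show ?thesis by (simp add: absolutely_integrable_on_Icc_iff_Ioo)
qed

lemma bmeas_L2_interval:
  assumes "bmeas 0 l h"
  shows "L2_interval l h"
  unfolding L2_interval_def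
proof
  show "h \<in> borel_measurable (lebesgue_on {0<..<l})"
    using assms by (auto simp: bmeas_def intro: measurable_restrict_mono[where A="{0..l}"])
  have "(\<lambda>x. h x * h x) absolutely_integrable_on {0<..<l}"
    using bmeas_ai[OF bmeas_mult[OF assms assms]] by (simp add: absolutely_integrable_on_Icc_iff_Ioo)
  then show "integrable (lebesgue_on {0<..<l}) (\<lambda>x. (h x)\<^sup>2)"
    unfolding power2_eq_square by (rule absolutely_integrable_imp_integrable) simp
qed

text \<open>Continuity of \<open>f\<close> upgrades equality almost everywhere with a primitive to
  equality at every point, end points included. The weak derivative may then be changed on a null
  set into its continuous representative \<open>g\<close>.\<close>

lemma H2_interval_primitive:
  assumes "0 < l" "H2_interval l f" "continuous_on {0..l} f"
  obtains g h where "primitive_on 0 l f g" "primitive_on 0 l g h"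
proof -
  obtain k h where k: "has_weak_deriv l f k" "L2_interval l k" and h: "has_weak_deriv l k h" "L2_interval l h"
    using assms(2) by (auto simp: H2_interval_def)
  have kai: "k absolutely_integrable_on {0..l}" and hai: "h absolutely_integrable_on {0..l}"
    using k h L2_interval_ai by auto
  have fai: "f absolutely_integrable_on {0..l}" by (rule absolutely_integrable_continuous_real[OF assms(3)])
  obtain C where C: "negligible {x \<in> {0..l}. k x \<noteq> C + integral {0..x} h}"
    by (rule has_weak_deriv_imp_primitive[OF h(1) order_refl \<open>0 < l\<close> order_refl kai hai])
  obtain D where D: "negligible {x \<in> {0..l}. f x \<noteq> D + integral {0..x} k}"
    by (rule has_weak_deriv_imp_primitive[OF k(1) order_refl \<open>0 < l\<close> order_refl fai kai])
  define g where "g x = C + integral {0..x} h" for x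
  have pg: "primitive_on 0 l g h" unfolding g_def by (rule primitive_on_integral[OF hai])
  have pk: "primitive_on 0 l (\<lambda>x. D + integral {0..x} k) k" by (rule primitive_on_integral[OF kai])
  have "primitive_on 0 l f k"
    by (rule primitive_on_cong[OF pk continuous_eq_of_AE_eq[OF \<open>0 < l\<close> assms(3)
          primitive_on_continuous[OF pk] D]]) auto
  then have "primitive_on 0 l f g"
    by (rule primitive_on_spike[OF _ C]) (auto simp: g_def)
  then show ?thesis using pg by (rule that)
qed

lemma H2_intervalI:
  assumes "primitive_on 0 l f g" "primitive_on 0 l g h" "bmeas 0 l h"
  shows "H2_interval l f"
  unfolding H2_interval_def
proof (rule conjI, rule_tac [2] exI[of _ g], rule_tac [2] exI[of _ h])
  show "L2_interval l f"
    by (intro bmeas_L2_interval bmeas_continuous primitive_on_continuous[OF assms(1)])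
  have "L2_interval l g"
    by (intro bmeas_L2_interval bmeas_continuous primitive_on_continuous[OF assms(2)])
  then show "has_weak_deriv l f g \<and> L2_interval l g \<and> has_weak_deriv l g h \<and> L2_interval l h"
    using assms by (auto intro: bmeas_L2_interval primitive_imp_has_weak_deriv)
qed

lemma weak_deriv_eq:
  assumes "has_weak_deriv l f g"
  shows "negligible {x \<in> {0<..<l}. weak_deriv l f x \<noteq> g x}"
proof -
  have "has_weak_deriv l f (weak_deriv l f)" unfolding weak_deriv_def by (rule someI[of "has_weak_deriv l f", OF assms])
  then show ?thesis using assms by (rule has_weak_deriv_unique)
qed

text \<open>The inner weak derivative is a mere choice, so the outer one acts on a function known
  only almost everywhere; the hypothesis supplies the absolutely continuous representative
  \<open>a * g\<close> of that function.\<close>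

lemma weak_deriv_flux:
  assumes f: "primitive_on 0 l f g" and p: "primitive_on 0 l (\<lambda>x. a x * g x) q"
  shows "negligible {x \<in> {0<..<l}. weak_deriv l (\<lambda>y. a y * weak_deriv l f y) x \<noteq> q x}"
proof (rule weak_deriv_eq)
  have neg: "negligible {x \<in> {0<..<l}. weak_deriv l f x \<noteq> g x}"
    by (rule weak_deriv_eq[OF primitive_imp_has_weak_deriv[OF f]])
  show "has_weak_deriv l (\<lambda>y. a y * weak_deriv l f y) q"
    by (rule has_weak_deriv_cong[OF primitive_imp_has_weak_deriv[OF p]])
      (rule negligible_subset[OF neg], auto)
qed

section \<open>Cauchy-Schwarz, Poincare and trace inequalities in one dimension\<close>

lemma integral_square_le:
  fixes g :: "real \<Rightarrow> real"
  assumes "A \<le> B" "g integrable_on {A..B}" "(\<lambda>x. (g x)\<^sup>2) integrable_on {A..B}"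
  shows "(integral {A..B} g)\<^sup>2 \<le> (B - A) * integral {A..B} (\<lambda>x. (g x)\<^sup>2)"
proof (cases "A = B")
  case False
  \<comment> \<open>With \<open>c\<close> the mean of \<open>g\<close>, the claim says that the
    integral of \<open>(g x - c)\<^sup>2\<close> is nonnegative.\<close>
  define c where "c = integral {A..B} g / (B - A)"
  have "((\<lambda>x. (g x)\<^sup>2 - 2 * c * g x + c\<^sup>2) has_integral
      integral {A..B} (\<lambda>x. (g x)\<^sup>2) - 2 * c * integral {A..B} g + c\<^sup>2 * (B - A)) {A..B}"
    using has_integral_const_real[of "c\<^sup>2" A B] assms
    by (intro has_integral_add has_integral_diff has_integral_mult_right integrable_integral)
      (auto simp: mult.commute)
  then have "0 \<le> integral {A..B} (\<lambda>x. (g x)\<^sup>2) - 2 * c * integral {A..B} g + c\<^sup>2 * (B - A)"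
  proof (rule has_integral_nonneg)
    show "0 \<le> (g x)\<^sup>2 - 2 * c * g x + c\<^sup>2" for x
      using zero_le_power2[of "g x - c"] by (simp add: power2_diff mult.commute mult.left_commute)
  qed
  also have "\<dots> = integral {A..B} (\<lambda>x. (g x)\<^sup>2) - (integral {A..B} g)\<^sup>2 / (B - A)"
  proof -
    have "c * (B - A) = integral {A..B} g" using False by (simp add: c_def)
    then have "c\<^sup>2 * (B - A) = c * integral {A..B} g" by (simp add: power2_eq_square)
    moreover have "(integral {A..B} g)\<^sup>2 / (B - A) = c * integral {A..B} g" by (simp add: c_def power2_eq_square)
    ultimately show ?thesis by simp
  qed
  finally have "(integral {A..B} g)\<^sup>2 / (B - A) \<le> integral {A..B} (\<lambda>x. (g x)\<^sup>2)" by simp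
  then show ?thesis using False assms(1) by (simp add: pos_divide_le_eq mult.commute)
qed simp

text \<open>Cauchy-Schwarz for the density: an \<open>L2\<close> bound on the derivative gives
  Hoelder continuity of exponent one half. This estimate feeds the Poincare and trace inequalities
  as well as the equicontinuity behind compactness.\<close>

lemma primitive_increment_square_le:
  assumes p: "primitive_on A B F f" and b: "bmeas A B f" and xy: "A \<le> x" "x \<le> y" "y \<le> B"
  shows "(F y - F x)\<^sup>2 \<le> (y - x) * integral {A..B} (\<lambda>t. (f t)\<^sup>2)"
proof -
  have bs: "bmeas A B (\<lambda>t. (f t)\<^sup>2)" unfolding power2_eq_square by (rule bmeas_mult[OF b b])
  have i: "f integrable_on {x..y}" "(\<lambda>t. (f t)\<^sup>2) integrable_on {x..y}"
    using bmeas_integrable bmeas_subinterval[OF b xy(1,3)] bmeas_subinterval[OF bs xy(1,3)] by auto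
  have "(F y - F x)\<^sup>2 = (integral {x..y} f)\<^sup>2" using primitive_on_diff[OF p xy] by simp
  also have "\<dots> \<le> (y - x) * integral {x..y} (\<lambda>t. (f t)\<^sup>2)"
    using xy i by (intro integral_square_le)
  also have "\<dots> \<le> (y - x) * integral {A..B} (\<lambda>t. (f t)\<^sup>2)"
    using xy i bmeas_integrable[OF bs] by (intro mult_left_mono integral_subset_le) auto
  finally show ?thesis .
qed

lemma poincare_inequality:
  assumes p: "primitive_on A B F f" and b: "bmeas A B f" and "A \<le> B" "F A = 0"
  shows "integral {A..B} (\<lambda>t. (F t)\<^sup>2) \<le> (B - A)\<^sup>2 * integral {A..B} (\<lambda>t. (f t)\<^sup>2)"
proof -
  have bF: "bmeas A B F" by (rule bmeas_continuous[OF primitive_on_continuous[OF p]])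
  have nn: "0 \<le> integral {A..B} (\<lambda>t. (f t)\<^sup>2)" by (rule integral_nonneg)
      (use bmeas_integrable[OF bmeas_mult[OF b b]] in \<open>auto simp: power2_eq_square\<close>)
  have "integral {A..B} (\<lambda>t. (F t)\<^sup>2) \<le> integral {A..B} (\<lambda>t. (B - A) * integral {A..B} (\<lambda>t. (f t)\<^sup>2))"
  proof (rule integral_le)
    show "(\<lambda>t. (F t)\<^sup>2) integrable_on {A..B}"
      unfolding power2_eq_square by (rule bmeas_integrable[OF bmeas_mult[OF bF bF]])
    show "(F t)\<^sup>2 \<le> (B - A) * integral {A..B} (\<lambda>t. (f t)\<^sup>2)" if "t \<in> {A..B}" for t
      using primitive_increment_square_le[OF p b, of A t] mult_right_mono[OF _ nn, of "t - A" "B - A"] that \<open>F A = 0\<close>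
      by auto
  qed auto
  also have "\<dots> = (B - A)\<^sup>2 * integral {A..B} (\<lambda>t. (f t)\<^sup>2)"
    using \<open>A \<le> B\<close> by (simp add: power2_eq_square)
  finally show ?thesis .
qed

text \<open>Averages \<open>(F z)\<^sup>2 \<le> 2 * (F t)\<^sup>2 + 2 * (F z - F t)\<^sup>2\<close>
  over \<open>t\<close> in \<open>{C..D}\<close>. The length \<open>D - C\<close> stays free: a full
  edge yields the constants of the smallness hypotheses, a short piece a small weight on the
  derivative.\<close>

lemma trace_inequality:
  assumes p: "primitive_on A B F f" and b: "bmeas A B f"
    and CD: "A \<le> C" "C < D" "D \<le> B" and z: "z = C \<or> z = D"
  shows "(F z)\<^sup>2 \<le> 2 / (D - C) * integral {A..B} (\<lambda>t. (F t)\<^sup>2)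
    + (D - C) * integral {A..B} (\<lambda>t. (f t)\<^sup>2)"
proof -
  define I where "I = integral {A..B} (\<lambda>t. (f t)\<^sup>2)"
  have bF: "bmeas A B F" by (rule bmeas_continuous[OF primitive_on_continuous[OF p]])
  have bF2: "bmeas A B (\<lambda>t. (F t)\<^sup>2)" unfolding power2_eq_square by (rule bmeas_mult[OF bF bF])
  have iCD: "(\<lambda>t. (F t)\<^sup>2) integrable_on {C..D}"
    using bmeas_integrable bmeas_subinterval[OF bF2 CD(1,3)] by auto
  have dist: "((\<lambda>t. \<bar>z - t\<bar>) has_integral (D - C)\<^sup>2 / 2) {C..D}"
    using z
  proof
    assume z: "z = C"
    have "((\<lambda>t. t - C) has_integral (D - C)\<^sup>2 / 2 - (C - C)\<^sup>2 / 2) {C..D}"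
      using CD by (intro fundamental_theorem_of_calculus)
        (auto intro!: derivative_eq_intros simp: has_real_derivative_iff_has_vector_derivative[symmetric])
    then show ?thesis by (rule has_integral_eq_rhs[OF has_integral_eq[rotated]]) (auto simp: z)
  next
    assume z: "z = D"
    have "((\<lambda>t. D - t) has_integral - ((D - D)\<^sup>2 / 2) - (- ((D - C)\<^sup>2 / 2))) {C..D}"
      using CD by (intro fundamental_theorem_of_calculus)
        (auto intro!: derivative_eq_intros simp: has_real_derivative_iff_has_vector_derivative[symmetric] field_simps)
    then show ?thesis by (rule has_integral_eq_rhs[OF has_integral_eq[rotated]]) (auto simp: z)
  qed
  have rhs: "((\<lambda>t. 2 * (F t)\<^sup>2 + 2 * I * \<bar>z - t\<bar>) has_integral
      2 * integral {C..D} (\<lambda>t. (F t)\<^sup>2) + 2 * I * ((D - C)\<^sup>2 / 2)) {C..D}"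
    by (intro has_integral_add has_integral_mult_right dist integrable_integral iCD)
  have "(D - C) * (F z)\<^sup>2 = integral {C..D} (\<lambda>t. (F z)\<^sup>2)" using CD by simp
  also have "\<dots> \<le> integral {C..D} (\<lambda>t. 2 * (F t)\<^sup>2 + 2 * I * \<bar>z - t\<bar>)"
  proof (rule integral_le)
    show "(\<lambda>t. 2 * (F t)\<^sup>2 + 2 * I * \<bar>z - t\<bar>) integrable_on {C..D}"
      using rhs by (rule has_integral_integrable)
    fix t assume t: "t \<in> {C..D}"
    have "(F z - F t)\<^sup>2 \<le> \<bar>z - t\<bar> * I"
    proof (cases "t \<le> z")
      case True
      then show ?thesis using primitive_increment_square_le[OF p b, of t z] t z CD by (auto simp: I_def)
    next
      case False
      then show ?thesis using primitive_increment_square_le[OF p b, of z t] t z CD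
        by (auto simp: I_def power2_commute)
    qed
    moreover have "(F z)\<^sup>2 \<le> 2 * (F t)\<^sup>2 + 2 * (F z - F t)\<^sup>2"
      using zero_le_power2[of "2 * F t - F z"] by (simp add: power2_eq_square algebra_simps)
    ultimately show "(F z)\<^sup>2 \<le> 2 * (F t)\<^sup>2 + 2 * I * \<bar>z - t\<bar>"
      by (simp add: mult.commute mult.left_commute)
  qed auto
  also have "\<dots> = 2 * integral {C..D} (\<lambda>t. (F t)\<^sup>2) + (D - C)\<^sup>2 * I"
    using integral_unique[OF rhs] by simp
  also have "\<dots> \<le> 2 * integral {A..B} (\<lambda>t. (F t)\<^sup>2) + (D - C)\<^sup>2 * I"
    using iCD bmeas_integrable[OF bF2] CD by (intro add_right_mono mult_left_mono integral_subset_le) auto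
  finally have "(D - C) * (F z)\<^sup>2 \<le> 2 * integral {A..B} (\<lambda>t. (F t)\<^sup>2) + (D - C)\<^sup>2 * I" .
  then have "(F z)\<^sup>2 \<le> (2 * integral {A..B} (\<lambda>t. (F t)\<^sup>2) + (D - C)\<^sup>2 * I) / (D - C)"
    using CD by (simp add: pos_le_divide_eq mult.commute)
  also have "\<dots> = 2 / (D - C) * integral {A..B} (\<lambda>t. (F t)\<^sup>2) + (D - C) * I"
    using CD by (simp add: add_divide_distrib power2_eq_square)
  finally show ?thesis unfolding I_def .
qed

section \<open>Symmetric forms and Rayleigh quotients\<close>

text \<open>Bilinearity is required on \<open>V\<close> only: the forms below are total functions
  given by integrals, and an integral of a sum splits only where the summands are
  integrable.\<close>

locale symmetric_form =
  fixes V :: "'a::real_vector set" and B :: "'a \<Rightarrow> 'a \<Rightarrow> real"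
  assumes subspace_V: "subspace V"
    and sym: "x \<in> V \<Longrightarrow> y \<in> V \<Longrightarrow> B x y = B y x"
    and add_left: "x \<in> V \<Longrightarrow> y \<in> V \<Longrightarrow> z \<in> V \<Longrightarrow> B (x + y) z = B x z + B y z"
    and scale_left: "x \<in> V \<Longrightarrow> z \<in> V \<Longrightarrow> B (c *\<^sub>R x) z = c * B x z"
begin

lemma V_closed: "0 \<in> V" "x \<in> V \<Longrightarrow> y \<in> V \<Longrightarrow> x + y \<in> V" "x \<in> V \<Longrightarrow> c *\<^sub>R x \<in> V"
  "x \<in> V \<Longrightarrow> y \<in> V \<Longrightarrow> x - y \<in> V"
  using subspace_V by (auto simp: subspace_0 subspace_add subspace_scale subspace_diff)

lemma zero_left: "z \<in> V \<Longrightarrow> B 0 z = 0"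
  using scale_left[of 0 z 0] V_closed(1) by simp

lemma diff_left: "x \<in> V \<Longrightarrow> y \<in> V \<Longrightarrow> z \<in> V \<Longrightarrow> B (x - y) z = B x z - B y z"
  using add_left[of x "(-1) *\<^sub>R y" z] scale_left[of y z "-1"] V_closed(3)[of y "-1"] by simp

lemma add_right: "x \<in> V \<Longrightarrow> y \<in> V \<Longrightarrow> z \<in> V \<Longrightarrow> B z (x + y) = B z x + B z y"
  using add_left[of x y z] sym V_closed by metis

lemma scale_right: "x \<in> V \<Longrightarrow> z \<in> V \<Longrightarrow> B z (c *\<^sub>R x) = c * B z x"
  using scale_left[of x z c] sym V_closed by metis

lemma diff_right: "x \<in> V \<Longrightarrow> y \<in> V \<Longrightarrow> z \<in> V \<Longrightarrow> B z (x - y) = B z x - B z y"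
  using diff_left[of x y z] sym V_closed by metis

lemma sum_in: "(\<And>i. i \<in> I \<Longrightarrow> f i \<in> V) \<Longrightarrow> (\<Sum>i\<in>I. c i *\<^sub>R f i) \<in> V"
  using subspace_V by (auto intro: subspace_sum subspace_scale)

lemma sum_left:
  assumes "finite I" "\<And>i. i \<in> I \<Longrightarrow> f i \<in> V" "z \<in> V"
  shows "B (\<Sum>i\<in>I. c i *\<^sub>R f i) z = (\<Sum>i\<in>I. c i * B (f i) z)"
  using assms
proof (induction I)
  case (insert i I)
  then have "(\<Sum>i\<in>I. c i *\<^sub>R f i) \<in> V" by (intro sum_in) auto
  with insert show ?case by (simp add: add_left scale_left V_closed)
qed (simp add: zero_left)

lemma sum_right:
  assumes "finite I" "\<And>i. i \<in> I \<Longrightarrow> f i \<in> V" "z \<in> V"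
  shows "B z (\<Sum>i\<in>I. c i *\<^sub>R f i) = (\<Sum>i\<in>I. c i * B z (f i))"
proof -
  have "B z (\<Sum>i\<in>I. c i *\<^sub>R f i) = B (\<Sum>i\<in>I. c i *\<^sub>R f i) z"
    using assms(2,3) by (intro sym sum_in)
  also have "\<dots> = (\<Sum>i\<in>I. c i * B (f i) z)" by (rule sum_left[OF assms])
  also have "\<dots> = (\<Sum>i\<in>I. c i * B z (f i))"
    using assms(2,3) by (intro sum.cong refl arg_cong2[of _ _ _ _ "(*)"] sym)
  finally show ?thesis .
qed

lemma zero_on_span:
  assumes "E \<subseteq> V" "z \<in> V" "\<And>e. e \<in> E \<Longrightarrow> B z e = 0" "w \<in> span E"
  shows "B z w = 0"
proof -
  have "subspace {w \<in> V. B z w = 0}"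
    unfolding subspace_def using assms(2) V_closed
    by (auto simp: sym[of z 0] zero_left add_right scale_right)
  then have "span E \<subseteq> {w \<in> V. B z w = 0}"
    using assms(1,3) by (intro span_minimal) auto
  then have "w \<in> {w \<in> V. B z w = 0}" using assms(4) by blast
  then show ?thesis by simp
qed

end

locale psd_form = symmetric_form +
  assumes nonneg: "x \<in> V \<Longrightarrow> 0 \<le> B x x"
begin

lemma cauchy_schwarz:
  assumes x: "x \<in> V" and y: "y \<in> V"
  shows "(B x y)\<^sup>2 \<le> B x x * B y y"
proof -
  have q: "0 \<le> B x x - 2 * t * B x y + t\<^sup>2 * B y y" for t
  proof -
    have "0 \<le> B (x - t *\<^sub>R y) (x - t *\<^sub>R y)" using x y by (intro nonneg V_closed)
    also have "\<dots> = B x x - 2 * t * B x y + t\<^sup>2 * B y y"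
      using x y by (simp add: diff_left diff_right scale_left scale_right V_closed sym[of y x]
          power2_eq_square algebra_simps)
    finally show ?thesis .
  qed
  show ?thesis
  proof (cases "B y y = 0")
    case True
    have "B x y = 0"
    proof (rule ccontr)
      assume "B x y \<noteq> 0"
      \<comment> \<open>At this value of \<open>t\<close> the quadratic expression equals
        -1.\<close>
      then show False using q[of "(B x x + 1) / (2 * B x y)"] True by simp
    qed
    then show ?thesis using True by simp
  next
    case False
    then have "B y y > 0" using nonneg[OF y] by simp
    have "0 \<le> B x x - (B x y)\<^sup>2 / B y y"
      using q[of "B x y / B y y"] False by (simp add: power2_eq_square)
    then show ?thesis using \<open>B y y > 0\<close> by (simp add: field_simps)
  qed
qed

lemma null_vector: "x \<in> V \<Longrightarrow> y \<in> V \<Longrightarrow> B x x = 0 \<Longrightarrow> B x y = 0"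
  using cauchy_schwarz[of x y] by simp

text \<open>Gram-Schmidt for a semidefinite form: the new direction \<open>h\<close> may be a null
  vector, but such a vector is orthogonal to everything and demands no correction.\<close>

lemma orthogonal_projection:
  assumes "finite E" "E \<subseteq> V" "v \<in> V"
  shows "\<exists>w\<in>span E. \<forall>e\<in>E. B (v - w) e = 0"
  using assms
proof (induction E arbitrary: v rule: finite_induct)
  case empty
  then show ?case by (auto simp: span_zero)
next
  case (insert f E)
  have EV: "E \<subseteq> V" "f \<in> V" using insert.prems by auto
  have spV: "span E \<subseteq> V" using span_minimal[OF EV(1) subspace_V] .
  obtain w where w: "w \<in> span E" "\<forall>e\<in>E. B (v - w) e = 0" using insert EV by blast
  obtain g where g: "g \<in> span E" "\<forall>e\<in>E. B (f - g) e = 0" using insert EV by blast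
  define h where "h = f - g"
  have hV: "h \<in> V" and wV: "w \<in> V" and gV: "g \<in> V" using w g spV EV V_closed by (auto simp: h_def)
  \<comment> \<open>If \<open>B h h = 0\<close> the quotient is 0 by convention, which is harmless
    because \<open>B (v - w) h = 0\<close> as well.\<close>
  define t where "t = B (v - w) h / B h h"
  have vw: "v - w \<in> V" using insert.prems wV V_closed by auto
  have th: "B (v - w) h = t * B h h"
    using null_vector[OF hV vw] sym[OF hV vw] by (cases "B h h = 0") (auto simp: t_def)
  have zV: "v - (w + t *\<^sub>R h) \<in> V" using insert.prems wV hV V_closed by auto
  have E0: "B (v - (w + t *\<^sub>R h)) e = 0" if "e \<in> E" for e
  proof -
    have "e \<in> V" using that EV by auto
    have "B (v - w - t *\<^sub>R h) e = B (v - w) e - t * B h e"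
      using vw hV \<open>e \<in> V\<close> by (simp add: diff_left scale_left V_closed)
    then show ?thesis using w(2) g(2) that by (simp add: h_def diff_diff_add)
  qed
  have "B (v - (w + t *\<^sub>R h)) h = B (v - w) h - t * B h h"
    using vw hV diff_left[of "v - w" "t *\<^sub>R h" h] by (simp add: scale_left V_closed diff_diff_add)
  then have h0: "B (v - (w + t *\<^sub>R h)) h = 0" using th by simp
  have "B (v - (w + t *\<^sub>R h)) g = 0" by (rule zero_on_span[OF EV(1) zV E0 g(1)])
  then have "B (v - (w + t *\<^sub>R h)) f = 0"
    using h0 add_right[of h g "v - (w + t *\<^sub>R h)"] hV gV zV by (simp add: h_def)
  moreover have "w + t *\<^sub>R h \<in> span (insert f E)"
    using w(1) g(1) span_mono[of E "insert f E"]
    by (auto simp: h_def intro!: span_add span_scale span_diff span_base[of f])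
  ultimately show ?case using E0 by (intro bexI[of _ "w + t *\<^sub>R h"]) auto
qed

end

lemma psd_form_shift:
  assumes Q: "symmetric_form V Q" and M: "symmetric_form V M" and "subspace S" "S \<subseteq> V"
    and "\<And>x. x \<in> S \<Longrightarrow> 0 \<le> Q x x - l * M x x"
  shows "psd_form S (\<lambda>x y. Q x y - l * M x y)"
proof -
  interpret Q: symmetric_form V Q by fact
  interpret M: symmetric_form V M by fact
  show ?thesis
  proof
    show "subspace S" by fact
  qed (use assms in \<open>auto simp: subset_iff Q.sym M.sym Q.add_left M.add_left Q.scale_left M.scale_left algebra_simps\<close>)
qed

text \<open>Even without a minimiser, a minimising sequence satisfies the Euler-Lagrange equation in
  the limit: \<open>Q - l * M\<close> is semidefinite on the \<open>M\<close>-orthogonal complement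
  of \<open>E\<close>, and Cauchy-Schwarz bounds the square of its value at \<open>X n\<close> and
  \<open>v\<close> by a constant times its diagonal value at \<open>X n\<close>, which tends to
  0.\<close>

lemma rayleigh_minimizing_sequence:
  assumes Q: "symmetric_form V Q" and M: "psd_form V M"
    and E: "finite E" "E \<subseteq> V" "\<And>e. e \<in> E \<Longrightarrow> \<exists>\<mu>. \<forall>v\<in>V. Q e v = \<mu> * M e v"
    and lower: "\<And>x. x \<in> V \<Longrightarrow> 0 \<le> Q x x"
    and x0: "x0 \<in> V" "\<And>e. e \<in> E \<Longrightarrow> M x0 e = 0" "0 < M x0 x0" "Q x0 x0 \<le> \<Lambda> * M x0 x0"
  obtains l X where "l \<le> \<Lambda>" "\<And>n::nat. X n \<in> V" "\<And>n e. e \<in> E \<Longrightarrow> M (X n) e = 0" "\<And>n. M (X n) (X n) = 1"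
    "\<And>n. Q (X n) (X n) \<le> l + 1" "\<And>v. v \<in> V \<Longrightarrow> (\<lambda>n. Q (X n) v - l * M (X n) v) \<longlonglongrightarrow> 0"
proof -
  interpret Q: symmetric_form V Q by fact
  interpret M: psd_form V M by fact
  define S where "S = {x \<in> V. \<forall>e\<in>E. M x e = 0}"
  have SV: "S \<subseteq> V" by (auto simp: S_def)
  have Ssub: "subspace S"
    unfolding subspace_def S_def using M.V_closed E(2) by (auto simp: subset_iff M.zero_left M.add_left M.scale_left)
  define R where "R = (\<lambda>x. Q x x) ` {x \<in> S. M x x = 1}"
  have scaled: "x /\<^sub>R sqrt (M x x) \<in> S" "M (x /\<^sub>R sqrt (M x x)) (x /\<^sub>R sqrt (M x x)) = 1"
      "Q (x /\<^sub>R sqrt (M x x)) (x /\<^sub>R sqrt (M x x)) = Q x x / M x x"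
    if x: "x \<in> S" "M x x > 0" for x
  proof -
    have xV: "x \<in> V" using x SV by auto
    show "x /\<^sub>R sqrt (M x x) \<in> S" using Ssub x(1) by (rule subspace_scale)
    show "M (x /\<^sub>R sqrt (M x x)) (x /\<^sub>R sqrt (M x x)) = 1"
      using x(2) xV by (simp add: M.scale_left M.scale_right M.V_closed field_simps)
    show "Q (x /\<^sub>R sqrt (M x x)) (x /\<^sub>R sqrt (M x x)) = Q x x / M x x"
      using x(2) xV by (simp add: Q.scale_left Q.scale_right Q.V_closed field_simps)
  qed
  have x0S: "x0 \<in> S" using x0 by (auto simp: S_def)
  have x0R: "Q x0 x0 / M x0 x0 \<in> R"
    unfolding R_def using scaled[OF x0S x0(3)] by (metis (mono_tags, lifting) image_eqI mem_Collect_eq)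
  have bdd: "bdd_below R" unfolding R_def using lower SV by (intro bdd_belowI[of _ 0]) auto
  define l where "l = Inf R"
  have lR: "l \<le> r" if "r \<in> R" for r unfolding l_def using that bdd by (rule cInf_lower)
  have "l \<le> Q x0 x0 / M x0 x0" by (rule lR[OF x0R])
  also have "\<dots> \<le> \<Lambda>" using x0 by (simp add: field_simps)
  finally have l\<Lambda>: "l \<le> \<Lambda>" .
  have "\<exists>x. x \<in> S \<and> M x x = 1 \<and> Q x x < l + inverse (real (Suc n))" for n
  proof -
    have "Inf R < l + inverse (real (Suc n))" by (simp add: l_def)
    then obtain r where "r \<in> R" "r < l + inverse (real (Suc n))"
      using cInf_lessD[of R] x0R by auto
    then show ?thesis by (auto simp: R_def)
  qed
  then obtain X where X: "\<And>n. X n \<in> S" "\<And>n. M (X n) (X n) = 1" "\<And>n. Q (X n) (X n) < l + inverse (real (Suc n))"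
    by metis
  have pos: "0 \<le> Q x x - l * M x x" if "x \<in> S" for x
  proof (cases "M x x = 0")
    case True
    then show ?thesis using lower that SV by auto
  next
    case False
    then have "M x x > 0" using M.nonneg that SV by (metis less_eq_real_def subsetD)
    moreover have "l \<le> Q x x / M x x"
      using scaled[OF that \<open>M x x > 0\<close>] by (intro lR) (metis (mono_tags, lifting) R_def image_eqI mem_Collect_eq)
    ultimately show ?thesis by (simp add: field_simps)
  qed
  define T where "T x y = Q x y - l * M x y" for x y
  interpret T: psd_form S T
    unfolding T_def by (rule psd_form_shift[OF Q M.symmetric_form_axioms Ssub SV pos])
  have TS: "(\<lambda>n. T (X n) v) \<longlonglongrightarrow> 0" if "v \<in> S" for v
  proof -
    have "(T (X n) v)\<^sup>2 \<le> inverse (real (Suc n)) * T v v" for n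
    proof -
      have "(T (X n) v)\<^sup>2 \<le> T (X n) (X n) * T v v" using X(1) that by (rule T.cauchy_schwarz)
      also have "\<dots> \<le> inverse (real (Suc n)) * T v v"
        using X(2,3)[of n] T.nonneg[OF that] by (intro mult_right_mono) (auto simp: T_def)
      finally show ?thesis .
    qed
    moreover have "(\<lambda>n. inverse (real (Suc n)) * T v v) \<longlonglongrightarrow> 0 * T v v"
      by (intro tendsto_mult LIMSEQ_inverse_real_of_nat tendsto_const)
    ultimately have "(\<lambda>n. (T (X n) v)\<^sup>2) \<longlonglongrightarrow> 0"
      by (intro tendsto_sandwich[of "\<lambda>_. 0" "\<lambda>n. (T (X n) v)\<^sup>2" sequentially "\<lambda>n. inverse (real (Suc n)) * T v v"]) auto
    then have "(\<lambda>n. sqrt ((T (X n) v)\<^sup>2)) \<longlonglongrightarrow> sqrt 0" by (rule tendsto_real_sqrt)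
    then show ?thesis by (simp add: tendsto_rabs_zero_iff)
  qed
  \<comment> \<open>A general \<open>v\<close> splits into an element of the complement and one of
    \<open>span E\<close>. The latter contributes nothing: members of \<open>E\<close> are
    eigenvectors, hence orthogonal to \<open>X n\<close> for \<open>Q\<close> as well as for
    \<open>M\<close>.\<close>
  have TV: "(\<lambda>n. Q (X n) v - l * M (X n) v) \<longlonglongrightarrow> 0" if v: "v \<in> V" for v
  proof -
    obtain w where w: "w \<in> span E" "\<forall>e\<in>E. M (v - w) e = 0"
      using M.orthogonal_projection[OF E(1,2) v] by auto
    have wV: "w \<in> V" using w(1) span_minimal[OF E(2) Q.subspace_V] by auto
    have vw: "v - w \<in> S" using w(2) v wV M.V_closed by (auto simp: S_def)
    have "T (X n) v = T (X n) (v - w)" for n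
    proof -
      have XV: "X n \<in> V" using X SV by auto
      have "M (X n) w = 0"
        using X(1)[of n] by (intro M.zero_on_span[OF E(2) XV _ w(1)]) (auto simp: S_def)
      moreover have "Q (X n) w = 0"
      proof (rule Q.zero_on_span[OF E(2) XV _ w(1)])
        fix e assume e: "e \<in> E"
        then obtain \<mu> where "Q e (X n) = \<mu> * M e (X n)" using E(3) XV by blast
        then show "Q (X n) e = 0"
          using X(1)[of n] e E(2) XV Q.sym[of e "X n"] M.sym[of e "X n"] by (auto simp: S_def)
      qed
      ultimately show ?thesis using v wV XV by (simp add: T_def Q.diff_right M.diff_right)
    qed
    then show ?thesis using TS[OF vw] by (simp add: T_def)
  qed
  show ?thesis
  proof (rule that[OF l\<Lambda> _ _ X(2) _ TV])
    show "Q (X n) (X n) \<le> l + 1" for n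
    proof -
      have "inverse (real (Suc n)) \<le> 1" by (simp add: field_simps)
      then show ?thesis using X(3)[of n] by linarith
    qed
  qed (use X SV in \<open>auto simp: S_def\<close>)
qed

text \<open>The columns lie in the span of \<open>card I\<close> unit vectors, so more than
  \<open>card I\<close> of them are linearly dependent.\<close>

lemma underdetermined_system:
  fixes m :: "'i \<Rightarrow> 'j \<Rightarrow> real"
  assumes "finite I" "finite J" "card I < card J"
  obtains c where "\<exists>j\<in>J. c j \<noteq> 0" "\<And>i. i \<in> I \<Longrightarrow> (\<Sum>j\<in>J. c j * m i j) = 0"
proof -
  define x where "x j = (\<lambda>i. if i \<in> I then m i j else 0)" for j
  have "\<exists>c. (\<exists>j\<in>J. c j \<noteq> 0) \<and> (\<Sum>j\<in>J. c j *\<^sub>R x j) = 0"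
  \<comment> \<open>Linear dependence is a notion for sets; repeated columns, which a set would
    merge, are treated first.\<close>
  proof (cases "inj_on x J")
    case False
    then obtain j k where jk: "j \<in> J" "k \<in> J" "j \<noteq> k" "x j = x k" by (auto simp: inj_on_def)
    define c where "c i = (if i = j then 1 else if i = k then -1 else (0::real))" for i
    have "(\<Sum>i\<in>J. c i *\<^sub>R x i) = (\<Sum>i\<in>{j, k}. c i *\<^sub>R x i)"
      using assms(2) jk by (intro sum.mono_neutral_right) (auto simp: c_def)
    also have "\<dots> = 0" using jk by (simp add: c_def)
    finally show ?thesis using jk by (intro exI[of _ c]) (auto simp: c_def)
  next
    case True
    define b where "b i = (\<lambda>i'. if i' = i then 1 else (0::real))" for i :: 'i
    have eval: "(\<Sum>i\<in>A. f i) p = (\<Sum>i\<in>A. f i p)" if "finite A" for f :: "'i \<Rightarrow> 'i \<Rightarrow> real" and A p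
      using that by (induction A) auto
    have xb: "x j = (\<Sum>i\<in>I. m i j *\<^sub>R b i)" for j
    proof
      fix p
      have "(\<Sum>i\<in>I. m i j *\<^sub>R b i) p = (\<Sum>i\<in>I. if i = p then m i j else 0)"
        unfolding eval[OF assms(1)] by (rule sum.cong) (auto simp: b_def scaleR_fun_def)
      then show "x j p = (\<Sum>i\<in>I. m i j *\<^sub>R b i) p"
        using assms(1) by (simp add: x_def)
    qed
    have "x j \<in> span (b ` I)" for j
      unfolding xb by (rule span_sum, rule span_scale, rule span_base) auto
    then have "x ` J \<subseteq> span (b ` I)" by auto
    moreover have "card (b ` I) < card (x ` J)"
      using card_image_le[OF assms(1), of b] card_image[OF True] assms(3) by simp
    ultimately have "dependent (x ` J)"
      using independent_span_bound[of "b ` I" "x ` J"] assms(1) by auto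
    then obtain u where u: "\<exists>v\<in>x ` J. u v \<noteq> 0" "(\<Sum>v\<in>x ` J. u v *\<^sub>R v) = 0"
      using dependent_finite[of "x ` J"] assms(2) by auto
    then show ?thesis
      by (intro exI[of _ "\<lambda>j. u (x j)"]) (simp add: sum.reindex[OF True] o_def)
  qed
  then obtain c where c: "\<exists>j\<in>J. c j \<noteq> 0" "(\<Sum>j\<in>J. c j *\<^sub>R x j) = 0" by blast
  have eval: "(\<Sum>j\<in>A. f j) p = (\<Sum>j\<in>A. f j p)" if "finite A" for f :: "'j \<Rightarrow> 'i \<Rightarrow> real" and A p
    using that by (induction A) auto
  have "(\<Sum>j\<in>J. c j * m i j) = 0" if "i \<in> I" for i
  proof -
    have "(\<Sum>j\<in>J. c j *\<^sub>R x j) i = 0" using c(2) by simp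
    then show ?thesis using that by (simp add: eval[OF assms(2)] x_def scaleR_fun_def)
  qed
  then show ?thesis using c(1) by (rule that[rotated])
qed

section \<open>Metric graphs\<close>

locale metric_graph = fin_digraph G for G :: "('v, 'e) pre_digraph" +
  fixes len :: "'e \<Rightarrow> real"
  assumes conn: "Digraph_Component.connected G"
    and arcs_ne: "arcs G \<noteq> {}"
    and len_pos: "e \<in> arcs G \<Longrightarrow> 0 < len e"
begin

lemma symmetric_step_reachable:
  assumes "v \<in> verts G" "w \<in> verts G"
  shows "(v, w) \<in> (\<Union>e\<in>arcs G. {(tail G e, head G e), (head G e, tail G e)})\<^sup>*"
proof -
  have "v \<rightarrow>\<^sup>*\<^bsub>mk_symmetric G\<^esub> w"
    using conn assms by (simp add: connected_def strongly_connected_def)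
  then have "(v, w) \<in> (parcs (mk_symmetric G))\<^sup>*"
    unfolding reachable_def by (auto dest: rtrancl_on_rtranclI)
  then show ?thesis by (simp add: parcs_mk_symmetric)
qed

text \<open>A path from \<open>v\<close> to the tail of some edge starts with an edge at
  \<open>v\<close>, unless \<open>v\<close> is that tail. Hence every vertex value is a value at an
  edge end, and all degrees are positive.\<close>

lemma ex_incident_arc:
  assumes v: "v \<in> verts G"
  shows "\<exists>e\<in>arcs G. tail G e = v \<or> head G e = v"
proof -
  obtain e where e: "e \<in> arcs G" using arcs_ne by auto
  have "(v, tail G e) \<in> (\<Union>e\<in>arcs G. {(tail G e, head G e), (head G e, tail G e)})\<^sup>*"
    using e v by (intro symmetric_step_reachable) auto
  then show ?thesis
    by (cases rule: converse_rtranclE) (use e in auto)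
qed

lemma edge_pt_simps: "edge_pt G len e 0 = Vertex (tail G e)"
  "e \<in> arcs G \<Longrightarrow> edge_pt G len e (len e) = Vertex (head G e)"
  using len_pos[of e] by (auto simp: edge_pt_def)

lemma on_edge_ends: "on_edge G len u e 0 = u (Vertex (tail G e))"
  "e \<in> arcs G \<Longrightarrow> on_edge G len u e (len e) = u (Vertex (head G e))"
  by (simp_all add: on_edge_def edge_pt_simps)

lemma edge_pt_gpoints: "e \<in> arcs G \<Longrightarrow> x \<in> {0..len e} \<Longrightarrow> edge_pt G len e x \<in> gpoints G len"
  by (auto simp: edge_pt_def gpoints_def)

lemma gpointsE:
  assumes "p \<in> gpoints G len"
  obtains e x where "e \<in> arcs G" "x \<in> {0..len e}" "p = edge_pt G len e x"
proof -
  consider v where "v \<in> verts G" "p = Vertex v" | e x where "e \<in> arcs G" "0 < x" "x < len e" "p = Inner e x"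
    using assms by (auto simp: gpoints_def)
  then show ?thesis
  proof cases
    case 1
    then obtain e where e: "e \<in> arcs G" "tail G e = v \<or> head G e = v" using ex_incident_arc by blast
    then show ?thesis
      using that[of e 0] that[of e "len e"] 1 edge_pt_simps[of e] len_pos[of e] by auto
  next
    case 2
    then show ?thesis by (intro that[of e x]) (auto simp: edge_pt_def)
  qed
qed

lemma route_nonneg: "route G len p r q \<Longrightarrow> 0 \<le> r"
  by (induction rule: route.induct) auto

lemma route_edge:
  assumes "e \<in> arcs G" "x \<in> {0..len e}" "y \<in> {0..len e}"
  shows "route G len (edge_pt G len e x) \<bar>x - y\<bar> (edge_pt G len e y)"
  using route.step[OF route.start[OF edge_pt_gpoints[OF assms(1,2)]], OF assms] by simp

lemma route_Vertex:
  assumes "route G len p r (Vertex v)" "(v, w) \<in> (\<Union>e\<in>arcs G. {(tail G e, head G e), (head G e, tail G e)})\<^sup>*"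
  shows "\<exists>r. route G len p r (Vertex w)"
  using assms(2)
proof (induction rule: rtrancl_induct)
  case base
  then show ?case using assms(1) by blast
next
  case (step y z)
  then obtain r where r: "route G len p r (Vertex y)" by blast
  from step.hyps obtain e where e: "e \<in> arcs G"
    and yz: "(y = tail G e \<and> z = head G e) \<or> (y = head G e \<and> z = tail G e)" by auto
  have l: "0 \<in> {0..len e}" "len e \<in> {0..len e}" using len_pos[OF e] by auto
  from yz show ?case
    using route.step[of G len p r e 0, OF _ e l] route.step[of G len p r e "len e", OF _ e l(2,1)] r
      edge_pt_simps[of e] e by auto
qed

text \<open>Connectivity makes the set in the infimum \<open>gdist\<close> nonempty, so that routes
  of length close to the distance exist.\<close>

lemma ex_route:
  assumes "p \<in> gpoints G len" "q \<in> gpoints G len"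
  shows "\<exists>r. route G len p r q"
proof -
  obtain e x where e: "e \<in> arcs G" "x \<in> {0..len e}" "p = edge_pt G len e x" using gpointsE[OF assms(1)] .
  obtain f y where f: "f \<in> arcs G" "y \<in> {0..len f}" "q = edge_pt G len f y" using gpointsE[OF assms(2)] .
  have l: "0 \<in> {0..len e}" "0 \<in> {0..len f}" using len_pos e f by (auto simp: less_imp_le)
  have "\<exists>r. route G len p r (Vertex (tail G f))"
  proof (rule route_Vertex[OF _ symmetric_step_reachable])
    show "route G len p \<bar>x - 0\<bar> (Vertex (tail G e))"
      using route_edge[OF e(1,2) l(1)] e(3) edge_pt_simps(1)[of e] by simp
  qed (use e f in auto)
  then obtain r where "route G len p r (edge_pt G len f 0)" using edge_pt_simps(1)[of f] by auto
  from route.step[OF this f(1) l(2) f(2)] show ?thesis using f(3) by blast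
qed

lemma gdist_le: "route G len p r q \<Longrightarrow> gdist G len p q \<le> r"
  unfolding gdist_def by (rule cInf_lower) (auto intro!: bdd_belowI[of _ 0] route_nonneg)

lemma gdist_edge:
  assumes "e \<in> arcs G" "x \<in> {0..len e}" "y \<in> {0..len e}"
  shows "gdist G len (edge_pt G len e x) (edge_pt G len e y) \<le> \<bar>x - y\<bar>"
    and "0 \<le> gdist G len (edge_pt G len e x) (edge_pt G len e y)"
proof -
  show "gdist G len (edge_pt G len e x) (edge_pt G len e y) \<le> \<bar>x - y\<bar>"
    by (rule gdist_le[OF route_edge[OF assms]])
  show "0 \<le> gdist G len (edge_pt G len e x) (edge_pt G len e y)"
    unfolding gdist_def using route_edge[OF assms] route_nonneg by (intro cInf_greatest) auto
qed

lemma graph_lipschitz_edge: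
  assumes "graph_lipschitz G len f"
  obtains K where "0 \<le> K" "\<And>e x y. e \<in> arcs G \<Longrightarrow> x \<in> {0..len e} \<Longrightarrow> y \<in> {0..len e} \<Longrightarrow>
    \<bar>on_edge G len f e x - on_edge G len f e y\<bar> \<le> K * \<bar>x - y\<bar>"
proof -
  obtain K where K: "\<forall>p\<in>gpoints G len. \<forall>q\<in>gpoints G len. \<bar>f p - f q\<bar> \<le> K * gdist G len p q"
    using assms by (auto simp: graph_lipschitz_def)
  show ?thesis
  proof (rule that[of "max K 0"])
    fix e x y assume e: "e \<in> arcs G" "x \<in> {0..len e}" "y \<in> {0..len e}"
    define d where "d = gdist G len (edge_pt G len e x) (edge_pt G len e y)"
    have "\<bar>on_edge G len f e x - on_edge G len f e y\<bar> \<le> K * d"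
      using K edge_pt_gpoints[OF e(1,2)] edge_pt_gpoints[OF e(1,3)] by (simp add: on_edge_def d_def)
    also have "\<dots> \<le> max K 0 * d" using gdist_edge(2)[OF e] by (intro mult_right_mono) (auto simp: d_def)
    also have "\<dots> \<le> max K 0 * \<bar>x - y\<bar>" using gdist_edge(1)[OF e] by (intro mult_left_mono) (auto simp: d_def)
    finally show "\<bar>on_edge G len f e x - on_edge G len f e y\<bar> \<le> max K 0 * \<bar>x - y\<bar>" .
  qed auto
qed

lemma graph_continuous_edge:
  assumes u: "graph_continuous G len u" and e: "e \<in> arcs G"
  shows "continuous_on {0..len e} (on_edge G len u e)"
  unfolding continuous_on_iff
proof (intro ballI allI impI)
  fix x \<epsilon> :: real assume x: "x \<in> {0..len e}" "0 < \<epsilon>"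
  obtain \<delta> where \<delta>: "\<delta> > 0" "\<And>q. q \<in> gpoints G len \<Longrightarrow> gdist G len (edge_pt G len e x) q < \<delta> \<Longrightarrow>
      \<bar>u q - u (edge_pt G len e x)\<bar> < \<epsilon>"
    using u edge_pt_gpoints[OF e x(1)] x(2) unfolding graph_continuous_def by metis
  have "dist (on_edge G len u e y) (on_edge G len u e x) < \<epsilon>" if y: "y \<in> {0..len e}" "dist y x < \<delta>" for y
  proof -
    have "\<bar>x - y\<bar> < \<delta>" using y by (simp add: dist_real_def abs_minus_commute)
    then show ?thesis
      using \<delta>(2)[OF edge_pt_gpoints[OF e y(1)]] gdist_edge(1)[OF e x(1) y(1)]
      by (simp add: on_edge_def dist_real_def)
  qed
  then show "\<exists>d>0. \<forall>x'\<in>{0..len e}. dist x' x < d \<longrightarrow> dist (on_edge G len u e x') (on_edge G len u e x) < \<epsilon>"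
    using \<delta>(1) by blast
qed

lemma route_lipschitz:
  assumes lip: "\<And>e x y. e \<in> arcs G \<Longrightarrow> x \<in> {0..len e} \<Longrightarrow> y \<in> {0..len e} \<Longrightarrow>
    \<bar>on_edge G len u e x - on_edge G len u e y\<bar> \<le> K * \<bar>x - y\<bar>"
    and "route G len p r q"
  shows "\<bar>u q - u p\<bar> \<le> K * r"
  using assms(2)
proof (induction rule: route.induct)
  case (step r e x y)
  have "\<bar>u (edge_pt G len e y) - u (edge_pt G len e x)\<bar> \<le> K * \<bar>x - y\<bar>"
    using lip[OF step.hyps(2,4,3)] by (simp add: on_edge_def abs_minus_commute)
  then show ?case using step.IH by (simp add: distrib_left)
qed simp

text \<open>Chains the edgewise estimates along a route whose length is close to the
  distance.\<close>

lemma graph_continuous_of_edge_lipschitz: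
  assumes lip: "\<And>e x y. e \<in> arcs G \<Longrightarrow> x \<in> {0..len e} \<Longrightarrow> y \<in> {0..len e} \<Longrightarrow>
    \<bar>on_edge G len u e x - on_edge G len u e y\<bar> \<le> K * \<bar>x - y\<bar>" and "0 \<le> K"
  shows "graph_continuous G len u"
  unfolding graph_continuous_def
proof (intro ballI allI impI)
  fix p and \<epsilon> :: real assume p: "p \<in> gpoints G len" and "\<epsilon> > 0"
  have "\<bar>u q - u p\<bar> < \<epsilon>" if q: "q \<in> gpoints G len" "gdist G len p q < \<epsilon> / (K + 1)" for q
  proof -
    obtain r where r: "route G len p r q" "r < \<epsilon> / (K + 1)"
      using ex_route[OF p q(1)] q(2) unfolding gdist_def by (metis (mono_tags, lifting) cInf_lessD empty_iff mem_Collect_eq)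
    have "\<bar>u q - u p\<bar> \<le> K * r" by (rule route_lipschitz[OF lip r(1)])
    also have "\<dots> \<le> (K + 1) * r" using route_nonneg[OF r(1)] by (simp add: distrib_right)
    also have "\<dots> < \<epsilon>" using r(2) \<open>0 \<le> K\<close> by (simp add: field_simps)
    finally show ?thesis .
  qed
  then show "\<exists>\<delta>>0. \<forall>q\<in>gpoints G len. gdist G len p q < \<delta> \<longrightarrow> \<bar>u q - u p\<bar> < \<epsilon>"
    using \<open>\<epsilon> > 0\<close> \<open>0 \<le> K\<close> by (intro exI[of _ "\<epsilon> / (K + 1)"]) auto
qed

lemma sum_arcs_tail: "(\<Sum>e\<in>arcs G. f e) = (\<Sum>v\<in>verts G. \<Sum>e\<in>out_arcs G v. f e)"
  unfolding out_arcs_def by (rule sum.group[symmetric]) auto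

lemma sum_arcs_head: "(\<Sum>e\<in>arcs G. f e) = (\<Sum>v\<in>verts G. \<Sum>e\<in>in_arcs G v. f e)"
  unfolding in_arcs_def by (rule sum.group[symmetric]) auto

text \<open>Collects the boundary terms of edgewise integration by parts at the vertices; a loop
  contributes through both of its ends.\<close>

lemma sum_boundary_terms:
  fixes P R :: "'e \<Rightarrow> real"
  shows "(\<Sum>e\<in>arcs G. P e * w (head G e) - R e * w (tail G e)) =
    (\<Sum>v\<in>verts G. w v * ((\<Sum>e\<in>in_arcs G v. P e) - (\<Sum>e\<in>out_arcs G v. R e)))"
proof -
  have "(\<Sum>e\<in>arcs G. P e * w (head G e)) = (\<Sum>v\<in>verts G. w v * (\<Sum>e\<in>in_arcs G v. P e))"
    unfolding sum_arcs_head sum_distrib_left by (intro sum.cong refl) (auto simp: in_arcs_def)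
  moreover have "(\<Sum>e\<in>arcs G. R e * w (tail G e)) = (\<Sum>v\<in>verts G. w v * (\<Sum>e\<in>out_arcs G v. R e))"
    unfolding sum_arcs_tail sum_distrib_left by (intro sum.cong refl) (auto simp: out_arcs_def)
  ultimately show ?thesis by (simp add: sum_subtractf right_diff_distrib)
qed

lemma outgoing_deriv_sum_eq:
  assumes "\<And>e. e \<in> arcs G \<Longrightarrow> primitive_on 0 (len e) (on_edge G len u e) (g e)"
    and "\<And>e. e \<in> arcs G \<Longrightarrow> continuous_on {0..len e} (g e)"
  shows "outgoing_deriv_sum G len u v = (\<Sum>e\<in>out_arcs G v. g e 0) - (\<Sum>e\<in>in_arcs G v. g e (len e))"
proof -
  have "vector_derivative (on_edge G len u e) (at x within {0..len e}) = g e x"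
    if e: "e \<in> arcs G" "x \<in> {0..len e}" for e x
  proof (rule vector_derivative_within_cbox[of 0 "len e", unfolded box_real])
    show "(on_edge G len u e has_vector_derivative g e x) (at x within {0..len e})"
      using primitive_on_has_derivative[OF assms(1)[OF e(1)] assms(2)[OF e(1)] e(2)]
      by (simp add: has_real_derivative_iff_has_vector_derivative)
  qed (use e len_pos in auto)
  then have d: "vector_derivative (on_edge G len u e) (at 0 within {0..len e}) = g e 0"
    "vector_derivative (on_edge G len u e) (at (len e) within {0..len e}) = g e (len e)"
    if "e \<in> arcs G" for e
    using len_pos[OF that] that by auto
  have "(\<Sum>e\<in>out_arcs G v. vector_derivative (on_edge G len u e) (at 0 within {0..len e})) = (\<Sum>e\<in>out_arcs G v. g e 0)"
    by (intro sum.cong refl d) (auto simp: out_arcs_def)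
  moreover have "(\<Sum>e\<in>in_arcs G v. - vector_derivative (on_edge G len u e) (at (len e) within {0..len e}))
      = (\<Sum>e\<in>in_arcs G v. - g e (len e))"
    by (intro sum.cong refl arg_cong[of _ _ uminus] d) (auto simp: in_arcs_def)
  ultimately show ?thesis by (simp add: outgoing_deriv_sum_def sum_negf)
qed

end

section \<open>The energy form\<close>

type_synonym ('v, 'e) energy_pair = "(('v, 'e) gpoint \<Rightarrow> real) \<times> ('e \<Rightarrow> real \<Rightarrow> real)"

text \<open>The potential enters only through the bounded representative \<open>k e\<close> of \<open>\<kappa>\<^sub>e\<^sup>2\<close>.\<close>
locale quantum_graph = metric_graph G len for G :: "('v, 'e) pre_digraph" and len +
  fixes a \<kappa> :: "('v, 'e) gpoint \<Rightarrow> real" and k :: "'e \<Rightarrow> real \<Rightarrow> real" and \<alpha> a\<^sub>0 c\<^sub>0 S \<delta> :: real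
  assumes a_lipschitz: "graph_lipschitz G len a"
    and a_ge: "p \<in> gpoints G len \<Longrightarrow> a\<^sub>0 \<le> a p" and a\<^sub>0_pos: "0 < a\<^sub>0"
    and k_bmeas: "e \<in> arcs G \<Longrightarrow> bmeas 0 (len e) (k e)"
    and k_eq: "e \<in> arcs G \<Longrightarrow> negligible {x \<in> {0<..<len e}. (on_edge G len \<kappa> e x)\<^sup>2 \<noteq> k e x}"
    and k_ge: "c\<^sub>0 \<le> k e x"
    and S_nonneg: "0 \<le> S" and S_degree: "v \<in> verts G \<Longrightarrow> \<bar>\<alpha>\<bar> \<le> S * real (vdegree G v)"
    and \<delta>: "0 < \<delta>" "\<delta> \<le> c\<^sub>0"
    and coercive: "0 \<le> \<alpha> \<or> (\<forall>e\<in>arcs G. 2 * S * len e \<le> a\<^sub>0 \<and> 4 * S / len e \<le> c\<^sub>0 - \<delta>)"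
begin

abbreviation res :: "(('v, 'e) gpoint \<Rightarrow> real) \<Rightarrow> 'e \<Rightarrow> real \<Rightarrow> real" where
  "res \<equiv> on_edge G len"

lemma res_add: "res (u + v) e = (\<lambda>x. res u e x + res v e x)"
  and res_scaleR: "res (c *\<^sub>R u) e = (\<lambda>x. c * res u e x)"
  and res_zero: "res 0 e = (\<lambda>x. 0)"
  by (auto simp: on_edge_def scaleR_fun_def fun_eq_iff)

lemma curried_add: "(g + h) e = (\<lambda>x. g e x + h e x)"
  and curried_scaleR: "(c *\<^sub>R g) e = (\<lambda>x. c * g e x)"
  and curried_zero: "0 e = (\<lambda>x. 0)" for g h :: "'e \<Rightarrow> real \<Rightarrow> real"
  by (auto simp: scaleR_fun_def fun_eq_iff)

lemma a_continuous: "e \<in> arcs G \<Longrightarrow> continuous_on {0..len e} (res a e)"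
  and a_edge_ge: "e \<in> arcs G \<Longrightarrow> x \<in> {0..len e} \<Longrightarrow> a\<^sub>0 \<le> res a e x"
proof -
  obtain K where K: "0 \<le> K" "\<And>e x y. e \<in> arcs G \<Longrightarrow> x \<in> {0..len e} \<Longrightarrow> y \<in> {0..len e} \<Longrightarrow>
      \<bar>res a e x - res a e y\<bar> \<le> K * \<bar>x - y\<bar>"
    by (rule graph_lipschitz_edge[OF a_lipschitz]) blast
  show "continuous_on {0..len e} (res a e)" if "e \<in> arcs G"
    by (rule lipschitz_on_continuous_on[where L=K])
      (use K that in \<open>auto intro!: lipschitz_onI simp: dist_real_def\<close>)
  show "a\<^sub>0 \<le> res a e x" if "e \<in> arcs G" "x \<in> {0..len e}"
    using a_ge[OF edge_pt_gpoints[OF that]] by (simp add: on_edge_def)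
qed

lemma a_primitive:
  assumes "e \<in> arcs G"
  obtains b where "primitive_on 0 (len e) (res a e) b" "bmeas 0 (len e) b"
proof -
  obtain K where K: "0 \<le> K" "\<And>e x y. e \<in> arcs G \<Longrightarrow> x \<in> {0..len e} \<Longrightarrow> y \<in> {0..len e} \<Longrightarrow>
      \<bar>res a e x - res a e y\<bar> \<le> K * \<bar>x - y\<bar>"
    by (rule graph_lipschitz_edge[OF a_lipschitz]) blast
  obtain b where b: "primitive_on 0 (len e) (res a e) b" "b \<in> borel_measurable borel" "\<And>x. \<bar>b x\<bar> \<le> K"
    using lipschitz_primitive[OF len_pos[OF assms] K(2)[OF assms]] by blast
  have "bmeas 0 (len e) b"
    using b(2,3) by (intro bmeasI[where K=K] measurable_restrict_space1 measurable_completion) auto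
  then show ?thesis using b(1) by (intro that)
qed

text \<open>Since \<open>a\<close> is at least \<open>a\<^sub>0\<close>, its reciprocal is Lipschitz
  with constant \<open>K / a\<^sub>0\<^sup>2\<close>. This gives a bounded density to the derivative
  of a solution, the product of its flux with \<open>1 / a\<close>.\<close>

lemma inverse_a_primitive:
  assumes e: "e \<in> arcs G"
  obtains c where "primitive_on 0 (len e) (\<lambda>x. 1 / res a e x) c" "bmeas 0 (len e) c"
proof -
  obtain K where K: "0 \<le> K" "\<And>e x y. e \<in> arcs G \<Longrightarrow> x \<in> {0..len e} \<Longrightarrow> y \<in> {0..len e} \<Longrightarrow>
      \<bar>res a e x - res a e y\<bar> \<le> K * \<bar>x - y\<bar>"
    by (rule graph_lipschitz_edge[OF a_lipschitz]) blast
  have lip: "\<bar>1 / res a e x - 1 / res a e y\<bar> \<le> K / a\<^sub>0\<^sup>2 * \<bar>x - y\<bar>"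
    if xy: "x \<in> {0..len e}" "y \<in> {0..len e}" for x y
  proof -
    have p: "a\<^sub>0 \<le> res a e x" "a\<^sub>0 \<le> res a e y" using a_edge_ge[OF e] xy by auto
    then have pos: "0 < res a e x" "0 < res a e y" using a\<^sub>0_pos by auto
    then have "1 / res a e x - 1 / res a e y = (res a e y - res a e x) / (res a e x * res a e y)"
      by (simp add: field_simps)
    then have "\<bar>1 / res a e x - 1 / res a e y\<bar> = \<bar>res a e x - res a e y\<bar> / (res a e x * res a e y)"
      using pos by (simp add: abs_mult abs_minus_commute)
    also have "\<dots> \<le> (K * \<bar>x - y\<bar>) / (a\<^sub>0 * a\<^sub>0)"
      using K(2)[OF e xy] p a\<^sub>0_pos pos by (intro frac_le mult_mono) auto
    finally show ?thesis by (simp add: power2_eq_square)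
  qed
  obtain c where c: "primitive_on 0 (len e) (\<lambda>x. 1 / res a e x) c" "c \<in> borel_measurable borel" "\<And>x. \<bar>c x\<bar> \<le> K / a\<^sub>0\<^sup>2"
    using lipschitz_primitive[OF len_pos[OF e] lip] by blast
  have "bmeas 0 (len e) c"
    using c(2,3) by (intro bmeasI[where K="K / a\<^sub>0\<^sup>2"] measurable_restrict_space1 measurable_completion) auto
  then show ?thesis using c(1) by (intro that)
qed

text \<open>The form domain, restricted to functions with bounded derivative; a function is paired with a
  representative of its edgewise derivative so that the forms are bilinear without reference to
  almost everywhere classes.\<close>
definition energy_space :: "('v, 'e) energy_pair set" where
  "energy_space = {x. (\<forall>p. p \<notin> gpoints G len \<longrightarrow> fst x p = 0) \<and>
     (\<forall>e\<in>arcs G. primitive_on 0 (len e) (res (fst x) e) (snd x e) \<and> bmeas 0 (len e) (snd x e))}"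

definition L2_form :: "('v, 'e) energy_pair \<Rightarrow> ('v, 'e) energy_pair \<Rightarrow> real" where
  "L2_form x y = (\<Sum>e\<in>arcs G. integral {0..len e} (\<lambda>t. res (fst x) e t * res (fst y) e t))"

definition deriv_form :: "('v, 'e) energy_pair \<Rightarrow> ('v, 'e) energy_pair \<Rightarrow> real" where
  "deriv_form x y = (\<Sum>e\<in>arcs G. integral {0..len e} (\<lambda>t. snd x e t * snd y e t))"

abbreviation energy_density :: "('v, 'e) energy_pair \<Rightarrow> ('v, 'e) energy_pair \<Rightarrow> 'e \<Rightarrow> real \<Rightarrow> real" where
  "energy_density x y e t \<equiv> res a e t * snd x e t * snd y e t + k e t * res (fst x) e t * res (fst y) e t"

definition energy_form :: "('v, 'e) energy_pair \<Rightarrow> ('v, 'e) energy_pair \<Rightarrow> real" where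
  "energy_form x y = (\<Sum>e\<in>arcs G. integral {0..len e} (\<lambda>t. energy_density x y e t))
     + \<alpha> * (\<Sum>v\<in>verts G. fst x (Vertex v) * fst y (Vertex v))"

lemma energy_spaceD:
  assumes "x \<in> energy_space"
  shows "p \<notin> gpoints G len \<Longrightarrow> fst x p = 0"
    and "e \<in> arcs G \<Longrightarrow> primitive_on 0 (len e) (res (fst x) e) (snd x e)"
    and "e \<in> arcs G \<Longrightarrow> bmeas 0 (len e) (snd x e)"
    and "e \<in> arcs G \<Longrightarrow> bmeas 0 (len e) (res (fst x) e)"
  using assms bmeas_continuous[OF primitive_on_continuous] by (auto simp: energy_space_def)

lemma energy_spaceI:
  assumes "\<And>p. p \<notin> gpoints G len \<Longrightarrow> u p = 0"
    and "\<And>e. e \<in> arcs G \<Longrightarrow> primitive_on 0 (len e) (res u e) (g e)"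
    and "\<And>e. e \<in> arcs G \<Longrightarrow> bmeas 0 (len e) (g e)"
  shows "(u, g) \<in> energy_space"
  using assms by (auto simp: energy_space_def)

lemma subspace_energy_space: "subspace energy_space"
  unfolding subspace_def
proof (intro conjI ballI allI)
  have "(0, 0) \<in> energy_space"
    by (rule energy_spaceI) (simp, simp only: res_zero curried_zero primitive_on_const, simp only: curried_zero bmeas_const)
  then show "0 \<in> energy_space" by (simp add: zero_prod_def)
next
  fix x y assume "x \<in> energy_space" "y \<in> energy_space"
  note D = energy_spaceD[OF this(1)] energy_spaceD[OF this(2)]
  have "(fst x + fst y, snd x + snd y) \<in> energy_space"
    by (rule energy_spaceI)
      (simp add: D, simp only: res_add curried_add D primitive_on_add, simp only: curried_add D bmeas_add)
  then show "x + y \<in> energy_space" by (simp add: plus_prod_def)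
next
  fix x and c :: real assume "x \<in> energy_space"
  note D = energy_spaceD[OF this]
  have "(c *\<^sub>R fst x, c *\<^sub>R snd x) \<in> energy_space"
    by (rule energy_spaceI)
      (simp add: D scaleR_fun_def, simp only: res_scaleR curried_scaleR D primitive_on_cmult,
        simp only: curried_scaleR D bmeas_mult bmeas_const)
  then show "c *\<^sub>R x \<in> energy_space" by (simp add: scaleR_prod_def)
qed

lemma bmeas_L2_density:
  assumes "x \<in> energy_space" "y \<in> energy_space" "e \<in> arcs G"
  shows "bmeas 0 (len e) (\<lambda>t. res (fst x) e t * res (fst y) e t)"
    and "bmeas 0 (len e) (\<lambda>t. snd x e t * snd y e t)"
    and "bmeas 0 (len e) (\<lambda>t. res a e t * snd x e t * snd y e t)"
    and "bmeas 0 (len e) (\<lambda>t. k e t * res (fst x) e t * res (fst y) e t)"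
    and "bmeas 0 (len e) (\<lambda>t. energy_density x y e t)"
  using assms
  by (auto intro!: bmeas_add bmeas_mult energy_spaceD bmeas_continuous[OF a_continuous] k_bmeas)

lemma L2_form_symmetric: "symmetric_form energy_space L2_form"
proof
  fix x y z :: "('v, 'e) energy_pair" and c :: real
  show "L2_form x y = L2_form y x" by (simp add: L2_form_def mult.commute)
  show "L2_form (c *\<^sub>R x) z = c * L2_form x z"
    by (simp add: L2_form_def res_scaleR sum_distrib_left mult.assoc)
  assume V: "x \<in> energy_space" "y \<in> energy_space" "z \<in> energy_space"
  show "L2_form (x + y) z = L2_form x z + L2_form y z"
    unfolding L2_form_def sum.distrib[symmetric]
  proof (intro sum.cong refl)
    fix e assume e: "e \<in> arcs G"
    show "integral {0..len e} (\<lambda>t. res (fst (x + y)) e t * res (fst z) e t) =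
      integral {0..len e} (\<lambda>t. res (fst x) e t * res (fst z) e t) + integral {0..len e} (\<lambda>t. res (fst y) e t * res (fst z) e t)"
      using integral_add[OF bmeas_integrable[OF bmeas_L2_density(1)[OF V(1,3) e]]
          bmeas_integrable[OF bmeas_L2_density(1)[OF V(2,3) e]]]
      by (simp add: res_add distrib_right)
  qed
qed (rule subspace_energy_space)

lemma L2_form_psd: "psd_form energy_space L2_form"
proof -
  interpret symmetric_form energy_space L2_form by (rule L2_form_symmetric)
  show ?thesis
    by unfold_locales
      (auto simp: L2_form_def intro!: sum_nonneg integral_nonneg bmeas_integrable bmeas_L2_density)
qed

lemma energy_form_symmetric: "symmetric_form energy_space energy_form"
proof
  fix x y z :: "('v, 'e) energy_pair" and c :: real
  show "energy_form x y = energy_form y x" by (simp add: energy_form_def mult.commute mult.left_commute)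
  have "integral {0..len e} (\<lambda>t. energy_density (c *\<^sub>R x) z e t) =
    c * integral {0..len e} (\<lambda>t. energy_density x z e t)" for e
  proof -
    have "(\<lambda>t. energy_density (c *\<^sub>R x) z e t) =
      (\<lambda>t. c * (energy_density x z e t))"
      by (simp add: fun_eq_iff res_scaleR curried_scaleR algebra_simps)
    then show ?thesis by simp
  qed
  moreover have "(\<Sum>v\<in>verts G. fst (c *\<^sub>R x) (Vertex v) * fst z (Vertex v)) = c * (\<Sum>v\<in>verts G. fst x (Vertex v) * fst z (Vertex v))"
    by (simp add: scaleR_fun_def sum_distrib_left mult.assoc)
  ultimately show "energy_form (c *\<^sub>R x) z = c * energy_form x z"
    unfolding energy_form_def by (simp only: sum_distrib_left[symmetric] distrib_left mult.left_commute)
  assume V: "x \<in> energy_space" "y \<in> energy_space" "z \<in> energy_space"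
  have "(\<Sum>e\<in>arcs G. integral {0..len e} (\<lambda>t. energy_density (x + y) z e t)) =
    (\<Sum>e\<in>arcs G. integral {0..len e} (\<lambda>t. energy_density x z e t) + integral {0..len e} (\<lambda>t. energy_density y z e t))"
  proof (intro sum.cong refl)
    fix e assume e: "e \<in> arcs G"
    have "(\<lambda>t. energy_density (x + y) z e t) =
      (\<lambda>t. (energy_density x z e t) +
        (energy_density y z e t))"
      by (simp add: res_add fun_eq_iff algebra_simps)
    then show "integral {0..len e} (\<lambda>t. energy_density (x + y) z e t) =
      integral {0..len e} (\<lambda>t. energy_density x z e t) + integral {0..len e} (\<lambda>t. energy_density y z e t)"
      using integral_add[OF bmeas_integrable[OF bmeas_L2_density(5)[OF V(1,3) e]]
          bmeas_integrable[OF bmeas_L2_density(5)[OF V(2,3) e]]] by simp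
  qed
  moreover have "(\<Sum>v\<in>verts G. fst (x + y) (Vertex v) * fst z (Vertex v)) =
    (\<Sum>v\<in>verts G. fst x (Vertex v) * fst z (Vertex v)) + (\<Sum>v\<in>verts G. fst y (Vertex v) * fst z (Vertex v))"
    by (simp add: distrib_right sum.distrib)
  ultimately show "energy_form (x + y) z = energy_form x z + energy_form y z"
    unfolding energy_form_def by (simp only: sum.distrib distrib_left)
qed (rule subspace_energy_space)

section \<open>Upper and lower bounds for the energy form\<close>

abbreviation edge_L2 :: "('v, 'e) energy_pair \<Rightarrow> 'e \<Rightarrow> real" where
   "edge_L2 x e \<equiv> integral {0..len e} (\<lambda>t. (res (fst x) e t)\<^sup>2)"
abbreviation edge_deriv :: "('v, 'e) energy_pair \<Rightarrow> 'e \<Rightarrow> real" where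
   "edge_deriv x e \<equiv> integral {0..len e} (\<lambda>t. (snd x e t)\<^sup>2)"

lemma L2_form_diag: "L2_form x x = (\<Sum>e\<in>arcs G. edge_L2 x e)"
  and deriv_form_diag: "deriv_form x x = (\<Sum>e\<in>arcs G. edge_deriv x e)"
  by (simp_all add: L2_form_def deriv_form_def power2_eq_square)

lemma edge_L2_nonneg: "x \<in> energy_space \<Longrightarrow> e \<in> arcs G \<Longrightarrow> 0 \<le> edge_L2 x e"
  and edge_deriv_nonneg: "x \<in> energy_space \<Longrightarrow> e \<in> arcs G \<Longrightarrow> 0 \<le> edge_deriv x e"
  by (auto intro!: integral_nonneg bmeas_integrable bmeas_L2_density simp: power2_eq_square)

lemma energy_form_ge:
  assumes x: "x \<in> energy_space"
  shows "energy_form x x \<ge> a\<^sub>0 * deriv_form x x + c\<^sub>0 * L2_form x x + \<alpha> * (\<Sum>v\<in>verts G. (fst x (Vertex v))\<^sup>2)"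
proof -
  have "(\<Sum>e\<in>arcs G. a\<^sub>0 * edge_deriv x e + c\<^sub>0 * edge_L2 x e) \<le>
    (\<Sum>e\<in>arcs G. integral {0..len e} (\<lambda>t. energy_density x x e t))"
  proof (rule sum_mono)
    fix e assume e: "e \<in> arcs G"
    have i: "(\<lambda>t. a\<^sub>0 * (snd x e t)\<^sup>2) integrable_on {0..len e}" "(\<lambda>t. c\<^sub>0 * (res (fst x) e t)\<^sup>2) integrable_on {0..len e}"
      unfolding power2_eq_square
      by (intro integrable_on_mult_right bmeas_integrable bmeas_L2_density x e)+
    have "a\<^sub>0 * edge_deriv x e + c\<^sub>0 * edge_L2 x e = integral {0..len e} (\<lambda>t. a\<^sub>0 * (snd x e t)\<^sup>2 + c\<^sub>0 * (res (fst x) e t)\<^sup>2)"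
      by (subst integral_add[OF i]) simp
    also have "\<dots> \<le> integral {0..len e} (\<lambda>t. energy_density x x e t)"
    proof (rule integral_le)
      show "(\<lambda>t. a\<^sub>0 * (snd x e t)\<^sup>2 + c\<^sub>0 * (res (fst x) e t)\<^sup>2) integrable_on {0..len e}" by (intro integrable_add i)
      show "(\<lambda>t. energy_density x x e t) integrable_on {0..len e}"
        by (intro bmeas_integrable bmeas_L2_density x e)
      show "a\<^sub>0 * (snd x e t)\<^sup>2 + c\<^sub>0 * (res (fst x) e t)\<^sup>2 \<le> energy_density x x e t"
        if "t \<in> {0..len e}" for t
        unfolding power2_eq_square mult.assoc
        using a_edge_ge[OF e that] k_ge[of e t] by (intro add_mono mult_right_mono) auto
    qed
    finally show "a\<^sub>0 * edge_deriv x e + c\<^sub>0 * edge_L2 x e \<le> \<dots>" .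
  qed
  then show ?thesis
    by (simp add: energy_form_def L2_form_diag deriv_form_diag sum.distrib sum_distrib_left power2_eq_square)
qed

text \<open>Vanishing at the vertices removes the term with \<open>\<alpha>\<close>, whatever its
  sign; the bound is meant for trial functions supported on one edge.\<close>

lemma energy_form_le:
  obtains A where "A > 0" "\<And>x. x \<in> energy_space \<Longrightarrow> (\<And>v. v \<in> verts G \<Longrightarrow> fst x (Vertex v) = 0) \<Longrightarrow>
    energy_form x x \<le> A * (deriv_form x x + L2_form x x)"
proof -
  have "\<exists>A>0. \<forall>t\<in>{0..len e}. res a e t \<le> A \<and> k e t \<le> A" if e: "e \<in> arcs G" for e
  proof -
    obtain K L where "\<And>t. t \<in> {0..len e} \<Longrightarrow> \<bar>res a e t\<bar> \<le> K" "\<And>t. t \<in> {0..len e} \<Longrightarrow> \<bar>k e t\<bar> \<le> L"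
      using bmeasE[OF bmeas_continuous[OF a_continuous[OF e]]] bmeasE[OF k_bmeas[OF e]] by metis
    then have *: "res a e t \<le> K" "k e t \<le> L" if "t \<in> {0..len e}" for t
      using that by (fastforce simp: abs_le_iff)+
    show ?thesis
    proof (intro exI[of _ "max 1 (max K L)"] conjI ballI)
      fix t assume "t \<in> {0..len e}"
      from *[OF this] show "res a e t \<le> max 1 (max K L)" "k e t \<le> max 1 (max K L)" by auto
    qed simp
  qed
  then obtain A where A: "\<And>e. e \<in> arcs G \<Longrightarrow> A e > 0" "\<And>e t. e \<in> arcs G \<Longrightarrow> t \<in> {0..len e} \<Longrightarrow> res a e t \<le> A e \<and> k e t \<le> A e"
    by metis
  define B where "B = Max (A ` arcs G)"
  have AB: "A e \<le> B" if "e \<in> arcs G" for e unfolding B_def using that by (intro Max_ge) auto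
  have "B > 0" using AB A(1) arcs_ne by (meson all_not_in_conv less_le_trans)
  show ?thesis
  proof (rule that[OF \<open>B > 0\<close>])
    fix x assume x: "x \<in> energy_space" and v0: "\<And>v. v \<in> verts G \<Longrightarrow> fst x (Vertex v) = 0"
    have "(\<Sum>e\<in>arcs G. integral {0..len e} (\<lambda>t. energy_density x x e t)) \<le> (\<Sum>e\<in>arcs G. B * edge_deriv x e + B * edge_L2 x e)"
    proof (rule sum_mono)
      fix e assume e: "e \<in> arcs G"
      have i: "(\<lambda>t. B * (snd x e t)\<^sup>2) integrable_on {0..len e}" "(\<lambda>t. B * (res (fst x) e t)\<^sup>2) integrable_on {0..len e}"
        unfolding power2_eq_square
        by (intro integrable_on_mult_right bmeas_integrable bmeas_L2_density x e)+
      have "integral {0..len e} (\<lambda>t. energy_density x x e t)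
        \<le> integral {0..len e} (\<lambda>t. B * (snd x e t)\<^sup>2 + B * (res (fst x) e t)\<^sup>2)"
      proof (rule integral_le)
        show "(\<lambda>t. B * (snd x e t)\<^sup>2 + B * (res (fst x) e t)\<^sup>2) integrable_on {0..len e}" by (intro integrable_add i)
        show "(\<lambda>t. energy_density x x e t) integrable_on {0..len e}"
          by (intro bmeas_integrable bmeas_L2_density x e)
        show "energy_density x x e t \<le> B * (snd x e t)\<^sup>2 + B * (res (fst x) e t)\<^sup>2"
          if "t \<in> {0..len e}" for t
          unfolding power2_eq_square mult.assoc
          using A(2)[OF e that] AB[OF e] by (intro add_mono mult_right_mono) auto
      qed
      also have "\<dots> = B * edge_deriv x e + B * edge_L2 x e"
        by (subst integral_add[OF i]) simp
      finally show "integral {0..len e} (\<lambda>t. energy_density x x e t)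
        \<le> B * edge_deriv x e + B * edge_L2 x e" .
    qed
    then show "energy_form x x \<le> B * (deriv_form x x + L2_form x x)"
      by (simp add: energy_form_def L2_form_diag deriv_form_diag sum.distrib sum_distrib_left distrib_left v0)
  qed
qed

text \<open>The weight \<open>S * vdegree G v\<close> distributes each vertex term over the edge
  ends at \<open>v\<close>. Every edge receives two traces, estimated on the pieces of length
  \<open>h e\<close> next to its ends, which doubles the constants of
  \<open>trace_inequality\<close>.\<close>

lemma vertex_values_le:
  assumes x: "x \<in> energy_space" and h: "\<And>e. e \<in> arcs G \<Longrightarrow> 0 < h e \<and> h e \<le> len e"
  shows "\<bar>\<alpha>\<bar> * (\<Sum>v\<in>verts G. (fst x (Vertex v))\<^sup>2) \<le> (\<Sum>e\<in>arcs G. S * (4 / h e * edge_L2 x e + 2 * h e * edge_deriv x e))"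
proof -
  have "\<bar>\<alpha>\<bar> * (\<Sum>v\<in>verts G. (fst x (Vertex v))\<^sup>2) \<le> (\<Sum>v\<in>verts G. S * (real (vdegree G v) * (fst x (Vertex v))\<^sup>2))"
    unfolding sum_distrib_left mult.assoc[symmetric] by (intro sum_mono mult_right_mono S_degree) auto
  also have "\<dots> = S * ((\<Sum>v\<in>verts G. \<Sum>e\<in>out_arcs G v. (fst x (Vertex (tail G e)))\<^sup>2) +
      (\<Sum>v\<in>verts G. \<Sum>e\<in>in_arcs G v. (fst x (Vertex (head G e)))\<^sup>2))"
    by (simp add: sum_distrib_left[symmetric] sum.distrib[symmetric] vdegree_def out_degree_def in_degree_def distrib_right)
  also have "\<dots> = S * ((\<Sum>e\<in>arcs G. (fst x (Vertex (tail G e)))\<^sup>2) + (\<Sum>e\<in>arcs G. (fst x (Vertex (head G e)))\<^sup>2))"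
    by (simp only: sum_arcs_tail[symmetric] sum_arcs_head[symmetric])
  also have "\<dots> = (\<Sum>e\<in>arcs G. S * ((res (fst x) e 0)\<^sup>2 + (res (fst x) e (len e))\<^sup>2))"
    by (simp add: sum_distrib_left[symmetric] sum.distrib on_edge_ends)
  also have "\<dots> \<le> (\<Sum>e\<in>arcs G. S * (4 / h e * edge_L2 x e + 2 * h e * edge_deriv x e))"
  proof (intro sum_mono mult_left_mono S_nonneg)
    fix e assume e: "e \<in> arcs G"
    have h': "0 < h e" "h e \<le> len e" using h[OF e] by auto
    note tr = trace_inequality[OF energy_spaceD(2,3)[OF x e]]
    have "(res (fst x) e 0)\<^sup>2 \<le> 2 / h e * edge_L2 x e + h e * edge_deriv x e"
      using tr[of 0 "h e" 0] h' by simp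
    moreover have "(res (fst x) e (len e))\<^sup>2 \<le> 2 / h e * edge_L2 x e + h e * edge_deriv x e"
      using tr[of "len e - h e" "len e" "len e"] h' by simp
    ultimately show "(res (fst x) e 0)\<^sup>2 + (res (fst x) e (len e))\<^sup>2 \<le> 4 / h e * edge_L2 x e + 2 * h e * edge_deriv x e"
      by (simp add: field_simps)
  qed
  finally show ?thesis .
qed

text \<open>For negative \<open>\<alpha>\<close>, taking \<open>h = len\<close> gives the weights
  \<open>4 * S / len e\<close> and \<open>2 * S * len e\<close>: the potential absorbs the first
  with \<open>\<delta>\<close> to spare, and \<open>a\<^sub>0\<close> absorbs the second, possibly
  with nothing left.\<close>

lemma energy_form_coercive:
  assumes x: "x \<in> energy_space"
  shows "\<delta> * L2_form x x \<le> energy_form x x"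
proof (cases "0 \<le> \<alpha>")
  case True
  have "\<delta> * L2_form x x \<le> c\<^sub>0 * L2_form x x"
    using \<delta> psd_form.nonneg[OF L2_form_psd x] by (intro mult_right_mono) auto
  moreover have "0 \<le> a\<^sub>0 * deriv_form x x" "0 \<le> \<alpha> * (\<Sum>v\<in>verts G. (fst x (Vertex v))\<^sup>2)"
    using a\<^sub>0_pos True edge_deriv_nonneg[OF x] by (auto simp: deriv_form_diag intro!: mult_nonneg_nonneg sum_nonneg)
  ultimately show ?thesis using energy_form_ge[OF x] by linarith
next
  case False
  then have c: "2 * S * len e \<le> a\<^sub>0" "4 * S / len e \<le> c\<^sub>0 - \<delta>" if "e \<in> arcs G" for e
    using coercive that by auto
  have "- \<alpha> * (\<Sum>v\<in>verts G. (fst x (Vertex v))\<^sup>2) \<le> (\<Sum>e\<in>arcs G. S * (4 / len e * edge_L2 x e + 2 * len e * edge_deriv x e))"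
    using vertex_values_le[OF x, of len] len_pos False by simp
  also have "\<dots> \<le> (\<Sum>e\<in>arcs G. (c\<^sub>0 - \<delta>) * edge_L2 x e + a\<^sub>0 * edge_deriv x e)"
  proof (rule sum_mono)
    fix e assume e: "e \<in> arcs G"
    have "4 * S / len e * edge_L2 x e \<le> (c\<^sub>0 - \<delta>) * edge_L2 x e" "2 * S * len e * edge_deriv x e \<le> a\<^sub>0 * edge_deriv x e"
      using c[OF e] edge_L2_nonneg[OF x e] edge_deriv_nonneg[OF x e] by (intro mult_right_mono; simp)+
    then show "S * (4 / len e * edge_L2 x e + 2 * len e * edge_deriv x e) \<le> (c\<^sub>0 - \<delta>) * edge_L2 x e + a\<^sub>0 * edge_deriv x e"
      by (simp add: distrib_left mult_ac)
  qed
  also have "\<dots> = (c\<^sub>0 - \<delta>) * L2_form x x + a\<^sub>0 * deriv_form x x"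
    by (simp add: L2_form_diag deriv_form_diag sum.distrib sum_distrib_left)
  finally show ?thesis using energy_form_ge[OF x] by (simp add: left_diff_distrib)
qed

text \<open>Coercivity alone does not control derivatives. Traces over short pieces cost at most
  half of the derivative term; the large weight that this puts on the \<open>L2\<close> norm is
  harmless for normalised sequences.\<close>

lemma deriv_form_bounded:
  obtains C where "0 \<le> C" "\<And>x. x \<in> energy_space \<Longrightarrow> a\<^sub>0 / 2 * deriv_form x x \<le> energy_form x x + C * L2_form x x"
proof -
  \<comment> \<open>The denominator \<open>4 * S + 4\<close> ensures
    \<open>2 * S * h e \<le> a\<^sub>0 / 2\<close> and stays positive for
    \<open>S = 0\<close>.\<close>
  define h where "h e = min (len e) (a\<^sub>0 / (4 * S + 4))" for e
  have h: "0 < h e" "h e \<le> len e" "2 * S * h e \<le> a\<^sub>0 / 2" if e: "e \<in> arcs G" for e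
  proof -
    show "0 < h e" "h e \<le> len e" using len_pos[OF e] a\<^sub>0_pos S_nonneg by (auto simp: h_def)
    have "2 * S * h e \<le> 2 * S * (a\<^sub>0 / (4 * S + 4))" using S_nonneg by (intro mult_left_mono) (auto simp: h_def)
    also have "\<dots> = a\<^sub>0 / 2 * (S / (S + 1))" using S_nonneg by (simp add: field_simps)
    also have "\<dots> \<le> a\<^sub>0 / 2 * 1" using S_nonneg a\<^sub>0_pos by (intro mult_left_mono) auto
    finally show "2 * S * h e \<le> a\<^sub>0 / 2" by simp
  qed
  define C where "C = (\<Sum>e\<in>arcs G. 4 * S / h e)"
  have C: "4 * S / h e \<le> C" if e: "e \<in> arcs G" for e
    unfolding C_def using h(1) S_nonneg e by (intro member_le_sum) (auto intro!: divide_nonneg_pos)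
  have C0: "0 \<le> C" unfolding C_def using h(1) S_nonneg by (auto intro!: sum_nonneg divide_nonneg_pos)
  show ?thesis
  proof (rule that[OF C0])
    fix x assume x: "x \<in> energy_space"
    have "- \<alpha> * (\<Sum>v\<in>verts G. (fst x (Vertex v))\<^sup>2) \<le> \<bar>\<alpha>\<bar> * (\<Sum>v\<in>verts G. (fst x (Vertex v))\<^sup>2)"
      by (intro mult_right_mono) (auto intro: sum_nonneg)
    also have "\<dots> \<le> (\<Sum>e\<in>arcs G. S * (4 / h e * edge_L2 x e + 2 * h e * edge_deriv x e))"
      using vertex_values_le[OF x, of h] h by simp
    also have "\<dots> \<le> (\<Sum>e\<in>arcs G. C * edge_L2 x e + a\<^sub>0 / 2 * edge_deriv x e)"
    proof (rule sum_mono)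
      fix e assume e: "e \<in> arcs G"
      have "4 * S / h e * edge_L2 x e \<le> C * edge_L2 x e" "2 * S * h e * edge_deriv x e \<le> a\<^sub>0 / 2 * edge_deriv x e"
        using C[OF e] h(3)[OF e] edge_L2_nonneg[OF x e] edge_deriv_nonneg[OF x e] by (intro mult_right_mono; simp)+
      then show "S * (4 / h e * edge_L2 x e + 2 * h e * edge_deriv x e) \<le> C * edge_L2 x e + a\<^sub>0 / 2 * edge_deriv x e"
        by (simp add: distrib_left mult_ac)
    qed
    also have "\<dots> = C * L2_form x x + a\<^sub>0 / 2 * deriv_form x x"
      by (simp add: L2_form_diag deriv_form_diag sum.distrib sum_distrib_left)
    finally have *: "- \<alpha> * (\<Sum>v\<in>verts G. (fst x (Vertex v))\<^sup>2) \<le> C * L2_form x x + a\<^sub>0 / 2 * deriv_form x x" .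
    have "0 \<le> c\<^sub>0 * L2_form x x" using \<delta> psd_form.nonneg[OF L2_form_psd x] by simp
    then show "a\<^sub>0 / 2 * deriv_form x x \<le> energy_form x x + C * L2_form x x"
      using * energy_form_ge[OF x] by simp
  qed
qed

end

section \<open>Eigenfunctions as critical points\<close>

context quantum_graph
begin

text \<open>By the product rule \<open>a * u'\<close> is absolutely continuous, so the weak
  derivative in \<open>L_op\<close> agrees almost everywhere with its density, and the eigenvalue
  equation prescribes that density.\<close>

lemma eigenfunction_edge:
  assumes u: "u \<in> eigenspace G len a \<kappa> \<alpha> \<mu>" and e: "e \<in> arcs G"
  obtains g where "primitive_on 0 (len e) (res u e) g" "continuous_on {0..len e} g"
    "primitive_on 0 (len e) (\<lambda>x. res a e x * g x) (\<lambda>x. (k e x - \<mu>) * res u e x)"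
proof -
  have uL: "H2_interval (len e) (res u e)" "graph_continuous G len u"
    and eig: "AE x in lebesgue_on {0<..<len e}. L_op G len a \<kappa> u e x = \<mu> * res u e x"
    using u e by (auto simp: eigenspace_def L_domain_def)
  obtain g h where g: "primitive_on 0 (len e) (res u e) g" "primitive_on 0 (len e) g h"
    using H2_interval_primitive[OF len_pos[OF e] uL(1) graph_continuous_edge[OF uL(2) e]] .
  obtain b where b: "primitive_on 0 (len e) (res a e) b" using a_primitive[OF e] by blast
  define q where "q x = b x * g x + res a e x * h x" for x
  have p: "primitive_on 0 (len e) (\<lambda>x. res a e x * g x) q"
    unfolding q_def by (rule primitive_on_mult[OF b g(2)])
  have "negligible ({x \<in> {0<..<len e}. weak_deriv (len e) (\<lambda>y. res a e y * weak_deriv (len e) (res u e) y) x \<noteq> q x}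
    \<union> {x \<in> {0<..<len e}. \<not> L_op G len a \<kappa> u e x = \<mu> * res u e x}
    \<union> {x \<in> {0<..<len e}. (res \<kappa> e x)\<^sup>2 \<noteq> k e x} \<union> {0, len e})"
    using weak_deriv_flux[OF g(1) p] eig k_eq[OF e] by (intro negligible_Un) (auto simp: AE_lebesgue_on_negligible)
  then have "primitive_on 0 (len e) (\<lambda>x. res a e x * g x) (\<lambda>x. (k e x - \<mu>) * res u e x)"
    by (rule primitive_on_spike[OF p]) (auto simp: L_op_def algebra_simps)
  then show ?thesis by (rule that[OF g(1) primitive_on_continuous[OF g(2)]])
qed

text \<open>Integration by parts of the flux on each edge, with the boundary terms collected at the
  vertices. For eigenfunctions the vertex sum vanishes; conversely, a test function isolating one
  vertex extracts the Kirchhoff condition from it.\<close>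

lemma green_identity:
  assumes u: "(u, g) \<in> energy_space" and y: "y \<in> energy_space"
    and c: "\<And>e. e \<in> arcs G \<Longrightarrow> continuous_on {0..len e} (g e)"
    and flux: "\<And>e. e \<in> arcs G \<Longrightarrow>
      primitive_on 0 (len e) (\<lambda>x. res a e x * g e x) (\<lambda>x. (k e x - \<mu>) * res u e x)"
  shows "energy_form (u, g) y = \<mu> * L2_form (u, g) y
    + (\<Sum>v\<in>verts G. fst y (Vertex v) * (\<alpha> * u (Vertex v) - a (Vertex v) * outgoing_deriv_sum G len u v))"
proof -
  define P where "P e = a (Vertex (head G e)) * g e (len e)" for e
  define R where "R e = a (Vertex (tail G e)) * g e 0" for e
  have edge: "integral {0..len e} (\<lambda>t. res a e t * g e t * snd y e t + k e t * res u e t * res (fst y) e t)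
    = \<mu> * integral {0..len e} (\<lambda>t. res u e t * res (fst y) e t)
      + (P e * fst y (Vertex (head G e)) - R e * fst y (Vertex (tail G e)))" if e: "e \<in> arcs G" for e
  proof -
    have "integral {0..len e} (\<lambda>x. (k e x - \<mu>) * res u e x * res (fst y) e x + res a e x * g e x * snd y e x)
      = P e * fst y (Vertex (head G e)) - R e * fst y (Vertex (tail G e))"
      using integral_product_rule[OF flux[OF e] energy_spaceD(2)[OF y e]] len_pos[OF e]
      by (simp add: P_def R_def on_edge_ends(2)[OF e] on_edge_ends(1))
    moreover have "integral {0..len e} (\<lambda>x. \<mu> * (res u e x * res (fst y) e x) +
        ((k e x - \<mu>) * res u e x * res (fst y) e x + res a e x * g e x * snd y e x)) =
      integral {0..len e} (\<lambda>x. \<mu> * (res u e x * res (fst y) e x)) +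
      integral {0..len e} (\<lambda>x. (k e x - \<mu>) * res u e x * res (fst y) e x + res a e x * g e x * snd y e x)"
    proof (rule integral_add)
      have b: "bmeas 0 (len e) (res u e)" "bmeas 0 (len e) (g e)"
        using energy_spaceD(4)[OF u e] energy_spaceD(3)[OF u e] by auto
      have km: "bmeas 0 (len e) (\<lambda>x. k e x - \<mu>)" by (intro bmeas_diff bmeas_const k_bmeas[OF e])
      show "(\<lambda>x. \<mu> * (res u e x * res (fst y) e x)) integrable_on {0..len e}"
        by (intro bmeas_integrable bmeas_mult bmeas_const b energy_spaceD(4)[OF y e])
      show "(\<lambda>x. (k e x - \<mu>) * res u e x * res (fst y) e x + res a e x * g e x * snd y e x) integrable_on {0..len e}"
        by (intro bmeas_integrable bmeas_add bmeas_mult km b energy_spaceD(3,4)[OF y e] bmeas_continuous[OF a_continuous[OF e]])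
    qed
    moreover have "(\<lambda>x. \<mu> * (res u e x * res (fst y) e x) +
        ((k e x - \<mu>) * res u e x * res (fst y) e x + res a e x * g e x * snd y e x)) =
        (\<lambda>t. res a e t * g e t * snd y e t + k e t * res u e t * res (fst y) e t)"
      by (simp add: fun_eq_iff algebra_simps)
    ultimately show ?thesis by simp
  qed
  have "outgoing_deriv_sum G len u v = (\<Sum>e\<in>out_arcs G v. g e 0) - (\<Sum>e\<in>in_arcs G v. g e (len e))" for v
    using energy_spaceD(2)[OF u] c by (intro outgoing_deriv_sum_eq) auto
  then have out: "a (Vertex v) * outgoing_deriv_sum G len u v = (\<Sum>e\<in>out_arcs G v. R e) - (\<Sum>e\<in>in_arcs G v. P e)" for v
    by (simp add: right_diff_distrib sum_distrib_left P_def R_def out_arcs_def in_arcs_def)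
  have "energy_form (u, g) y = (\<Sum>e\<in>arcs G. \<mu> * integral {0..len e} (\<lambda>t. res u e t * res (fst y) e t)
      + (P e * fst y (Vertex (head G e)) - R e * fst y (Vertex (tail G e))))
      + \<alpha> * (\<Sum>v\<in>verts G. u (Vertex v) * fst y (Vertex v))"
    by (simp add: energy_form_def edge)
  also have "\<dots> = \<mu> * L2_form (u, g) y + (\<Sum>e\<in>arcs G. P e * fst y (Vertex (head G e)) - R e * fst y (Vertex (tail G e)))
      + \<alpha> * (\<Sum>v\<in>verts G. u (Vertex v) * fst y (Vertex v))"
    by (simp only: sum.distrib L2_form_def sum_distrib_left fst_conv)
  also have "\<dots> = \<mu> * L2_form (u, g) y + (\<Sum>v\<in>verts G. fst y (Vertex v) * ((\<Sum>e\<in>in_arcs G v. P e) - (\<Sum>e\<in>out_arcs G v. R e)))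
      + (\<Sum>v\<in>verts G. fst y (Vertex v) * (\<alpha> * u (Vertex v)))"
    using sum_boundary_terms[of P "\<lambda>v. fst y (Vertex v)" R] by (simp add: sum_distrib_left mult_ac)
  also have "\<dots> = \<mu> * L2_form (u, g) y
    + (\<Sum>v\<in>verts G. fst y (Vertex v) * (\<alpha> * u (Vertex v) - a (Vertex v) * outgoing_deriv_sum G len u v))"
    unfolding out by (simp add: sum.distrib[symmetric] algebra_simps)
  finally show ?thesis .
qed

lemma eigenspace_lift:
  assumes u: "u \<in> eigenspace G len a \<kappa> \<alpha> \<mu>"
  obtains g where "(u, g) \<in> energy_space"
    "\<And>y. y \<in> energy_space \<Longrightarrow> energy_form (u, g) y = \<mu> * L2_form (u, g) y"
proof -
  have "\<forall>e\<in>arcs G. \<exists>g. primitive_on 0 (len e) (res u e) g \<and> continuous_on {0..len e} g \<and>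
    primitive_on 0 (len e) (\<lambda>x. res a e x * g x) (\<lambda>x. (k e x - \<mu>) * res u e x)"
    using eigenfunction_edge[OF u] by metis
  from bchoice[OF this] obtain g where g: "\<forall>e\<in>arcs G. primitive_on 0 (len e) (res u e) (g e) \<and>
    continuous_on {0..len e} (g e) \<and>
    primitive_on 0 (len e) (\<lambda>x. res a e x * g e x) (\<lambda>x. (k e x - \<mu>) * res u e x)" ..
  then have g: "primitive_on 0 (len e) (res u e) (g e)" "continuous_on {0..len e} (g e)"
    "primitive_on 0 (len e) (\<lambda>x. res a e x * g e x) (\<lambda>x. (k e x - \<mu>) * res u e x)" if "e \<in> arcs G" for e
    using that by simp_all
  have uL: "\<And>p. p \<notin> gpoints G len \<Longrightarrow> u p = 0"
    "\<And>v. v \<in> verts G \<Longrightarrow> a (Vertex v) * outgoing_deriv_sum G len u v = \<alpha> * u (Vertex v)"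
    using u unfolding eigenspace_def L_domain_def by simp_all
  have V: "(u, g) \<in> energy_space" by (rule energy_spaceI[OF uL(1) g(1) bmeas_continuous[OF g(2)]])
  show ?thesis
    by (rule that[OF V]) (use green_identity[OF V _ g(2,3)] uL(2) in simp)
qed

text \<open>The derivative is the product of the flux and \<open>1 / a\<close>, both absolutely
  continuous with bounded density, which gives edgewise \<open>H2\<close> regularity. The bounded
  derivative makes \<open>u\<close> Lipschitz along edges and hence continuous on the graph.\<close>

lemma eigenspaceI:
  assumes u: "(u, g) \<in> energy_space"
    and c: "\<And>e. e \<in> arcs G \<Longrightarrow> continuous_on {0..len e} (g e)"
    and flux: "\<And>e. e \<in> arcs G \<Longrightarrow>
      primitive_on 0 (len e) (\<lambda>x. res a e x * g e x) (\<lambda>x. (k e x - \<mu>) * res u e x)"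
    and kirchhoff: "\<And>v. v \<in> verts G \<Longrightarrow> a (Vertex v) * outgoing_deriv_sum G len u v = \<alpha> * u (Vertex v)"
  shows "u \<in> eigenspace G len a \<kappa> \<alpha> \<mu>"
proof -
  have up: "primitive_on 0 (len e) (res u e) (g e)" and ub: "bmeas 0 (len e) (res u e)"
    and gb: "bmeas 0 (len e) (g e)" if "e \<in> arcs G" for e
    using energy_spaceD(2,3,4)[OF u that] by auto
  have H2: "H2_interval (len e) (res u e)" if e: "e \<in> arcs G" for e
  proof -
    obtain c where c: "primitive_on 0 (len e) (\<lambda>x. 1 / res a e x) c" "bmeas 0 (len e) c"
      using inverse_a_primitive[OF e] .
    have "primitive_on 0 (len e) (\<lambda>x. res a e x * g e x * (1 / res a e x))
      (\<lambda>x. (k e x - \<mu>) * res u e x * (1 / res a e x) + res a e x * g e x * c x)"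
      by (rule primitive_on_mult[OF flux[OF e] c(1)])
    then have "primitive_on 0 (len e) (g e)
      (\<lambda>x. (k e x - \<mu>) * res u e x * (1 / res a e x) + res a e x * g e x * c x)"
    proof (rule primitive_on_cong)
      show "g e x = res a e x * g e x * (1 / res a e x)" if "x \<in> {0..len e}" for x
        using a_edge_ge[OF e that] a\<^sub>0_pos by simp
    qed simp
    then show ?thesis
    proof (rule H2_intervalI[OF up[OF e]])
      have km: "bmeas 0 (len e) (\<lambda>x. k e x - \<mu>)" by (intro bmeas_diff bmeas_const k_bmeas[OF e])
      show "bmeas 0 (len e) (\<lambda>x. (k e x - \<mu>) * res u e x * (1 / res a e x) + res a e x * g e x * c x)"
        by (intro bmeas_add bmeas_mult km ub[OF e] gb[OF e] c(2) bmeas_continuous[OF a_continuous[OF e]]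
            bmeas_continuous[OF primitive_on_continuous[OF c(1)]])
    qed
  qed
  have "\<exists>K\<ge>0. \<forall>t\<in>{0..len e}. \<bar>g e t\<bar> \<le> K" if "e \<in> arcs G" for e
    using bmeasE[OF gb[OF that]] by metis
  then obtain K where K: "\<And>e. e \<in> arcs G \<Longrightarrow> 0 \<le> K e" "\<And>e t. e \<in> arcs G \<Longrightarrow> t \<in> {0..len e} \<Longrightarrow> \<bar>g e t\<bar> \<le> K e"
    by metis
  define L where "L = (\<Sum>e\<in>arcs G. K e)"
  have KL: "K e \<le> L" if "e \<in> arcs G" for e unfolding L_def using that K(1) by (intro member_le_sum) auto
  have lip: "\<bar>res u e y - res u e x\<bar> \<le> L * (y - x)" if e: "e \<in> arcs G" and xy: "0 \<le> x" "x \<le> y" "y \<le> len e" for e x y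
  proof -
    have "norm (integral {x..y} (g e)) \<le> integral {x..y} (\<lambda>t. L)"
    proof (rule integral_norm_bound_integral)
      show "g e integrable_on {x..y}" by (rule bmeas_integrable[OF bmeas_subinterval[OF gb[OF e] xy(1,3)]])
      show "norm (g e t) \<le> L" if "t \<in> {x..y}" for t using K(2)[OF e, of t] KL[OF e] that xy by auto
    qed auto
    then show ?thesis using primitive_on_diff[OF up[OF e] xy] xy by (simp add: mult.commute)
  qed
  have cont: "graph_continuous G len u"
  proof (rule graph_continuous_of_edge_lipschitz)
    show "0 \<le> L" unfolding L_def using K(1) by (intro sum_nonneg) auto
    show "\<bar>res u e x - res u e y\<bar> \<le> L * \<bar>x - y\<bar>" if "e \<in> arcs G" "x \<in> {0..len e}" "y \<in> {0..len e}" for e x y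
      using lip[of e x y] lip[of e y x] that by (cases "x \<le> y") (auto simp: abs_minus_commute)
  qed
  have eig: "AE x in lebesgue_on {0<..<len e}. L_op G len a \<kappa> u e x = \<mu> * res u e x" if e: "e \<in> arcs G" for e
  proof -
    have "negligible ({x \<in> {0<..<len e}. weak_deriv (len e) (\<lambda>y. res a e y * weak_deriv (len e) (res u e) y) x \<noteq> (k e x - \<mu>) * res u e x}
      \<union> {x \<in> {0<..<len e}. (res \<kappa> e x)\<^sup>2 \<noteq> k e x})"
      by (intro negligible_Un weak_deriv_flux[OF up[OF e] flux[OF e]] k_eq[OF e])
    then have "negligible {x \<in> {0<..<len e}. \<not> L_op G len a \<kappa> u e x = \<mu> * res u e x}"
      by (rule negligible_subset) (auto simp: L_op_def algebra_simps)
    then show ?thesis by (simp add: AE_lebesgue_on_negligible)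
  qed
  show ?thesis
    using energy_spaceD(1)[OF u] H2 cont kirchhoff eig by (auto simp: eigenspace_def L_domain_def)
qed

text \<open>Extension by zero from one edge. The guard on \<open>t\<close> discards values
  \<open>Inner e t\<close> that are no points of the graph, where elements of
  \<open>energy_space\<close> must vanish.\<close>

definition edge_bump :: "'e \<Rightarrow> (real \<Rightarrow> real) \<Rightarrow> (real \<Rightarrow> real) \<Rightarrow> ('v, 'e) energy_pair" where
  "edge_bump e \<phi> \<phi>' =
    ((\<lambda>p. case p of Vertex v \<Rightarrow> 0 | Inner f t \<Rightarrow> if f = e \<and> 0 < t \<and> t < len e then \<phi> t else 0),
     (\<lambda>f t. if f = e then \<phi>' t else 0))"

lemma edge_bump:
  assumes e: "e \<in> arcs G" and \<phi>: "primitive_on 0 (len e) \<phi> \<phi>'" "bmeas 0 (len e) \<phi>'" "\<phi> 0 = 0" "\<phi> (len e) = 0"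
  shows "edge_bump e \<phi> \<phi>' \<in> energy_space"
    and "t \<in> {0..len e} \<Longrightarrow> res (fst (edge_bump e \<phi> \<phi>')) e t = \<phi> t"
    and "f \<noteq> e \<Longrightarrow> res (fst (edge_bump e \<phi> \<phi>')) f t = 0"
    and "fst (edge_bump e \<phi> \<phi>') (Vertex v) = 0"
    and "snd (edge_bump e \<phi> \<phi>') e t = \<phi>' t" "f \<noteq> e \<Longrightarrow> snd (edge_bump e \<phi> \<phi>') f t = 0"
proof -
  show on: "res (fst (edge_bump e \<phi> \<phi>')) e t = \<phi> t" if "t \<in> {0..len e}" for t
    using that \<phi>(3,4) by (auto simp: edge_bump_def on_edge_def edge_pt_def)
  show off: "res (fst (edge_bump e \<phi> \<phi>')) f t = 0" if "f \<noteq> e" for f t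
    using that by (auto simp: edge_bump_def on_edge_def edge_pt_def)
  show "fst (edge_bump e \<phi> \<phi>') (Vertex v) = 0" by (simp add: edge_bump_def)
  show son: "snd (edge_bump e \<phi> \<phi>') e t = \<phi>' t" for t by (simp add: edge_bump_def)
  show soff: "snd (edge_bump e \<phi> \<phi>') f t = 0" if "f \<noteq> e" for f t using that by (simp add: edge_bump_def)
  have "(fst (edge_bump e \<phi> \<phi>'), snd (edge_bump e \<phi> \<phi>')) \<in> energy_space"
  proof (rule energy_spaceI)
    show "fst (edge_bump e \<phi> \<phi>') p = 0" if "p \<notin> gpoints G len" for p
      using that e by (cases p) (auto simp: edge_bump_def gpoints_def)
    fix f assume "f \<in> arcs G"
    show "primitive_on 0 (len f) (res (fst (edge_bump e \<phi> \<phi>')) f) (snd (edge_bump e \<phi> \<phi>') f)"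
    proof (cases "f = e")
      case True
      then show ?thesis using primitive_on_cong[OF \<phi>(1) on son] by simp
    next
      case False
      show ?thesis by (rule primitive_on_cong[OF primitive_on_const[of 0 "len f" 0]]) (simp_all add: off soff False)
    qed
    have "snd (edge_bump e \<phi> \<phi>') f = (if f = e then \<phi>' else (\<lambda>t. 0))" by (auto simp: fun_eq_iff son soff)
    then show "bmeas 0 (len f) (snd (edge_bump e \<phi> \<phi>') f)"
      using \<phi>(2) bmeas_const[of 0 "len f" 0] by simp
  qed
  then show "edge_bump e \<phi> \<phi>' \<in> energy_space" by simp
qed

lemma edge_bump_forms:
  assumes e: "e \<in> arcs G" and \<phi>: "primitive_on 0 (len e) \<phi> \<phi>'" "bmeas 0 (len e) \<phi>'" "\<phi> 0 = 0" "\<phi> (len e) = 0"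
  shows "L2_form x (edge_bump e \<phi> \<phi>') = integral {0..len e} (\<lambda>t. res (fst x) e t * \<phi> t)"
    and "deriv_form x (edge_bump e \<phi> \<phi>') = integral {0..len e} (\<lambda>t. snd x e t * \<phi>' t)"
    and "energy_form x (edge_bump e \<phi> \<phi>') = integral {0..len e} (\<lambda>t. res a e t * snd x e t * \<phi>' t + k e t * res (fst x) e t * \<phi> t)"
proof -
  note b = edge_bump[OF assms]
  have single: "(\<Sum>f\<in>arcs G. F f) = F e" if "\<And>f. f \<noteq> e \<Longrightarrow> F f = 0" for F :: "'e \<Rightarrow> real"
    using that e by (subst sum.remove[of _ e]) (auto intro: sum.neutral)
  have "L2_form x (edge_bump e \<phi> \<phi>') = integral {0..len e} (\<lambda>t. res (fst x) e t * res (fst (edge_bump e \<phi> \<phi>')) e t)"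
    unfolding L2_form_def by (rule single) (simp add: b(3))
  also have "\<dots> = integral {0..len e} (\<lambda>t. res (fst x) e t * \<phi> t)"
    by (rule integral_cong) (simp add: b(2))
  finally show "L2_form x (edge_bump e \<phi> \<phi>') = integral {0..len e} (\<lambda>t. res (fst x) e t * \<phi> t)" .
  have "deriv_form x (edge_bump e \<phi> \<phi>') = integral {0..len e} (\<lambda>t. snd x e t * snd (edge_bump e \<phi> \<phi>') e t)"
    unfolding deriv_form_def by (rule single) (simp add: b(6))
  then show "deriv_form x (edge_bump e \<phi> \<phi>') = integral {0..len e} (\<lambda>t. snd x e t * \<phi>' t)" by (simp add: b(5))
  have "energy_form x (edge_bump e \<phi> \<phi>') = integral {0..len e} (\<lambda>t. energy_density x (edge_bump e \<phi> \<phi>') e t)"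
    unfolding energy_form_def b(4) by (subst single) (simp_all add: b(3,6))
  also have "\<dots> = integral {0..len e} (\<lambda>t. res a e t * snd x e t * \<phi>' t + k e t * res (fst x) e t * \<phi> t)"
    by (rule integral_cong) (simp add: b(2,5))
  finally show "energy_form x (edge_bump e \<phi> \<phi>') =
    integral {0..len e} (\<lambda>t. res a e t * snd x e t * \<phi>' t + k e t * res (fst x) e t * \<phi> t)" .
qed

end

section \<open>Limits of minimising sequences\<close>

text \<open>Successive extraction over a finite index set; \<open>P\<close> must pass to
  subsequences so that earlier choices survive later ones.\<close>

lemma common_subsequence:
  fixes P :: "'i \<Rightarrow> (nat \<Rightarrow> nat) \<Rightarrow> bool"
  assumes "finite A"
    and sub: "\<And>i r s. P i r \<Longrightarrow> strict_mono s \<Longrightarrow> P i (r \<circ> s)"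
    and ex: "\<And>i (r :: nat \<Rightarrow> nat). i \<in> A \<Longrightarrow> strict_mono r \<Longrightarrow> \<exists>s. strict_mono s \<and> P i (r \<circ> s)"
  shows "\<exists>r. strict_mono r \<and> (\<forall>i\<in>A. P i r)"
  using assms(1,3)
proof (induction A rule: finite_induct)
  case empty
  have "strict_mono (\<lambda>n::nat. n)" by (simp add: strict_mono_def)
  then show ?case by blast
next
  case (insert i A)
  have "\<exists>r. strict_mono r \<and> (\<forall>i\<in>A. P i r)" by (rule insert.IH) (rule insert.prems; simp)
  then obtain r where r: "strict_mono r" "\<forall>i\<in>A. P i r" by blast
  obtain s where s: "strict_mono s" "P i (r \<circ> s)" using insert.prems[OF insertI1 r(1)] by blast
  show ?case
  proof (intro exI conjI ballI)
    show "strict_mono (r \<circ> s)" by (rule strict_mono_o[OF r(1) s(1)])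
    show "P j (r \<circ> s)" if "j \<in> insert i A" for j
    proof (cases "j = i")
      case False
      then have "P j r" using r(2) that by simp
      then show ?thesis using s(1) by (rule sub)
    qed (simp add: s(2))
  qed
qed

lemma integral_mult_tendsto:
  fixes f :: "nat \<Rightarrow> real \<Rightarrow> real"
  assumes w: "bmeas A B w" and f: "\<And>n. bmeas A B (f n)" "\<And>n t. t \<in> {A..B} \<Longrightarrow> \<bar>f n t\<bar> \<le> C"
    and lim: "\<And>t. t \<in> {A..B} \<Longrightarrow> (\<lambda>n. f n t) \<longlonglongrightarrow> g t"
  shows "(\<lambda>n. integral {A..B} (\<lambda>t. w t * f n t)) \<longlonglongrightarrow> integral {A..B} (\<lambda>t. w t * g t)"
proof -
  obtain W where W: "0 \<le> W" "\<And>t. t \<in> {A..B} \<Longrightarrow> \<bar>w t\<bar> \<le> W" using bmeasE[OF w] by metis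
  show ?thesis
  proof (rule dominated_convergence(2)[where h="\<lambda>_. W * C"])
    show "(\<lambda>t. w t * f n t) integrable_on {A..B}" for n by (rule bmeas_integrable[OF bmeas_mult[OF w f(1)]])
    show "norm (w t * f n t) \<le> W * C" if "t \<in> {A..B}" for n t
      using W(2)[OF that] f(2)[OF that] by (auto simp: abs_mult intro!: mult_mono W(1))
    show "(\<lambda>n. w t * f n t) \<longlonglongrightarrow> w t * g t" if "t \<in> {A..B}" for t
      by (intro tendsto_intros lim that)
  qed auto
qed

lemma bmeas_cutoff: "bmeas A B (\<lambda>t. if t \<le> x then 1 else 0)"
proof (rule bmeasI[where K=1])
  have "(\<lambda>t. if t \<le> x then 1 else (0::real)) \<in> borel_measurable borel" by measurable
  then show "(\<lambda>t. if t \<le> x then 1 else (0::real)) \<in> borel_measurable (lebesgue_on {A..B})"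
    by (intro measurable_restrict_space1 measurable_completion) simp
qed auto

lemma integral_cutoff:
  fixes f :: "real \<Rightarrow> real"
  shows "integral {A..y} (\<lambda>t. (if t \<le> x then 1 else 0) * f t) = integral {A..min y x} f"
proof -
  have "integral {A..y} (\<lambda>t. (if t \<le> x then 1 else 0) * f t) = integral {A..y} (\<lambda>t. if t \<in> {..x} then f t else 0)"
    by (rule integral_cong) auto
  also have "\<dots> = integral ({A..y} \<inter> {..x}) f" by (subst integral_restrict_Int) (simp add: Int_commute)
  also have "{A..y} \<inter> {..x} = {A..min y x}" by auto
  finally show ?thesis .
qed

context quantum_graph
begin

lemma edge_increment_le:
  assumes x: "x \<in> energy_space" and e: "e \<in> arcs G" and st: "s \<in> {0..len e}" "t \<in> {0..len e}"
  shows "(res (fst x) e t - res (fst x) e s)\<^sup>2 \<le> \<bar>t - s\<bar> * deriv_form x x"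
proof -
  have le: "edge_deriv x e \<le> deriv_form x x"
    unfolding deriv_form_diag using edge_deriv_nonneg[OF x] e by (intro member_le_sum) auto
  note inc = primitive_increment_square_le[OF energy_spaceD(2,3)[OF x e]]
  have "(res (fst x) e t - res (fst x) e s)\<^sup>2 \<le> \<bar>t - s\<bar> * edge_deriv x e"
    using inc[of s t] inc[of t s] st by (cases "s \<le> t") (auto simp: power2_commute)
  also have "\<dots> \<le> \<bar>t - s\<bar> * deriv_form x x" by (intro mult_left_mono le) auto
  finally show ?thesis .
qed

lemma edge_value_le:
  assumes x: "x \<in> energy_space" and e: "e \<in> arcs G" and t: "t \<in> {0..len e}"
  shows "(res (fst x) e t)\<^sup>2 \<le> 4 / len e * L2_form x x + 4 * len e * deriv_form x x"
proof -
  have D: "edge_deriv x e \<le> deriv_form x x" "edge_L2 x e \<le> L2_form x x"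
    unfolding deriv_form_diag L2_form_diag
    using edge_deriv_nonneg[OF x] edge_L2_nonneg[OF x] e by (auto intro!: member_le_sum)
  have D0: "0 \<le> deriv_form x x" unfolding deriv_form_diag using edge_deriv_nonneg[OF x] by (intro sum_nonneg)
  have l: "0 < len e" by (rule len_pos[OF e])
  have "(res (fst x) e 0)\<^sup>2 \<le> 2 / len e * edge_L2 x e + len e * edge_deriv x e"
    using trace_inequality[OF energy_spaceD(2,3)[OF x e], of 0 "len e" 0] l by simp
  also have "\<dots> \<le> 2 / len e * L2_form x x + len e * deriv_form x x"
    using D l by (intro add_mono mult_left_mono) auto
  finally have a: "(res (fst x) e 0)\<^sup>2 \<le> 2 / len e * L2_form x x + len e * deriv_form x x" .
  have "(res (fst x) e t - res (fst x) e 0)\<^sup>2 \<le> \<bar>t - 0\<bar> * deriv_form x x"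
    using edge_increment_le[OF x e, of 0 t] t by auto
  also have "\<dots> \<le> len e * deriv_form x x" using t D0 by (intro mult_right_mono) auto
  finally have b: "(res (fst x) e t - res (fst x) e 0)\<^sup>2 \<le> len e * deriv_form x x" .
  have "(res (fst x) e t)\<^sup>2 \<le> 2 * (res (fst x) e 0)\<^sup>2 + 2 * (res (fst x) e t - res (fst x) e 0)\<^sup>2"
    using zero_le_power2[of "2 * res (fst x) e 0 - res (fst x) e t"] by (simp add: power2_eq_square algebra_simps)
  also have "\<dots> \<le> 2 * (2 / len e * L2_form x x + len e * deriv_form x x) + 2 * (len e * deriv_form x x)"
    by (intro add_mono mult_left_mono a b) auto
  also have "\<dots> = 4 / len e * L2_form x x + 4 * len e * deriv_form x x" by (simp add: algebra_simps)
  finally show ?thesis .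
qed

text \<open>Equicontinuity comes from the Hoelder bound \<open>edge_increment_le\<close>,
  boundedness from \<open>edge_value_le\<close>. The limit is merely continuous here; its
  differentiability is recovered later from the equation.\<close>

lemma edge_compactness:
  fixes X :: "nat \<Rightarrow> ('v, 'e) energy_pair"
  assumes X: "\<And>n. X n \<in> energy_space" "\<And>n. L2_form (X n) (X n) = 1" "\<And>n. deriv_form (X n) (X n) \<le> D"
    and e: "e \<in> arcs G"
  shows "\<exists>s f. strict_mono s \<and> continuous_on {0..len e} f \<and>
    (\<forall>t\<in>{0..len e}. (\<lambda>n. res (fst (X (s n))) e t) \<longlonglongrightarrow> f t)"
proof -
  have l: "0 < len e" by (rule len_pos[OF e])
  have D0: "0 \<le> D"
  proof -
    have "0 \<le> deriv_form (X 0) (X 0)" unfolding deriv_form_diag using edge_deriv_nonneg[OF X(1)] by (intro sum_nonneg)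
    then show ?thesis using X(3)[of 0] by simp
  qed
  have bound: "norm (res (fst (X n)) e t) \<le> sqrt (4 / len e + 4 * len e * D)" if "t \<in> {0..len e}" for n t
  proof -
    have "(res (fst (X n)) e t)\<^sup>2 \<le> 4 / len e * L2_form (X n) (X n) + 4 * len e * deriv_form (X n) (X n)"
      by (rule edge_value_le[OF X(1) e that])
    also have "\<dots> \<le> 4 / len e + 4 * len e * D" using X(2,3) l by simp
    finally have "sqrt ((res (fst (X n)) e t)\<^sup>2) \<le> sqrt (4 / len e + 4 * len e * D)" by (rule real_sqrt_le_mono)
    then show ?thesis by simp
  qed
  have equi: "\<exists>d>0. \<forall>n y. y \<in> {0..len e} \<and> norm (t - y) < d \<longrightarrow> norm (res (fst (X n)) e t - res (fst (X n)) e y) < \<epsilon>"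
    if t: "t \<in> {0..len e}" "0 < \<epsilon>" for t \<epsilon>
  proof (intro exI[of _ "\<epsilon>\<^sup>2 / (D + 1)"] conjI allI impI)
    show "0 < \<epsilon>\<^sup>2 / (D + 1)" using D0 t(2) by simp
    fix n y assume y: "y \<in> {0..len e} \<and> norm (t - y) < \<epsilon>\<^sup>2 / (D + 1)"
    have "(res (fst (X n)) e t - res (fst (X n)) e y)\<^sup>2 \<le> \<bar>t - y\<bar> * deriv_form (X n) (X n)"
      using y t by (intro edge_increment_le X(1) e) auto
    also have "\<dots> \<le> \<bar>t - y\<bar> * (D + 1)" using X(3)[of n] by (intro mult_left_mono) auto
    also have "\<dots> < \<epsilon>\<^sup>2" using y D0 by (simp add: pos_less_divide_eq)
    finally have "\<bar>res (fst (X n)) e t - res (fst (X n)) e y\<bar>\<^sup>2 < \<epsilon>\<^sup>2" by simp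
    then show "norm (res (fst (X n)) e t - res (fst (X n)) e y) < \<epsilon>"
      using t(2) by (simp add: power2_less_imp_less)
  qed
  obtain f s where f: "continuous_on {0..len e} f" "strict_mono (s :: nat \<Rightarrow> nat)"
    "\<And>\<epsilon>. 0 < \<epsilon> \<Longrightarrow> \<exists>N. \<forall>n x. n \<ge> N \<and> x \<in> {0..len e} \<longrightarrow> norm (res (fst (X (s n))) e x - f x) < \<epsilon>"
    by (rule Arzela_Ascoli[of "{0..len e}" "\<lambda>n. res (fst (X n)) e" "sqrt (4 / len e + 4 * len e * D)"])
      (use bound equi in auto)
  have "(\<lambda>n. res (fst (X (s n))) e t) \<longlonglongrightarrow> f t" if "t \<in> {0..len e}" for t
    unfolding LIMSEQ_iff using f(3) that by meson
  then show ?thesis using f(1,2) by blast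
qed

text \<open>The solution of \<open>a * y' = 1\<close> with \<open>y = 0\<close> at the tail. Affine
  functions of \<open>travel e\<close> have constant flux, so they replace the linear functions of
  the case of constant \<open>a\<close>.\<close>

definition travel :: "'e \<Rightarrow> real \<Rightarrow> real" where
  "travel e t = integral {0..t} (\<lambda>x. 1 / res a e x)"

lemma travel:
  assumes e: "e \<in> arcs G"
  shows "continuous_on {0..len e} (\<lambda>x. 1 / res a e x)" "primitive_on 0 (len e) (travel e) (\<lambda>x. 1 / res a e x)"
    and "travel e 0 = 0" "0 < travel e (len e)"
proof -
  have pos: "0 < res a e x" if "x \<in> {0..len e}" for x using a_edge_ge[OF e that] a\<^sub>0_pos by simp
  show c: "continuous_on {0..len e} (\<lambda>x. 1 / res a e x)"
    using pos by (intro continuous_intros a_continuous[OF e]) force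
  show "primitive_on 0 (len e) (travel e) (\<lambda>x. 1 / res a e x)"
    unfolding travel_def
    using primitive_on_integral[OF absolutely_integrable_continuous_real[OF c], of 0] by simp
  show "travel e 0 = 0" by (simp add: travel_def)
  obtain B where B: "0 \<le> B" "\<And>x. x \<in> {0..len e} \<Longrightarrow> \<bar>res a e x\<bar> \<le> B"
    using bmeasE[OF bmeas_continuous[OF a_continuous[OF e]]] by metis
  have "0 < integral {0..len e} (\<lambda>x. 1 / (B + 1))" using B(1) len_pos[OF e] by simp
  also have "\<dots> \<le> travel e (len e)"
    unfolding travel_def
  proof (rule integral_le)
    show "(\<lambda>x. 1 / res a e x) integrable_on {0..len e}" by (rule integrable_continuous_real[OF c])
    show "1 / (B + 1) \<le> 1 / res a e x" if "x \<in> {0..len e}" for x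
      using pos[OF that] B(2)[OF that] by (intro frac_le) auto
  qed auto
  finally show "0 < travel e (len e)" .
qed

text \<open>The test functions \<open>travel e (min t x) - \<beta> * travel e t\<close> satisfy \<open>a \<phi>' = 1 - \<beta>\<close> to the left of \<open>x\<close>
  and \<open>a \<phi>' = - \<beta>\<close> to the right of it, so that the leading term of the form depends on the values of
  the function at \<open>0\<close>, \<open>x\<close> and \<open>len e\<close> only and passes to the pointwise limit.\<close>
lemma limit_edge_equation:
  assumes X: "\<And>n. X n \<in> energy_space" and e: "e \<in> arcs G"
    and bound: "\<And>n t. t \<in> {0..len e} \<Longrightarrow> \<bar>res (fst (X n)) e t\<bar> \<le> C"
    and lim: "\<And>t. t \<in> {0..len e} \<Longrightarrow> (\<lambda>n. res (fst (X n)) e t) \<longlonglongrightarrow> f t"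
    and f: "continuous_on {0..len e} f"
    and weak: "\<And>y. y \<in> energy_space \<Longrightarrow> (\<lambda>n. energy_form (X n) y - l * L2_form (X n) y) \<longlonglongrightarrow> 0"
  obtains g where "primitive_on 0 (len e) f g" "continuous_on {0..len e} g"
    "primitive_on 0 (len e) (\<lambda>x. res a e x * g x) (\<lambda>x. (k e x - l) * f x)"
proof -
  define L where "L = len e"
  have L: "0 < L" using len_pos[OF e] by (simp add: L_def)
  define ia where "ia x = 1 / res a e x" for x
  have ia: "continuous_on {0..L} ia" "primitive_on 0 L (travel e) ia" "0 < travel e L"
    using travel[OF e] by (simp_all add: L_def ia_def[abs_def])
  have a_ia: "res a e t * ia t = 1" if "t \<in> {0..L}" for t
    using a_edge_ge[OF e, of t] a\<^sub>0_pos that by (simp add: ia_def L_def)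
  have km: "bmeas 0 L (\<lambda>t. k e t - l)"
    unfolding L_def by (intro bmeas_diff bmeas_const k_bmeas[OF e])
  have fb: "bmeas 0 L f" using f bmeas_continuous by (simp add: L_def)
  have kf: "bmeas 0 L (\<lambda>t. (k e t - l) * f t)" by (rule bmeas_mult[OF km fb])
  \<comment> \<open>The density prescribed by the equation makes \<open>F\<close> the flux up to an
    additive constant.\<close>
  define F where "F t = integral {0..t} (\<lambda>t. (k e t - l) * f t)" for t
  have pF: "primitive_on 0 L F (\<lambda>t. (k e t - l) * f t)"
    unfolding F_def using primitive_on_integral[OF bmeas_ai[OF kf], of 0] by simp
  have cF: "continuous_on {0..L} F" by (rule primitive_on_continuous[OF pF])
  define J where "J t = integral {0..t} (\<lambda>t. F t * ia t)" for t
  have Fia: "continuous_on {0..L} (\<lambda>t. F t * ia t)" by (intro continuous_intros cF ia(1))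
  have pJ: "primitive_on 0 L J (\<lambda>t. F t * ia t)"
    unfolding J_def using primitive_on_integral[OF absolutely_integrable_continuous_real[OF Fia], of 0] by simp
  \<comment> \<open>The flux will be \<open>F + B\<close>, with \<open>B\<close> fixed by the value
    of \<open>f\<close> at \<open>L\<close>; \<open>key\<close> is the equation
    \<open>f' = (F + B) / a\<close> in integrated form.\<close>
  define B where "B = (f L - f 0 - J L) / travel e L"
  have key: "f x = f 0 + (J x + B * travel e x)" if x: "x \<in> {0..L}" for x
  proof -
    \<comment> \<open>This factor makes \<open>\<phi>\<close> vanish at \<open>L\<close>.\<close>
    define \<beta> where "\<beta> = travel e x / travel e L"
    define c where "c t = (if t \<le> x then 1 else 0) - \<beta>" for t
    define \<phi> where "\<phi> t = travel e (min t x) - \<beta> * travel e t" for t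
    define \<phi>' where "\<phi>' t = c t * ia t" for t
    have cb: "bmeas 0 L c" unfolding c_def by (intro bmeas_diff bmeas_cutoff bmeas_const)
    have \<phi>'b: "bmeas 0 L \<phi>'" unfolding \<phi>'_def by (intro bmeas_mult cb bmeas_continuous ia(1))
    have "primitive_on 0 L (\<lambda>t. travel e (min t x)) (\<lambda>t. (if t \<le> x then 1 else 0) * ia t)"
      unfolding primitive_on_def
    proof (intro conjI ballI)
      show "(\<lambda>t. (if t \<le> x then 1 else 0) * ia t) absolutely_integrable_on {0..L}"
        by (intro bmeas_ai bmeas_mult bmeas_cutoff bmeas_continuous ia(1))
      show "integral {0..t} (\<lambda>t. (if t \<le> x then 1 else 0) * ia t) = travel e (min t x) - travel e (min 0 x)" for t
        unfolding integral_cutoff using x by (simp add: travel_def ia_def[abs_def] min_def)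
    qed
    from primitive_on_add[OF this primitive_on_cmult[OF ia(2), of "- \<beta>"]]
    have \<phi>p: "primitive_on 0 L \<phi> \<phi>'"
      by (rule primitive_on_cong) (auto simp: \<phi>_def \<phi>'_def c_def left_diff_distrib)
    have \<phi>0: "\<phi> 0 = 0" "\<phi> L = 0"
      using x L ia(3) travel(3)[OF e] by (auto simp: \<phi>_def \<beta>_def min_def)
    have \<phi>b: "bmeas 0 L \<phi>" by (rule bmeas_continuous[OF primitive_on_continuous[OF \<phi>p]])
    have bump: "edge_bump e \<phi> \<phi>' \<in> energy_space"
      using edge_bump(1)[OF e, of \<phi> \<phi>'] \<phi>p \<phi>'b \<phi>0 by (simp add: L_def)
    have split: "integral {0..L} (\<lambda>t. h t * c t) = integral {0..x} h - \<beta> * integral {0..L} h" if h: "bmeas 0 L h" for h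
    proof -
      have "integral {0..L} (\<lambda>t. h t * c t) = integral {0..L} (\<lambda>t. (if t \<le> x then 1 else 0) * h t - \<beta> * h t)"
        by (rule integral_cong) (simp add: c_def algebra_simps)
      also have "\<dots> = integral {0..L} (\<lambda>t. (if t \<le> x then 1 else 0) * h t) - integral {0..L} (\<lambda>t. \<beta> * h t)"
        by (intro integral_diff bmeas_integrable bmeas_mult bmeas_cutoff bmeas_const h)
      moreover have "min L x = x" using x by simp
      ultimately show ?thesis by (simp add: integral_cutoff)
    qed
    define U where "U n t = res (fst (X n)) e t" for n t
    have Ub: "bmeas 0 L (U n)" for n using energy_spaceD(4)[OF X e] by (simp add: U_def[abs_def] L_def)
    have gb: "bmeas 0 L (snd (X n) e)" for n using energy_spaceD(3)[OF X e] by (simp add: L_def)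
    have Up: "primitive_on 0 L (U n) (snd (X n) e)" for n
      using energy_spaceD(2)[OF X e] by (simp add: U_def[abs_def] L_def)
    \<comment> \<open>As \<open>a * \<phi>'\<close> equals the step function \<open>c\<close>, the
      derivative of \<open>U n\<close> is integrated against constants and leaves only the values of
      \<open>U n\<close> at 0, \<open>x\<close> and \<open>L\<close>.\<close>
    have id: "energy_form (X n) (edge_bump e \<phi> \<phi>') - l * L2_form (X n) (edge_bump e \<phi> \<phi>') =
      (U n x - U n 0) - \<beta> * (U n L - U n 0) + integral {0..L} (\<lambda>t. ((k e t - l) * \<phi> t) * U n t)" for n
    proof -
      have "energy_form (X n) (edge_bump e \<phi> \<phi>') - l * L2_form (X n) (edge_bump e \<phi> \<phi>') =
        integral {0..L} (\<lambda>t. res a e t * snd (X n) e t * \<phi>' t + k e t * U n t * \<phi> t) - integral {0..L} (\<lambda>t. l * (U n t * \<phi> t))"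
        using edge_bump_forms[OF e, of \<phi> \<phi>' "X n"] \<phi>p \<phi>'b \<phi>0 by (simp add: L_def U_def)
      also have "\<dots> = integral {0..L} (\<lambda>t. (res a e t * snd (X n) e t * \<phi>' t + k e t * U n t * \<phi> t) - l * (U n t * \<phi> t))"
        by (intro integral_diff[symmetric] bmeas_integrable bmeas_add bmeas_mult bmeas_const gb Ub \<phi>b \<phi>'b)
          (simp_all add: L_def k_bmeas[OF e] bmeas_continuous[OF a_continuous[OF e]])
      also have "\<dots> = integral {0..L} (\<lambda>t. snd (X n) e t * c t + ((k e t - l) * \<phi> t) * U n t)"
      proof (rule integral_cong)
        fix t assume "t \<in> {0..L}"
        then have "res a e t * snd (X n) e t * \<phi>' t = snd (X n) e t * c t * (res a e t * ia t)"
          by (simp add: \<phi>'_def)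
        then have "res a e t * snd (X n) e t * \<phi>' t = snd (X n) e t * c t" using a_ia[OF \<open>t \<in> {0..L}\<close>] by simp
        then show "(res a e t * snd (X n) e t * \<phi>' t + k e t * U n t * \<phi> t) - l * (U n t * \<phi> t)
          = snd (X n) e t * c t + ((k e t - l) * \<phi> t) * U n t" by (simp add: algebra_simps)
      qed
      also have "\<dots> = integral {0..L} (\<lambda>t. snd (X n) e t * c t) + integral {0..L} (\<lambda>t. ((k e t - l) * \<phi> t) * U n t)"
        by (intro integral_add bmeas_integrable bmeas_mult gb cb km \<phi>b Ub)
      also have "integral {0..L} (\<lambda>t. snd (X n) e t * c t) = (U n x - U n 0) - \<beta> * (U n L - U n 0)"
        using split[OF gb] primitive_on_diff[OF Up, of 0 x] primitive_on_diff[OF Up, of 0 L] x L by simp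
      finally show ?thesis .
    qed
    have "(\<lambda>n. (U n x - U n 0) - \<beta> * (U n L - U n 0) + integral {0..L} (\<lambda>t. ((k e t - l) * \<phi> t) * U n t))
      \<longlonglongrightarrow> (f x - f 0) - \<beta> * (f L - f 0) + integral {0..L} (\<lambda>t. ((k e t - l) * \<phi> t) * f t)"
    proof (intro tendsto_intros)
      have lim': "(\<lambda>n. U n t) \<longlonglongrightarrow> f t" if "t \<in> {0..L}" for t using lim that by (simp add: U_def L_def)
      show "(\<lambda>n. U n x) \<longlonglongrightarrow> f x" "(\<lambda>n. U n 0) \<longlonglongrightarrow> f 0" "(\<lambda>n. U n 0) \<longlonglongrightarrow> f 0" "(\<lambda>n. U n L) \<longlonglongrightarrow> f L"
        using lim' x L by auto
      show "(\<lambda>n. integral {0..L} (\<lambda>t. ((k e t - l) * \<phi> t) * U n t)) \<longlonglongrightarrow> integral {0..L} (\<lambda>t. ((k e t - l) * \<phi> t) * f t)"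
        by (rule integral_mult_tendsto[where C=C, OF bmeas_mult[OF km \<phi>b] Ub])
          (use bound lim' in \<open>auto simp: U_def L_def\<close>)
    qed
    moreover have "(\<lambda>n. (U n x - U n 0) - \<beta> * (U n L - U n 0) + integral {0..L} (\<lambda>t. ((k e t - l) * \<phi> t) * U n t)) \<longlonglongrightarrow> 0"
      using weak[OF bump] by (simp add: id)
    ultimately have "(f x - f 0) - \<beta> * (f L - f 0) + integral {0..L} (\<lambda>t. ((k e t - l) * \<phi> t) * f t) = 0"
      by (rule LIMSEQ_unique)
    \<comment> \<open>The potential term is integrated by parts with \<open>F\<close>; the product
      \<open>F * \<phi>'\<close> is \<open>c\<close> times the density of \<open>J\<close>, so
      \<open>split\<close> applies again.\<close>
    moreover have "integral {0..L} (\<lambda>t. ((k e t - l) * \<phi> t) * f t) = - (J x - \<beta> * J L)"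
    proof -
      have i: "(\<lambda>t. (k e t - l) * f t * \<phi> t) integrable_on {0..L}" "(\<lambda>t. F t * \<phi>' t) integrable_on {0..L}"
        by (intro bmeas_integrable bmeas_mult kf km fb \<phi>b \<phi>'b bmeas_continuous[OF cF])+
      have "integral {0..L} (\<lambda>t. (k e t - l) * f t * \<phi> t + F t * \<phi>' t) = 0"
        using integral_product_rule[OF pF \<phi>p] L \<phi>0 by simp
      then have "integral {0..L} (\<lambda>t. (k e t - l) * f t * \<phi> t) = - integral {0..L} (\<lambda>t. F t * \<phi>' t)"
        using integral_add[OF i] by simp
      also have "integral {0..L} (\<lambda>t. F t * \<phi>' t) = integral {0..L} (\<lambda>t. (F t * ia t) * c t)"
        by (rule integral_cong) (simp add: \<phi>'_def)
      also have "\<dots> = J x - \<beta> * J L"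
        unfolding J_def by (rule split[OF bmeas_continuous[OF Fia]])
      finally show ?thesis by (simp add: mult.assoc mult.commute[of "\<phi> _"])
    qed
    ultimately have "f x = f 0 + (J x + \<beta> * (f L - f 0 - J L))" by (simp add: algebra_simps)
    then show ?thesis by (simp add: B_def \<beta>_def)
  qed
  define g where "g t = F t * ia t + B * ia t" for t
  have "primitive_on 0 L (\<lambda>t. f 0 + (J t + B * travel e t)) (\<lambda>t. 0 + (F t * ia t + B * ia t))"
    by (intro primitive_on_add primitive_on_const pJ primitive_on_cmult ia(2))
  then have pg: "primitive_on 0 L f g"
    by (rule primitive_on_cong) (rule key, assumption, simp add: g_def)
  have cg: "continuous_on {0..L} g" unfolding g_def by (intro continuous_intros cF ia(1))
  have "primitive_on 0 L (\<lambda>t. F t + B) (\<lambda>t. (k e t - l) * f t + 0)"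
    by (intro primitive_on_add primitive_on_const pF)
  then have "primitive_on 0 L (\<lambda>x. res a e x * g x) (\<lambda>x. (k e x - l) * f x)"
  proof (rule primitive_on_cong)
    fix t assume t: "t \<in> {0..L}"
    have "res a e t * g t = (F t + B) * (res a e t * ia t)" by (simp add: g_def algebra_simps)
    then show "res a e t * g t = F t + B" using a_ia[OF t] by simp
  qed simp
  then have flux: "primitive_on 0 (len e) (\<lambda>x. res a e x * g x) (\<lambda>x. (k e x - l) * f x)"
    by (simp only: L_def)
  show ?thesis by (rule that[OF pg[unfolded L_def] cg[unfolded L_def] flux])
qed

text \<open>The analogue of a piecewise linear hat function: affine in \<open>travel e\<close>
  instead of \<open>t\<close>, so that its flux is constant on each edge. On a loop at
  \<open>w\<close> it is constantly 1.\<close>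

definition vertex_hat :: "'v \<Rightarrow> ('v, 'e) energy_pair" where
  "vertex_hat w =
    ((\<lambda>p. case p of Vertex v \<Rightarrow> of_bool (v = w) | Inner e t \<Rightarrow> if e \<in> arcs G \<and> 0 < t \<and> t < len e
       then of_bool (tail G e = w) + (of_bool (head G e = w) - of_bool (tail G e = w)) / travel e (len e) * travel e t else 0),
     (\<lambda>e t. (of_bool (head G e = w) - of_bool (tail G e = w)) / travel e (len e) * (1 / res a e t)))"

lemma vertex_hat:
  assumes w: "w \<in> verts G"
  shows "vertex_hat w \<in> energy_space" and "fst (vertex_hat w) (Vertex v) = of_bool (v = w)"
    and "e \<in> arcs G \<Longrightarrow> t \<in> {0..len e} \<Longrightarrow>
      res a e t * snd (vertex_hat w) e t = (of_bool (head G e = w) - of_bool (tail G e = w)) / travel e (len e)"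
proof -
  define d where "d e = (of_bool (head G e = w) - of_bool (tail G e = w)) / travel e (len e)" for e
  have "(fst (vertex_hat w), snd (vertex_hat w)) \<in> energy_space"
  proof (rule energy_spaceI)
    show "fst (vertex_hat w) p = 0" if "p \<notin> gpoints G len" for p
      using that w by (cases p) (auto simp: vertex_hat_def gpoints_def)
    fix e assume e: "e \<in> arcs G"
    have s: "snd (vertex_hat w) e = (\<lambda>t. d e * (1 / res a e t))" by (simp add: vertex_hat_def d_def)
    show "bmeas 0 (len e) (snd (vertex_hat w) e)"
      unfolding s by (intro bmeas_mult bmeas_const bmeas_continuous travel(1) e)
    have "primitive_on 0 (len e) (\<lambda>t. of_bool (tail G e = w) + d e * travel e t) (\<lambda>t. 0 + d e * (1 / res a e t))"
      by (intro primitive_on_add primitive_on_const primitive_on_cmult travel(2) e)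
    then show "primitive_on 0 (len e) (res (fst (vertex_hat w)) e) (snd (vertex_hat w) e)"
    proof (rule primitive_on_cong)
      fix t assume t: "t \<in> {0..len e}"
      show "res (fst (vertex_hat w)) e t = of_bool (tail G e = w) + d e * travel e t"
        using t e travel(3,4)[OF e] by (auto simp: vertex_hat_def on_edge_def edge_pt_def d_def)
    qed (simp add: s)
  qed
  then show "vertex_hat w \<in> energy_space" by simp
  show "fst (vertex_hat w) (Vertex v) = of_bool (v = w)" by (simp add: vertex_hat_def)
  show "res a e t * snd (vertex_hat w) e t = (of_bool (head G e = w) - of_bool (tail G e = w)) / travel e (len e)"
    if "e \<in> arcs G" "t \<in> {0..len e}"
    using a_edge_ge[OF that] a\<^sub>0_pos by (simp add: vertex_hat_def)
qed

text \<open>With \<open>a * y'\<close> constant on each edge, the derivative of \<open>x\<close>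
  integrates to a difference of end values. The right hand side therefore passes to the limit under
  bounded pointwise convergence of \<open>x\<close>.\<close>

lemma energy_form_constant_flux:
  assumes x: "x \<in> energy_space" and y: "y \<in> energy_space"
    and c: "\<And>e t. e \<in> arcs G \<Longrightarrow> t \<in> {0..len e} \<Longrightarrow> res a e t * snd y e t = c e"
  shows "energy_form x y = (\<Sum>e\<in>arcs G. c e * (res (fst x) e (len e) - res (fst x) e 0)
      + integral {0..len e} (\<lambda>t. (k e t * res (fst y) e t) * res (fst x) e t))
    + \<alpha> * (\<Sum>v\<in>verts G. fst x (Vertex v) * fst y (Vertex v))"
proof -
  have "integral {0..len e} (\<lambda>t. energy_density x y e t) =
    c e * (res (fst x) e (len e) - res (fst x) e 0)
      + integral {0..len e} (\<lambda>t. (k e t * res (fst y) e t) * res (fst x) e t)" if e: "e \<in> arcs G" for e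
  proof -
    have "integral {0..len e} (\<lambda>t. energy_density x y e t) =
      integral {0..len e} (\<lambda>t. c e * snd x e t + (k e t * res (fst y) e t) * res (fst x) e t)"
    proof (rule integral_cong)
      fix t assume "t \<in> {0..len e}"
      from c[OF e this] show "energy_density x y e t =
        c e * snd x e t + (k e t * res (fst y) e t) * res (fst x) e t"
        by (simp add: mult_ac flip: c[OF e \<open>t \<in> {0..len e}\<close>])
    qed
    also have "\<dots> = integral {0..len e} (\<lambda>t. c e * snd x e t) + integral {0..len e} (\<lambda>t. (k e t * res (fst y) e t) * res (fst x) e t)"
      by (intro integral_add bmeas_integrable bmeas_mult bmeas_const energy_spaceD(3,4)[OF x e] energy_spaceD(3,4)[OF y e] k_bmeas e)
    also have "integral {0..len e} (\<lambda>t. c e * snd x e t) = c e * (res (fst x) e (len e) - res (fst x) e 0)"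
      using primitive_on_diff[OF energy_spaceD(2)[OF x e], of 0 "len e"] len_pos[OF e] by simp
    finally show ?thesis .
  qed
  then show ?thesis by (simp add: energy_form_def)
qed

text \<open>Bounds on form and norm bound the derivatives in \<open>L2\<close>, which gives
  compactness. Bumps then yield the edge equations, hats the Kirchhoff conditions, and dominated
  convergence preserves the norm 1, so that the limit is not zero.\<close>

lemma minimizing_limit:
  fixes X :: "nat \<Rightarrow> ('v, 'e) energy_pair"
  assumes X: "\<And>n. X n \<in> energy_space" "\<And>n. L2_form (X n) (X n) = 1" "\<And>n. energy_form (X n) (X n) \<le> C"
    and weak: "\<And>y. y \<in> energy_space \<Longrightarrow> (\<lambda>n. energy_form (X n) y - l * L2_form (X n) y) \<longlonglongrightarrow> 0"
  obtains u g where "(u, g) \<in> energy_space" "u \<in> eigenspace G len a \<kappa> \<alpha> l" "L2_form (u, g) (u, g) = 1"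
    "\<And>y. y \<in> energy_space \<Longrightarrow> (\<And>n. L2_form (X n) y = 0) \<Longrightarrow> L2_form (u, g) y = 0"
proof -
  obtain c where c: "0 \<le> c" "\<And>x. x \<in> energy_space \<Longrightarrow> a\<^sub>0 / 2 * deriv_form x x \<le> energy_form x x + c * L2_form x x"
    by (rule deriv_form_bounded) blast
  define D where "D = 2 / a\<^sub>0 * (C + c)"
  have D: "deriv_form (X n) (X n) \<le> D" for n
    using c(2)[OF X(1)[of n]] X(2,3)[of n] a\<^sub>0_pos by (simp add: D_def field_simps)
  define P where "P e r \<longleftrightarrow> (\<exists>f. continuous_on {0..len e} f \<and> (\<forall>t\<in>{0..len e}. (\<lambda>n. res (fst (X (r n))) e t) \<longlonglongrightarrow> f t))" for e and r :: "nat \<Rightarrow> nat"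
  have "\<exists>r. strict_mono r \<and> (\<forall>e\<in>arcs G. P e r)"
  proof (rule common_subsequence)
    show "P e (r \<circ> s)" if "P e r" "strict_mono s" for e r s
    proof -
      obtain f where f: "continuous_on {0..len e} f" "\<forall>t\<in>{0..len e}. (\<lambda>n. res (fst (X (r n))) e t) \<longlonglongrightarrow> f t"
        using \<open>P e r\<close> by (auto simp: P_def)
      have "(\<lambda>n. res (fst (X ((r \<circ> s) n))) e t) \<longlonglongrightarrow> f t" if "t \<in> {0..len e}" for t
        using LIMSEQ_subseq_LIMSEQ[OF f(2)[rule_format, OF that] \<open>strict_mono s\<close>] by (simp add: o_def)
      then show ?thesis using f(1) by (auto simp: P_def)
    qed
    show "\<exists>s. strict_mono s \<and> P e (r \<circ> s)" if "e \<in> arcs G" "strict_mono r" for e and r :: "nat \<Rightarrow> nat"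
      using edge_compactness[of "\<lambda>n. X (r n)" D e] X D that by (auto simp: P_def)
  qed simp
  then obtain r where r: "strict_mono r" "\<And>e. e \<in> arcs G \<Longrightarrow> P e r" by blast
  define Y where "Y n = X (r n)" for n
  have Y: "Y n \<in> energy_space" "L2_form (Y n) (Y n) = 1" "deriv_form (Y n) (Y n) \<le> D" for n
    using X D by (auto simp: Y_def)
  have weakY: "(\<lambda>n. energy_form (Y n) y - l * L2_form (Y n) y) \<longlonglongrightarrow> 0" if "y \<in> energy_space" for y
    using LIMSEQ_subseq_LIMSEQ[OF weak[OF that] r(1)] by (simp add: o_def Y_def)
  obtain f where f: "\<And>e. e \<in> arcs G \<Longrightarrow> continuous_on {0..len e} (f e)"
    "\<And>e t. e \<in> arcs G \<Longrightarrow> t \<in> {0..len e} \<Longrightarrow> (\<lambda>n. res (fst (Y n)) e t) \<longlonglongrightarrow> f e t"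
    using r(2) unfolding P_def Y_def by metis
  \<comment> \<open>The limit is taken at points of the graph, not edge by edge, so the edges agree
    at common vertices automatically.\<close>
  define u where "u p = (if p \<in> gpoints G len then Lim sequentially (\<lambda>n. fst (Y n) p) else 0)" for p
  have uf: "res u e t = f e t" if "e \<in> arcs G" "t \<in> {0..len e}" for e t
    using edge_pt_gpoints[OF that] tendsto_Lim[OF _ f(2)[OF that]] by (simp add: u_def on_edge_def)
  have lim: "(\<lambda>n. res (fst (Y n)) e t) \<longlonglongrightarrow> res u e t" if "e \<in> arcs G" "t \<in> {0..len e}" for e t
    using f(2)[OF that] uf[OF that] by simp
  have cu: "continuous_on {0..len e} (res u e)" if "e \<in> arcs G" for e
    by (rule continuous_on_eq[OF f(1)[OF that]]) (use uf[OF that] in simp)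
  define K where "K e = sqrt (4 / len e + 4 * len e * D)" for e
  have bound: "\<bar>res (fst (Y n)) e t\<bar> \<le> K e" if e: "e \<in> arcs G" "t \<in> {0..len e}" for n e t
  proof -
    have "(res (fst (Y n)) e t)\<^sup>2 \<le> 4 / len e * L2_form (Y n) (Y n) + 4 * len e * deriv_form (Y n) (Y n)"
      by (rule edge_value_le[OF Y(1) e])
    also have "\<dots> \<le> 4 / len e + 4 * len e * D" using Y(2,3) len_pos[OF e(1)] by simp
    finally have "sqrt ((res (fst (Y n)) e t)\<^sup>2) \<le> K e" unfolding K_def by (rule real_sqrt_le_mono)
    then show ?thesis by simp
  qed
  have "\<forall>e\<in>arcs G. \<exists>g. primitive_on 0 (len e) (res u e) g \<and> continuous_on {0..len e} g \<and>
    primitive_on 0 (len e) (\<lambda>x. res a e x * g x) (\<lambda>x. (k e x - l) * res u e x)"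
  proof
    fix e assume e: "e \<in> arcs G"
    show "\<exists>g. primitive_on 0 (len e) (res u e) g \<and> continuous_on {0..len e} g \<and>
      primitive_on 0 (len e) (\<lambda>x. res a e x * g x) (\<lambda>x. (k e x - l) * res u e x)"
      by (rule limit_edge_equation[OF Y(1) e bound[OF e] lim[OF e] cu[OF e] weakY]) auto
  qed
  from bchoice[OF this] obtain g where "\<forall>e\<in>arcs G. primitive_on 0 (len e) (res u e) (g e) \<and>
    continuous_on {0..len e} (g e) \<and>
    primitive_on 0 (len e) (\<lambda>x. res a e x * g e x) (\<lambda>x. (k e x - l) * res u e x)" ..
  then have g: "primitive_on 0 (len e) (res u e) (g e)" "continuous_on {0..len e} (g e)"
    "primitive_on 0 (len e) (\<lambda>x. res a e x * g e x) (\<lambda>x. (k e x - l) * res u e x)" if "e \<in> arcs G" for e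
    using that by simp_all
  \<comment> \<open>Membership in \<open>energy_space\<close> results from the edge equations, which
    provide continuous and hence bounded derivatives.\<close>
  have V: "(u, g) \<in> energy_space"
    by (rule energy_spaceI[OF _ g(1) bmeas_continuous[OF g(2)]]) (simp_all add: u_def)
  have limV: "(\<lambda>n. fst (Y n) (Vertex v)) \<longlonglongrightarrow> u (Vertex v)" if v: "v \<in> verts G" for v
  proof -
    obtain e where e: "e \<in> arcs G" "tail G e = v \<or> head G e = v" using ex_incident_arc[OF v] by blast
    then show ?thesis
      using lim[OF e(1), of 0] lim[OF e(1), of "len e"] len_pos[OF e(1)] on_edge_ends(1) on_edge_ends(2)[OF e(1)] by auto
  qed
  have limL: "(\<lambda>n. L2_form (Y n) y) \<longlonglongrightarrow> L2_form (u, g) y" if y: "y \<in> energy_space" for y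
  proof -
    have "(\<lambda>n. \<Sum>e\<in>arcs G. integral {0..len e} (\<lambda>t. res (fst y) e t * res (fst (Y n)) e t)) \<longlonglongrightarrow>
      (\<Sum>e\<in>arcs G. integral {0..len e} (\<lambda>t. res (fst y) e t * res u e t))"
      by (intro tendsto_sum integral_mult_tendsto[OF energy_spaceD(4)[OF y] energy_spaceD(4)[OF Y(1)] bound lim])
    then show ?thesis by (simp add: L2_form_def mult.commute)
  qed
  have kirchhoff: "a (Vertex w) * outgoing_deriv_sum G len u w = \<alpha> * u (Vertex w)" if w: "w \<in> verts G" for w
  proof -
    define y where "y = vertex_hat w"
    note vh = vertex_hat[OF w, folded y_def]
    define d where "d e = (of_bool (head G e = w) - of_bool (tail G e = w)) / travel e (len e)" for e
    have cf: "res a e t * snd y e t = d e" if "e \<in> arcs G" "t \<in> {0..len e}" for e t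
      using vh(3)[OF that] by (simp add: d_def)
    note forms = energy_form_constant_flux[OF _ vh(1), where c=d, OF _ cf]
    have "(\<lambda>n. energy_form (Y n) y) \<longlonglongrightarrow> energy_form (u, g) y"
      unfolding forms[OF Y(1), simplified] forms[OF V, simplified] fst_conv
    proof (intro tendsto_add tendsto_mult tendsto_const tendsto_sum tendsto_diff)
      fix e assume e: "e \<in> arcs G"
      show "(\<lambda>n. res (fst (Y n)) e (len e)) \<longlonglongrightarrow> res u e (len e)" "(\<lambda>n. res (fst (Y n)) e 0) \<longlonglongrightarrow> res u e 0"
        using lim[OF e] len_pos[OF e] by auto
      show "(\<lambda>n. integral {0..len e} (\<lambda>t. (k e t * res (fst y) e t) * res (fst (Y n)) e t)) \<longlonglongrightarrow>
        integral {0..len e} (\<lambda>t. (k e t * res (fst y) e t) * res u e t)"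
        by (rule integral_mult_tendsto[OF bmeas_mult[OF k_bmeas[OF e] energy_spaceD(4)[OF vh(1) e]] energy_spaceD(4)[OF Y(1) e] bound[OF e] lim[OF e]])
    qed (rule limV)
    from tendsto_diff[OF this tendsto_mult[OF tendsto_const limL[OF vh(1)], of l]]
    have "energy_form (u, g) y - l * L2_form (u, g) y = 0"
      using weakY[OF vh(1)] by (rule LIMSEQ_unique)
    \<comment> \<open>By Green's identity only the vertex sum remains; \<open>y\<close> is 1 at
      \<open>w\<close> and 0 at all other vertices.\<close>
    then have "(\<Sum>v\<in>verts G. fst y (Vertex v) * (\<alpha> * u (Vertex v) - a (Vertex v) * outgoing_deriv_sum G len u v)) = 0"
      using green_identity[OF V vh(1) g(2,3)] by simp
    moreover have "(\<Sum>v\<in>verts G. fst y (Vertex v) * (\<alpha> * u (Vertex v) - a (Vertex v) * outgoing_deriv_sum G len u v)) =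
      (\<Sum>v\<in>verts G. if v = w then \<alpha> * u (Vertex v) - a (Vertex v) * outgoing_deriv_sum G len u v else 0)"
      by (intro sum.cong refl) (simp add: vh(2))
    ultimately show ?thesis using w by simp
  qed
  have eig: "u \<in> eigenspace G len a \<kappa> \<alpha> l" by (rule eigenspaceI[OF V g(2,3) kirchhoff])
  have one: "L2_form (u, g) (u, g) = 1"
  proof -
    have "(\<lambda>n. \<Sum>e\<in>arcs G. integral {0..len e} (\<lambda>t. 1 * (res (fst (Y n)) e t * res (fst (Y n)) e t))) \<longlonglongrightarrow>
      (\<Sum>e\<in>arcs G. integral {0..len e} (\<lambda>t. 1 * (res u e t * res u e t)))"
    proof (intro tendsto_sum)
      fix e assume e: "e \<in> arcs G"
      show "(\<lambda>n. integral {0..len e} (\<lambda>t. 1 * (res (fst (Y n)) e t * res (fst (Y n)) e t))) \<longlonglongrightarrow>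
        integral {0..len e} (\<lambda>t. 1 * (res u e t * res u e t))"
      proof (rule integral_mult_tendsto[where C="K e * K e", OF bmeas_const])
        show "bmeas 0 (len e) (\<lambda>t. res (fst (Y n)) e t * res (fst (Y n)) e t)" for n
          by (intro bmeas_mult energy_spaceD(4)[OF Y(1) e])
        show "\<bar>res (fst (Y n)) e t * res (fst (Y n)) e t\<bar> \<le> K e * K e" if "t \<in> {0..len e}" for n t
          unfolding abs_mult using bound[OF e that, of n] by (intro mult_mono) auto
        show "(\<lambda>n. res (fst (Y n)) e t * res (fst (Y n)) e t) \<longlonglongrightarrow> res u e t * res u e t" if "t \<in> {0..len e}" for t
          by (intro tendsto_mult lim e that)
      qed
    qed
    then have "(\<lambda>n. L2_form (Y n) (Y n)) \<longlonglongrightarrow> L2_form (u, g) (u, g)" by (simp add: L2_form_def)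
    then show ?thesis by (simp add: Y(2) LIMSEQ_const_iff)
  qed
  show ?thesis
  proof (rule that[OF V eig one])
    fix y assume y: "y \<in> energy_space" "\<And>n. L2_form (X n) y = 0"
    then have "L2_form (Y n) y = 0" for n by (simp add: Y_def)
    then show "L2_form (u, g) y = 0" using limL[OF y(1)] by (simp add: LIMSEQ_const_iff)
  qed
qed

end

section \<open>Eigenvalue bounds\<close>

lemma eigenvectors_orthogonal:
  assumes Q: "symmetric_form V Q" and M: "symmetric_form V M"
    and "x \<in> V" "y \<in> V" "Q x y = \<mu> * M x y" "Q y x = \<nu> * M y x" "\<mu> \<noteq> \<nu>"
  shows "M x y = 0"
proof -
  have "\<mu> * M x y = \<nu> * M x y"
    using symmetric_form.sym[OF Q assms(3,4)] symmetric_form.sym[OF M assms(3,4)] assms(5,6) by simp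
  then show ?thesis using assms(7) by simp
qed

text \<open>By orthogonality, \<open>\<Lambda> M - Q\<close> takes at \<open>\<Sum> c\<^sub>i \<Phi>\<^sub>i\<close> the value of \<open>M\<close> at
  \<open>\<Sum> sqrt (\<Lambda> - \<mu>\<^sub>i) c\<^sub>i \<Phi>\<^sub>i\<close>.\<close>
lemma rayleigh_quotient_le:
  assumes Q: "symmetric_form V Q" and M: "psd_form V M" and I: "finite I"
    and \<Phi>: "\<And>i. i \<in> I \<Longrightarrow> \<Phi> i \<in> V"
      "\<And>i j. i \<in> I \<Longrightarrow> j \<in> I \<Longrightarrow> Q (\<Phi> i) (\<Phi> j) = \<mu> i * M (\<Phi> i) (\<Phi> j)"
    and \<mu>: "\<And>i. i \<in> I \<Longrightarrow> \<mu> i \<le> \<Lambda>"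
  shows "Q (\<Sum>i\<in>I. c i *\<^sub>R \<Phi> i) (\<Sum>i\<in>I. c i *\<^sub>R \<Phi> i) \<le> \<Lambda> * M (\<Sum>i\<in>I. c i *\<^sub>R \<Phi> i) (\<Sum>i\<in>I. c i *\<^sub>R \<Phi> i)"
proof -
  interpret Q: symmetric_form V Q by fact
  interpret M: psd_form V M by fact
  have expQ: "Q (\<Sum>i\<in>I. b i *\<^sub>R \<Phi> i) (\<Sum>i\<in>I. b i *\<^sub>R \<Phi> i) = (\<Sum>i\<in>I. \<Sum>j\<in>I. b i * (b j * Q (\<Phi> i) (\<Phi> j)))" for b
  proof -
    have "Q (\<Sum>i\<in>I. b i *\<^sub>R \<Phi> i) (\<Sum>i\<in>I. b i *\<^sub>R \<Phi> i) = (\<Sum>i\<in>I. b i * Q (\<Phi> i) (\<Sum>i\<in>I. b i *\<^sub>R \<Phi> i))"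
      by (rule Q.sum_left[OF I \<Phi>(1) Q.sum_in[OF \<Phi>(1)]])
    also have "\<dots> = (\<Sum>i\<in>I. \<Sum>j\<in>I. b i * (b j * Q (\<Phi> i) (\<Phi> j)))"
      by (intro sum.cong refl) (simp add: Q.sum_right[OF I \<Phi>(1) \<Phi>(1)] sum_distrib_left)
    finally show ?thesis .
  qed
  have expM: "M (\<Sum>i\<in>I. b i *\<^sub>R \<Phi> i) (\<Sum>i\<in>I. b i *\<^sub>R \<Phi> i) = (\<Sum>i\<in>I. \<Sum>j\<in>I. b i * (b j * M (\<Phi> i) (\<Phi> j)))" for b
  proof -
    have "M (\<Sum>i\<in>I. b i *\<^sub>R \<Phi> i) (\<Sum>i\<in>I. b i *\<^sub>R \<Phi> i) = (\<Sum>i\<in>I. b i * M (\<Phi> i) (\<Sum>i\<in>I. b i *\<^sub>R \<Phi> i))"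
      by (rule M.sum_left[OF I \<Phi>(1) M.sum_in[OF \<Phi>(1)]])
    also have "\<dots> = (\<Sum>i\<in>I. \<Sum>j\<in>I. b i * (b j * M (\<Phi> i) (\<Phi> j)))"
      by (intro sum.cong refl) (simp add: M.sum_right[OF I \<Phi>(1) \<Phi>(1)] sum_distrib_left)
    finally show ?thesis .
  qed
  define d where "d i = sqrt (\<Lambda> - \<mu> i) * c i" for i
  have "\<Lambda> * M (\<Sum>i\<in>I. c i *\<^sub>R \<Phi> i) (\<Sum>i\<in>I. c i *\<^sub>R \<Phi> i) - Q (\<Sum>i\<in>I. c i *\<^sub>R \<Phi> i) (\<Sum>i\<in>I. c i *\<^sub>R \<Phi> i)
    = (\<Sum>i\<in>I. \<Sum>j\<in>I. \<Lambda> * (c i * (c j * M (\<Phi> i) (\<Phi> j))) - c i * (c j * Q (\<Phi> i) (\<Phi> j)))"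
    unfolding expQ expM by (simp add: sum_distrib_left sum_subtractf)
  also have "\<dots> = (\<Sum>i\<in>I. \<Sum>j\<in>I. d i * (d j * M (\<Phi> i) (\<Phi> j)))"
  proof (intro sum.cong refl)
    fix i j assume ij: "i \<in> I" "j \<in> I"
    show "\<Lambda> * (c i * (c j * M (\<Phi> i) (\<Phi> j))) - c i * (c j * Q (\<Phi> i) (\<Phi> j)) = d i * (d j * M (\<Phi> i) (\<Phi> j))"
    \<comment> \<open>Vectors with equal eigenvalues need not be orthogonal, so the comparison is
      made pair by pair: equal eigenvalues merge the two square roots, distinct ones give
      \<open>M (\<Phi> i) (\<Phi> j) = 0\<close>.\<close>
    proof (cases "\<mu> i = \<mu> j")
      case True
      have "sqrt (\<Lambda> - \<mu> i) * sqrt (\<Lambda> - \<mu> j) = \<Lambda> - \<mu> i" using True \<mu>[OF ij(1)] by simp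
      then have "d i * (d j * M (\<Phi> i) (\<Phi> j)) = (\<Lambda> - \<mu> i) * (c i * (c j * M (\<Phi> i) (\<Phi> j)))"
        unfolding d_def by (metis mult.assoc mult.left_commute)
      then show ?thesis by (simp add: \<Phi>(2)[OF ij] algebra_simps)
    next
      case False
      have "M (\<Phi> i) (\<Phi> j) = 0"
        by (rule eigenvectors_orthogonal[OF Q M.symmetric_form_axioms \<Phi>(1)[OF ij(1)] \<Phi>(1)[OF ij(2)]
              \<Phi>(2)[OF ij] \<Phi>(2)[OF ij(2,1)] False])
      then show ?thesis by (simp add: \<Phi>(2)[OF ij])
    qed
  qed
  also have "\<dots> = M (\<Sum>i\<in>I. d i *\<^sub>R \<Phi> i) (\<Sum>i\<in>I. d i *\<^sub>R \<Phi> i)" by (rule expM[symmetric])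
  also have "\<dots> \<ge> 0" by (rule M.nonneg[OF M.sum_in[OF \<Phi>(1)]])
  finally show ?thesis by simp
qed

text \<open>\<open>poincare_inequality\<close> on each cell, started at its left mesh point, summed
  by induction over the cells.\<close>

lemma mesh_poincare_inequality:
  assumes p: "primitive_on 0 l F f" and b: "bmeas 0 l f" and m: "1 \<le> m" and l: "0 < l"
    and zero: "\<And>i. i \<le> m \<Longrightarrow> F (real i * (l / real m)) = 0"
  shows "integral {0..l} (\<lambda>t. (F t)\<^sup>2) \<le> (l / real m)\<^sup>2 * integral {0..l} (\<lambda>t. (f t)\<^sup>2)"
proof -
  define h where "h = l / real m"
  have h: "0 < h" "real m * h = l" using l m by (auto simp: h_def)
  have bF: "bmeas 0 l F" by (rule bmeas_continuous[OF primitive_on_continuous[OF p]])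
  have b2: "bmeas 0 l (\<lambda>t. (F t)\<^sup>2)" "bmeas 0 l (\<lambda>t. (f t)\<^sup>2)"
    unfolding power2_eq_square by (intro bmeas_mult bF b)+
  have "integral {0..real i * h} (\<lambda>t. (F t)\<^sup>2) \<le> h\<^sup>2 * integral {0..real i * h} (\<lambda>t. (f t)\<^sup>2)" if "i \<le> m" for i
    using that
  proof (induction i)
    case (Suc i)
    have le: "0 \<le> real i * h" "real i * h \<le> real (Suc i) * h" "real (Suc i) * h \<le> l"
    proof -
      show "0 \<le> real i * h" "real i * h \<le> real (Suc i) * h" using h(1) by (auto simp: algebra_simps)
      have "real (Suc i) * h \<le> real m * h" using h(1) Suc.prems by (intro mult_right_mono) auto
      then show "real (Suc i) * h \<le> l" by (simp only: h(2))
    qed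
    have comb: "integral {0..real i * h} w + integral {real i * h..real (Suc i) * h} w = integral {0..real (Suc i) * h} w"
      if "bmeas 0 l w" for w
      using le bmeas_integrable[OF bmeas_subinterval[OF that order_refl le(3)]]
      by (intro Henstock_Kurzweil_Integration.integral_combine) auto
    have "integral {real i * h..real (Suc i) * h} (\<lambda>t. (F t)\<^sup>2) \<le>
        (real (Suc i) * h - real i * h)\<^sup>2 * integral {real i * h..real (Suc i) * h} (\<lambda>t. (f t)\<^sup>2)"
      using zero[of i] Suc.prems
      by (intro poincare_inequality primitive_on_subinterval[OF p le(1,3)] bmeas_subinterval[OF b le(1,3)] le)
        (auto simp: h_def)
    also have "real (Suc i) * h - real i * h = h" by (simp add: algebra_simps)
    finally have "integral {real i * h..real (Suc i) * h} (\<lambda>t. (F t)\<^sup>2) \<le> h\<^sup>2 * integral {real i * h..real (Suc i) * h} (\<lambda>t. (f t)\<^sup>2)" .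
    then show ?case
      using Suc unfolding comb[OF b2(1), symmetric] comb[OF b2(2), symmetric] by (simp add: distrib_left)
  qed simp
  from this[of m] show ?thesis unfolding h(2) by (simp add: h_def)
qed

text \<open>One integration by parts with vanishing end values relates the two integrals without
  evaluating either. It exhibits the sines as eigenvectors of the derivative form, and their
  orthogonality follows from that. The shift \<open>Suc j\<close> excludes the zero
  frequency.\<close>

lemma sine_forms:
  fixes i j :: nat
  assumes l: "0 < l"
  defines "\<omega> \<equiv> \<lambda>j. real (Suc j) * pi / l"
  shows "primitive_on 0 l (\<lambda>t. sin (\<omega> j * t)) (\<lambda>t. \<omega> j * cos (\<omega> j * t))"
    and "sin (\<omega> j * l) = 0"
    and "integral {0..l} (\<lambda>t. (\<omega> i * cos (\<omega> i * t)) * (\<omega> j * cos (\<omega> j * t)))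
      = (\<omega> i)\<^sup>2 * integral {0..l} (\<lambda>t. sin (\<omega> i * t) * sin (\<omega> j * t))"
proof -
  show s: "primitive_on 0 l (\<lambda>t. sin (\<omega> j * t)) (\<lambda>t. \<omega> j * cos (\<omega> j * t))" for j
    by (rule primitive_on_C1) (auto intro!: derivative_eq_intros continuous_intros)
  have c: "primitive_on 0 l (\<lambda>t. \<omega> j * cos (\<omega> j * t)) (\<lambda>t. - (\<omega> j)\<^sup>2 * sin (\<omega> j * t))" for j
    by (rule primitive_on_C1) (auto intro!: derivative_eq_intros continuous_intros simp: power2_eq_square)
  show z: "sin (\<omega> j * l) = 0" for j
    using l sin_npi[of "Suc j"] by (simp add: \<omega>_def)
  define h where "h t = sin (\<omega> i * t) * sin (\<omega> j * t)" for t
  define g where "g t = (\<omega> i * cos (\<omega> i * t)) * (\<omega> j * cos (\<omega> j * t))" for t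
  have int: "(\<lambda>t. - (\<omega> i)\<^sup>2 * h t) integrable_on {0..l}" "g integrable_on {0..l}"
    unfolding h_def g_def by (intro integrable_continuous_real continuous_intros)+
  have "integral {0..l} (\<lambda>t. - (\<omega> i)\<^sup>2 * h t + g t) = 0"
    using integral_product_rule[OF c[of i] s[of j]] l z by (simp add: h_def g_def mult.assoc)
  then have "integral {0..l} g = (\<omega> i)\<^sup>2 * integral {0..l} h"
    unfolding integral_add[OF int] by simp
  then show "integral {0..l} (\<lambda>t. (\<omega> i * cos (\<omega> i * t)) * (\<omega> j * cos (\<omega> j * t)))
      = (\<omega> i)\<^sup>2 * integral {0..l} (\<lambda>t. sin (\<omega> i * t) * sin (\<omega> j * t))"
    unfolding h_def g_def .
qed

context quantum_graph
begin

section \<open>Definiteness of the norm and enumeration of the eigenfunctions\<close>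

lemma deriv_form_symmetric: "symmetric_form energy_space deriv_form"
proof
  fix x y z :: "('v, 'e) energy_pair" and c :: real
  show "deriv_form x y = deriv_form y x" by (simp add: deriv_form_def mult.commute)
  show "deriv_form (c *\<^sub>R x) z = c * deriv_form x z"
    by (simp add: deriv_form_def curried_scaleR sum_distrib_left mult.assoc)
  assume V: "x \<in> energy_space" "y \<in> energy_space" "z \<in> energy_space"
  show "deriv_form (x + y) z = deriv_form x z + deriv_form y z"
    unfolding deriv_form_def sum.distrib[symmetric]
  proof (intro sum.cong refl)
    fix e assume e: "e \<in> arcs G"
    show "integral {0..len e} (\<lambda>t. snd (x + y) e t * snd z e t) =
      integral {0..len e} (\<lambda>t. snd x e t * snd z e t) + integral {0..len e} (\<lambda>t. snd y e t * snd z e t)"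
      using integral_add[OF bmeas_integrable[OF bmeas_L2_density(2)[OF V(1,3) e]]
          bmeas_integrable[OF bmeas_L2_density(2)[OF V(2,3) e]]]
      by (simp add: distrib_right)
  qed
qed (rule subspace_energy_space)

sublocale M: psd_form energy_space L2_form by (rule L2_form_psd)

sublocale Q: symmetric_form energy_space energy_form by (rule energy_form_symmetric)

text \<open>Continuity along edges turns vanishing almost everywhere into vanishing. Only the first
  component is determined: the second is a representative of the derivative and is free on null
  sets.\<close>

lemma L2_form_definite:
  assumes x: "x \<in> energy_space" and "L2_form x x = 0"
  shows "fst x = 0"
proof
  fix p
  have edge: "res (fst x) e t = 0" if e: "e \<in> arcs G" "t \<in> {0..len e}" for e t
  proof -
    have "(\<Sum>e\<in>arcs G. edge_L2 x e) = 0" using assms(2) by (simp add: L2_form_diag)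
    then have "edge_L2 x e = 0"
      using edge_L2_nonneg[OF x] e(1) by (subst (asm) sum_nonneg_eq_0_iff) auto
    moreover have "continuous_on {0..len e} (\<lambda>t. (res (fst x) e t)\<^sup>2)"
      by (intro continuous_intros primitive_on_continuous[OF energy_spaceD(2)[OF x e(1)]])
    ultimately have "(res (fst x) e t)\<^sup>2 = 0"
      using integral_eq_0_iff[of 0 "len e" "\<lambda>t. (res (fst x) e t)\<^sup>2"] len_pos[OF e(1)] e(2) by simp
    then show ?thesis by simp
  qed
  show "fst x p = 0 p"
  proof (cases "p \<in> gpoints G len")
    case True
    then obtain e t where "e \<in> arcs G" "t \<in> {0..len e}" "p = edge_pt G len e t" by (rule gpointsE)
    then show ?thesis using edge[of e t] by (simp add: on_edge_def)
  qed (simp add: energy_spaceD(1)[OF x])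
qed

lemma fst_combination: "fst (\<Sum>i\<in>I. c i *\<^sub>R \<Phi> i) p = (\<Sum>i\<in>I. c i * fst (\<Phi> i) p)"
  for \<Phi> :: "'i \<Rightarrow> ('v, 'e) energy_pair"
  by (induction I rule: infinite_finite_induct) (auto simp: scaleR_fun_def)

lemma res_combination: "res (fst (\<Sum>i\<in>I. c i *\<^sub>R \<Phi> i)) e t = (\<Sum>i\<in>I. c i * res (fst (\<Phi> i)) e t)"
  for \<Phi> :: "'i \<Rightarrow> ('v, 'e) energy_pair"
  unfolding on_edge_def by (rule fst_combination)

text \<open>Independence is demanded inside each eigenspace only; across eigenvalues it follows from
  orthogonality. The last clause makes the list complete, which the upper bound exploits.\<close>

definition eigenbasis :: "(nat \<Rightarrow> real) \<Rightarrow> (nat \<Rightarrow> ('v, 'e) energy_pair) \<Rightarrow> bool" where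
  "eigenbasis ev \<Phi> \<longleftrightarrow>
     (\<forall>n\<ge>1. \<Phi> n \<in> energy_space \<and> (\<forall>y\<in>energy_space. energy_form (\<Phi> n) y = ev n * L2_form (\<Phi> n) y)) \<and>
     (\<forall>\<mu>. finite {n. 1 \<le> n \<and> ev n = \<mu>} \<and> inj_on (\<lambda>n. fst (\<Phi> n)) {n. 1 \<le> n \<and> ev n = \<mu>} \<and>
        independent ((\<lambda>n. fst (\<Phi> n)) ` {n. 1 \<le> n \<and> ev n = \<mu>}) \<and>
        span ((\<lambda>n. fst (\<Phi> n)) ` {n. 1 \<le> n \<and> ev n = \<mu>}) = eigenspace G len a \<kappa> \<alpha> \<mu>)"

text \<open>The multiplicity count in \<open>eigenvalue_sequence\<close> matches a basis of each
  eigenspace with the indices carrying its eigenvalue; these bijections are glued along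
  \<open>ev\<close>.\<close>

lemma ex_eigenbasis:
  assumes ev: "eigenvalue_sequence G len a \<kappa> \<alpha> ev"
  shows "\<exists>\<Phi>. eigenbasis ev \<Phi>"
proof -
  define J where "J \<mu> = {n. 1 \<le> n \<and> ev n = \<mu>}" for \<mu>
  have J: "finite (J \<mu>)" "\<exists>B. finite B \<and> independent B \<and> span B = eigenspace G len a \<kappa> \<alpha> \<mu> \<and> card B = card (J \<mu>)" for \<mu>
    using ev by (auto simp: eigenvalue_sequence_def J_def)
  then obtain B where B: "\<And>\<mu>. finite (B \<mu>)" "\<And>\<mu>. independent (B \<mu>)"
    "\<And>\<mu>. span (B \<mu>) = eigenspace G len a \<kappa> \<alpha> \<mu>" "\<And>\<mu>. card (B \<mu>) = card (J \<mu>)"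
    by metis
  have "\<exists>f. bij_betw f (J \<mu>) (B \<mu>)" for \<mu>
    by (rule finite_same_card_bij[OF J(1) B(1)]) (simp add: B(4))
  then obtain f where f: "\<And>\<mu>. bij_betw (f \<mu>) (J \<mu>) (B \<mu>)" by metis
  define \<phi> where "\<phi> n = f (ev n) n" for n
  have \<phi>f: "\<phi> n = f \<mu> n" if "n \<in> J \<mu>" for n \<mu> using that by (simp add: \<phi>_def J_def)
  have im: "\<phi> ` J \<mu> = B \<mu>" for \<mu>
    using f[of \<mu>] \<phi>f by (simp add: bij_betw_def cong: image_cong)
  have inj: "inj_on \<phi> (J \<mu>)" for \<mu>
    using f[of \<mu>] \<phi>f by (simp add: bij_betw_def cong: inj_on_cong)
  have "\<exists>g. (\<phi> n, g) \<in> energy_space \<and> (\<forall>y\<in>energy_space. energy_form (\<phi> n, g) y = ev n * L2_form (\<phi> n, g) y)"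
    if n: "1 \<le> n" for n
  proof -
    have "n \<in> J (ev n)" using n by (simp add: J_def)
    then have "\<phi> n \<in> B (ev n)" using im by blast
    then have "\<phi> n \<in> eigenspace G len a \<kappa> \<alpha> (ev n)" using B(3) span_base by blast
    then show ?thesis by (rule eigenspace_lift) blast
  qed
  then have "\<forall>n. \<exists>g. 1 \<le> n \<longrightarrow> (\<phi> n, g) \<in> energy_space \<and> (\<forall>y\<in>energy_space. energy_form (\<phi> n, g) y = ev n * L2_form (\<phi> n, g) y)"
    by blast
  from choice[OF this] obtain g where
    g: "\<forall>n. 1 \<le> n \<longrightarrow> (\<phi> n, g n) \<in> energy_space \<and> (\<forall>y\<in>energy_space. energy_form (\<phi> n, g n) y = ev n * L2_form (\<phi> n, g n) y)" ..
  have "eigenbasis ev (\<lambda>n. (\<phi> n, g n))"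
    unfolding eigenbasis_def J_def[symmetric] fst_conv im using g J(1) inj B(2,3) by simp
  then show ?thesis by blast
qed

text \<open>Stated for vanishing norm, because the derivative components are defined only up to null
  sets. The part belonging to one eigenvalue is orthogonal to the remainder, hence itself null, and
  independence inside the eigenspace applies.\<close>

lemma eigenbasis_independent:
  assumes \<Phi>: "eigenbasis ev \<Phi>" and I: "finite I" "I \<subseteq> {1..}"
    and zero: "L2_form (\<Sum>i\<in>I. c i *\<^sub>R \<Phi> i) (\<Sum>i\<in>I. c i *\<^sub>R \<Phi> i) = 0" and i: "i \<in> I"
  shows "c i = 0"
proof -
  have V: "\<Phi> j \<in> energy_space" "\<And>y. y \<in> energy_space \<Longrightarrow> energy_form (\<Phi> j) y = ev j * L2_form (\<Phi> j) y" if "j \<in> I" for j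
    using \<Phi> that I(2) by (auto simp: eigenbasis_def)
  define K where "K = {j \<in> I. ev j = ev i}"
  have K: "finite K" "K \<subseteq> I" "i \<in> K" using I i by (auto simp: K_def)
  define x where "x = (\<Sum>j\<in>I. c j *\<^sub>R \<Phi> j)"
  define y where "y = (\<Sum>j\<in>K. c j *\<^sub>R \<Phi> j)"
  have xV: "x \<in> energy_space" unfolding x_def using V(1) by (rule M.sum_in)
  have yV: "y \<in> energy_space" unfolding y_def using V(1) K by (intro M.sum_in) auto
  have "L2_form y (\<Phi> j) = 0" if j: "j \<in> I - K" for j
  proof -
    have "L2_form (\<Phi> m) (\<Phi> j) = 0" if m: "m \<in> K" for m
    proof (rule eigenvectors_orthogonal[OF energy_form_symmetric L2_form_symmetric])
      show "energy_form (\<Phi> m) (\<Phi> j) = ev m * L2_form (\<Phi> m) (\<Phi> j)" "energy_form (\<Phi> j) (\<Phi> m) = ev j * L2_form (\<Phi> j) (\<Phi> m)"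
        "\<Phi> m \<in> energy_space" "\<Phi> j \<in> energy_space"
        using V(2)[of m "\<Phi> j"] V(2)[of j "\<Phi> m"] V(1)[of m] V(1)[of j] j m K(2) by blast+
      show "ev m \<noteq> ev j" using j m by (auto simp: K_def)
    qed
    then show ?thesis
      unfolding y_def using K V(1) j by (subst M.sum_left) auto
  qed
  then have "L2_form y (\<Sum>j\<in>I - K. c j *\<^sub>R \<Phi> j) = 0"
    using I V(1) yV by (subst M.sum_right) auto
  moreover have xy: "x = y + (\<Sum>j\<in>I - K. c j *\<^sub>R \<Phi> j)"
    unfolding x_def y_def using sum.subset_diff[OF K(2) I(1), of "\<lambda>j. c j *\<^sub>R \<Phi> j"] by (simp add: add.commute)
  have "(\<Sum>j\<in>I - K. c j *\<^sub>R \<Phi> j) \<in> energy_space" using V(1) by (intro M.sum_in) auto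
  ultimately have "L2_form y x = L2_form y y"
    unfolding xy using yV by (simp add: M.add_right)
  moreover have "L2_form y x = 0"
    using M.null_vector[OF xV yV] zero M.sym[OF xV yV] by (simp add: x_def)
  ultimately have "fst y = 0" using yV by (intro L2_form_definite) auto
  then have sum0: "(\<Sum>j\<in>K. c j *\<^sub>R fst (\<Phi> j)) = 0"
    by (simp add: y_def fst_sum)
  define \<phi> where "\<phi> j = fst (\<Phi> j)" for j
  have KJ: "K \<subseteq> {n. 1 \<le> n \<and> ev n = ev i}" using I(2) by (auto simp: K_def)
  have inj: "inj_on \<phi> K"
    using \<Phi> inj_on_subset[OF _ KJ] unfolding eigenbasis_def \<phi>_def by blast
  have ind: "independent (\<phi> ` {n. 1 \<le> n \<and> ev n = ev i})"
    using \<Phi> by (simp add: eigenbasis_def \<phi>_def[abs_def])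
  have "(\<Sum>v\<in>\<phi> ` K. c (the_inv_into K \<phi> v) *\<^sub>R v) = (\<Sum>j\<in>K. c j *\<^sub>R \<phi> j)"
    by (subst sum.reindex[OF inj]) (auto intro!: sum.cong simp: the_inv_into_f_f[OF inj])
  also have "\<dots> = 0" using sum0 by (simp add: \<phi>_def)
  finally have rel: "(\<Sum>v\<in>\<phi> ` K. c (the_inv_into K \<phi> v) *\<^sub>R v) = 0" .
  have "c (the_inv_into K \<phi> (\<phi> i)) = 0"
    by (rule independentD[OF ind _ _ rel]) (use K KJ in auto)
  then show ?thesis using the_inv_into_f_f[OF inj K(3)] by simp
qed

text \<open>\<open>card (arcs G) * (m + 1)\<close> counts the vanishing conditions at the mesh
  points of all edges, both ends included; with \<open>n\<close> coefficients a nontrivial solution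
  remains.\<close>

lemma eigenvalue_lower_bound:
  assumes \<Phi>: "eigenbasis ev \<Phi>" and mono: "mono_on {1..} ev" and m: "1 \<le> m" "card (arcs G) * (m + 1) < n"
  shows "a\<^sub>0 * (real m / Max (len ` arcs G))\<^sup>2 \<le> ev n"
proof -
  define I where "I = arcs G \<times> {0..m}"
  define J where "J = {1..n}"
  have V: "\<Phi> j \<in> energy_space" "\<And>y. y \<in> energy_space \<Longrightarrow> energy_form (\<Phi> j) y = ev j * L2_form (\<Phi> j) y" if "j \<in> J" for j
    using \<Phi> that by (auto simp: eigenbasis_def J_def)
  have card: "card I < card J" and fin: "finite I" "finite J" using m(2) by (simp_all add: I_def J_def)
  obtain c where c: "\<exists>j\<in>J. c j \<noteq> 0"
    "\<And>p. p \<in> I \<Longrightarrow> (\<Sum>j\<in>J. c j * (case p of (e, i) \<Rightarrow> res (fst (\<Phi> j)) e (real i * (len e / real m)))) = 0"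
    by (rule underdetermined_system[OF fin card,
          where m="\<lambda>p j. case p of (e, i) \<Rightarrow> res (fst (\<Phi> j)) e (real i * (len e / real m))"]) blast
  define x where "x = (\<Sum>j\<in>J. c j *\<^sub>R \<Phi> j)"
  have xV: "x \<in> energy_space" unfolding x_def by (rule M.sum_in[OF V(1)])
  have mesh: "res (fst x) e (real i * (len e / real m)) = 0" if "e \<in> arcs G" "i \<le> m" for e i
    using c(2)[of "(e, i)"] that by (simp add: x_def res_combination I_def)
  have vertex: "fst x (Vertex v) = 0" if v: "v \<in> verts G" for v
  proof -
    obtain e where e: "e \<in> arcs G" "tail G e = v \<or> head G e = v" using ex_incident_arc[OF v] by blast
    then show ?thesis
      using mesh[OF e(1), of 0] mesh[OF e(1), of m] m(1) on_edge_ends(1)[of "fst x" e] on_edge_ends(2)[OF e(1), of "fst x"]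
      by auto
  qed
  have pos: "0 < L2_form x x"
  proof -
    have "L2_form x x \<noteq> 0"
    proof
      assume z: "L2_form x x = 0"
      have "c j = 0" if "j \<in> J" for j
        by (rule eigenbasis_independent[OF \<Phi> fin(2) _ z[unfolded x_def] that]) (auto simp: J_def)
      then show False using c(1) by blast
    qed
    then show ?thesis using M.nonneg[OF xV] by simp
  qed
  define l where "l = Max (len ` arcs G)"
  have ll: "len e \<le> l" if "e \<in> arcs G" for e unfolding l_def using that by (intro Max_ge) auto
  have l0: "0 < l" using ll len_pos arcs_ne by (meson all_not_in_conv less_le_trans)
  have "L2_form x x \<le> (l / real m)\<^sup>2 * deriv_form x x"
    unfolding L2_form_diag deriv_form_diag sum_distrib_left
  proof (rule sum_mono)
    fix e assume e: "e \<in> arcs G"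
    have "edge_L2 x e \<le> (len e / real m)\<^sup>2 * edge_deriv x e"
      using mesh[OF e] len_pos[OF e] m(1) by (intro mesh_poincare_inequality energy_spaceD(2,3)[OF xV e]) auto
    also have "\<dots> \<le> (l / real m)\<^sup>2 * edge_deriv x e"
      using ll[OF e] len_pos[OF e] edge_deriv_nonneg[OF xV e]
      by (intro mult_right_mono power_mono divide_right_mono) auto
    finally show "edge_L2 x e \<le> (l / real m)\<^sup>2 * edge_deriv x e" .
  qed
  then have "a\<^sub>0 * (real m / l)\<^sup>2 * L2_form x x \<le> a\<^sub>0 * (real m / l)\<^sup>2 * ((l / real m)\<^sup>2 * deriv_form x x)"
    using a\<^sub>0_pos by (intro mult_left_mono) auto
  also have "\<dots> = a\<^sub>0 * deriv_form x x" using l0 m(1) by (simp add: power_divide)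
  also have "\<dots> \<le> energy_form x x"
  proof -
    have "0 \<le> c\<^sub>0 * L2_form x x" using \<delta> pos by simp
    then show ?thesis using energy_form_ge[OF xV] vertex by simp
  qed
  also have "\<dots> \<le> ev n * L2_form x x"
    unfolding x_def
  proof (rule rayleigh_quotient_le[OF energy_form_symmetric L2_form_psd])
    show "ev j \<le> ev n" if "j \<in> J" for j
      using that mono by (auto simp: J_def mono_on_def)
  qed (use V in \<open>auto simp: J_def\<close>)
  finally show ?thesis using pos by (simp add: l_def)
qed

text \<open>Covers the small indices, for which the mesh argument may lack eigenfunctions.\<close>

lemma eigenvalue_ge:
  assumes \<Phi>: "eigenbasis ev \<Phi>" and n: "1 \<le> n"
  shows "\<delta> \<le> ev n"
proof -
  have V: "\<Phi> n \<in> energy_space" "energy_form (\<Phi> n) (\<Phi> n) = ev n * L2_form (\<Phi> n) (\<Phi> n)"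
    using \<Phi> n by (auto simp: eigenbasis_def)
  have "L2_form (\<Phi> n) (\<Phi> n) \<noteq> 0"
    using eigenbasis_independent[OF \<Phi>, of "{n}" "\<lambda>_. 1" n] n by auto
  then have "0 < L2_form (\<Phi> n) (\<Phi> n)" using M.nonneg[OF V(1)] by simp
  moreover have "\<delta> * L2_form (\<Phi> n) (\<Phi> n) \<le> ev n * L2_form (\<Phi> n) (\<Phi> n)"
    using energy_form_coercive[OF V(1)] V(2) by simp
  ultimately show ?thesis by simp
qed

text \<open>\<open>n\<close> sines on one edge face \<open>n - 1\<close> orthogonality conditions.
  The sines are eigenvectors of \<open>deriv_form\<close> relative to \<open>L2_form\<close>, so
  \<open>rayleigh_quotient_le\<close> bounds the quotient of any combination by the largest squared
  frequency.\<close>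

lemma ex_trial_function:
  assumes e: "e \<in> arcs G" and \<Psi>: "\<And>i. i \<in> {1..<n} \<Longrightarrow> \<Psi> i \<in> energy_space" and n: "1 \<le> n"
  obtains x where "x \<in> energy_space" "\<And>i. i \<in> {1..<n} \<Longrightarrow> L2_form x (\<Psi> i) = 0" "0 < L2_form x x"
    "deriv_form x x \<le> (real n * pi / len e)\<^sup>2 * L2_form x x" "\<And>v. fst x (Vertex v) = 0"
proof -
  define \<omega> where "\<omega> j = real (Suc j) * pi / len e" for j
  note l = len_pos[OF e]
  note sf = sine_forms[OF l, folded \<omega>_def]
  define Y where "Y j = edge_bump e (\<lambda>t. sin (\<omega> j * t)) (\<lambda>t. \<omega> j * cos (\<omega> j * t))" for j
  have b: "bmeas 0 (len e) (\<lambda>t. \<omega> j * cos (\<omega> j * t))" for j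
    by (intro bmeas_continuous continuous_intros)
  have s0: "sin (\<omega> j * 0) = 0" for j by simp
  note eb = edge_bump[OF e sf(1) b s0 sf(2), folded Y_def]
  note ef = edge_bump_forms[OF e sf(1) b s0 sf(2), folded Y_def]
  have L: "L2_form (Y i) (Y j) = integral {0..len e} (\<lambda>t. sin (\<omega> i * t) * sin (\<omega> j * t))" for i j
    unfolding ef(1) by (rule integral_cong) (simp add: eb(2))
  have D: "deriv_form (Y i) (Y j) = (\<omega> i)\<^sup>2 * L2_form (Y i) (Y j)" for i j
    unfolding ef(2) L sf(3)[symmetric] by (simp add: eb(5))
  have orth: "L2_form (Y i) (Y j) = 0" if "i \<noteq> j" for i j
  proof (rule eigenvectors_orthogonal[OF deriv_form_symmetric L2_form_symmetric eb(1) eb(1) D D])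
    have "\<omega> i \<noteq> \<omega> j" "0 < \<omega> i" "0 < \<omega> j" using that l by (auto simp: \<omega>_def)
    then show "(\<omega> i)\<^sup>2 \<noteq> (\<omega> j)\<^sup>2" by (simp add: power2_eq_iff)
  qed
  have pos: "L2_form (Y j) (Y j) \<noteq> 0" for j
  proof
    assume "L2_form (Y j) (Y j) = 0"
    then have z: "fst (Y j) = 0" by (rule L2_form_definite[OF eb(1)])
    define r where "r = real (Suc j)"
    have r: "1 \<le> r" and \<omega>r: "\<omega> j = r * pi / len e" by (simp_all add: r_def \<omega>_def)
    \<comment> \<open>A quarter period, where the sine equals 1.\<close>
    define t where "t = len e / (2 * r)"
    have "len e * 1 \<le> len e * (2 * r)" using l r by (intro mult_left_mono) auto
    then have t: "t \<in> {0..len e}" "\<omega> j * t = pi / 2"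
      using l r by (auto simp: t_def \<omega>r field_simps)
    have "sin (\<omega> j * t) = 0" using eb(2)[OF t(1), of j] by (simp add: z on_edge_def)
    then show False using t(2) by simp
  qed
  have card: "card {1..<n} < card {..<n}" using n by simp
  obtain c where c: "\<exists>j\<in>{..<n}. c j \<noteq> 0" "\<And>i. i \<in> {1..<n} \<Longrightarrow> (\<Sum>j<n. c j * L2_form (Y j) (\<Psi> i)) = 0"
    by (rule underdetermined_system[OF _ _ card, where m="\<lambda>i j. L2_form (Y j) (\<Psi> i)"]) (simp, simp, blast)
  define x where "x = (\<Sum>j<n. c j *\<^sub>R Y j)"
  have xV: "x \<in> energy_space" unfolding x_def by (rule M.sum_in[OF eb(1)])
  show ?thesis
  proof (rule that[OF xV])
    show "L2_form x (\<Psi> i) = 0" if "i \<in> {1..<n}" for i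
      unfolding x_def using c(2)[OF that] \<Psi>[OF that] eb(1) by (subst M.sum_left) auto
    have "L2_form x x \<noteq> 0"
    proof
      assume z: "L2_form x x = 0"
      have "c j = 0" if j: "j < n" for j
      proof -
        have "0 = L2_form x (Y j)" using M.null_vector[OF xV eb(1) z] by simp
        also have "\<dots> = (\<Sum>i<n. c i * L2_form (Y i) (Y j))"
          unfolding x_def using eb(1) by (intro M.sum_left) auto
        also have "\<dots> = (\<Sum>i<n. if i = j then c j * L2_form (Y j) (Y j) else 0)"
          by (intro sum.cong refl) (auto simp: orth)
        also have "\<dots> = c j * L2_form (Y j) (Y j)" using j by simp
        finally show ?thesis using pos[of j] by simp
      qed
      then show False using c(1) by auto
    qed
    then show "0 < L2_form x x" using M.nonneg[OF xV] by simp
    show "deriv_form x x \<le> (real n * pi / len e)\<^sup>2 * L2_form x x"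
      unfolding x_def
    proof (rule rayleigh_quotient_le[OF deriv_form_symmetric L2_form_psd])
      show "(\<omega> i)\<^sup>2 \<le> (real n * pi / len e)\<^sup>2" if "i \<in> {..<n}" for i
        unfolding \<omega>_def using that l
        by (intro power_mono divide_right_mono mult_right_mono) auto
    qed (use eb(1) D in auto)
    show "fst x (Vertex v) = 0" for v by (simp add: x_def fst_combination eb(4))
  qed
qed

lemma eigenvalue_upper_bound:
  assumes \<Phi>: "eigenbasis ev \<Phi>" and mono: "mono_on {1..} ev"
  obtains C where "C > 0" "\<And>n. 1 \<le> n \<Longrightarrow> ev n \<le> C * (real n)\<^sup>2"
proof -
  obtain e where e: "e \<in> arcs G" using arcs_ne by blast
  obtain A where A: "A > 0" "\<And>x. x \<in> energy_space \<Longrightarrow> (\<And>v. v \<in> verts G \<Longrightarrow> fst x (Vertex v) = 0) \<Longrightarrow>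
    energy_form x x \<le> A * (deriv_form x x + L2_form x x)" by (rule energy_form_le) blast
  \<comment> \<open>The summand \<open>(pi / len e)\<^sup>2\<close> stems from the sines, the
    summand 1 from the \<open>L2\<close> term, which is enlarged by the factor
    \<open>(real n)\<^sup>2\<close>.\<close>
  define C where "C = A * ((pi / len e)\<^sup>2 + 1)"
  have "ev n \<le> C * (real n)\<^sup>2" if n: "1 \<le> n" for n
  proof (rule ccontr)
    assume "\<not> ev n \<le> C * (real n)\<^sup>2"
    then have big: "C * (real n)\<^sup>2 < ev n" by simp
    have V: "\<Phi> j \<in> energy_space" "\<And>y. y \<in> energy_space \<Longrightarrow> energy_form (\<Phi> j) y = ev j * L2_form (\<Phi> j) y" if "1 \<le> j" for j
      using \<Phi> that by (auto simp: eigenbasis_def)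
    obtain x where x: "x \<in> energy_space" "\<And>i. i \<in> {1..<n} \<Longrightarrow> L2_form x (\<Phi> i) = 0" "0 < L2_form x x"
      "deriv_form x x \<le> (real n * pi / len e)\<^sup>2 * L2_form x x" "\<And>v. fst x (Vertex v) = 0"
      by (rule ex_trial_function[OF e _ n, of \<Phi>]) (use V(1) in auto)
    have n2: "1 \<le> (real n)\<^sup>2" using n by simp
    have "energy_form x x \<le> A * (deriv_form x x + L2_form x x)" using A(2)[OF x(1)] x(5) by simp
    also have "\<dots> \<le> A * ((real n * pi / len e)\<^sup>2 * L2_form x x + (real n)\<^sup>2 * L2_form x x)"
      using A(1) x(3,4) n2 mult_right_mono[OF n2, of "L2_form x x"] by (intro mult_left_mono add_mono) auto
    also have "\<dots> = C * (real n)\<^sup>2 * L2_form x x"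
      by (simp add: C_def power_mult_distrib power_divide algebra_simps)
    finally have xC: "energy_form x x \<le> C * (real n)\<^sup>2 * L2_form x x" .
    define E where "E = \<Phi> ` {1..<n}"
    have E: "finite E" "E \<subseteq> energy_space" "\<And>y. y \<in> E \<Longrightarrow> \<exists>\<mu>. \<forall>v\<in>energy_space. energy_form y v = \<mu> * L2_form y v"
      using V by (auto simp: E_def)
    have nonneg: "0 \<le> energy_form y y" if "y \<in> energy_space" for y
      using energy_form_coercive[OF that] M.nonneg[OF that] \<delta>(1) by (meson mult_nonneg_nonneg less_imp_le order_trans)
    obtain l X where X: "l \<le> C * (real n)\<^sup>2" "\<And>m::nat. X m \<in> energy_space" "\<And>m y. y \<in> E \<Longrightarrow> L2_form (X m) y = 0"
      "\<And>m. L2_form (X m) (X m) = 1" "\<And>m. energy_form (X m) (X m) \<le> l + 1"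
      "\<And>v. v \<in> energy_space \<Longrightarrow> (\<lambda>m. energy_form (X m) v - l * L2_form (X m) v) \<longlonglongrightarrow> 0"
      by (rule rayleigh_minimizing_sequence[OF energy_form_symmetric L2_form_psd E nonneg x(1) _ x(3) xC])
        (use x(2) in \<open>auto simp: E_def\<close>)
    obtain u g where u: "(u, g) \<in> energy_space" "u \<in> eigenspace G len a \<kappa> \<alpha> l" "L2_form (u, g) (u, g) = 1"
      "\<And>y. y \<in> energy_space \<Longrightarrow> (\<And>m. L2_form (X m) y = 0) \<Longrightarrow> L2_form (u, g) y = 0"
      by (rule minimizing_limit[OF X(2,4,5,6)]) auto
    \<comment> \<open>All indices carrying the eigenvalue \<open>l\<close> are below
      \<open>n\<close>, because \<open>l < ev n\<close> and \<open>ev\<close> is increasing.\<close>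
    define K where "K = {j. 1 \<le> j \<and> ev j = l}"
    have K: "finite K" "inj_on (\<lambda>j. fst (\<Phi> j)) K" "u \<in> span ((\<lambda>j. fst (\<Phi> j)) ` K)"
      using \<Phi> u(2) by (auto simp: eigenbasis_def K_def)
    have Kn: "j \<in> {1..<n}" if "j \<in> K" for j
    proof -
      have "1 \<le> j" "ev j < ev n" using that X(1) big by (auto simp: K_def)
      moreover have "ev n \<le> ev j" if "n \<le> j" using mono n that by (auto simp: mono_on_def)
      ultimately show ?thesis by (cases "n \<le> j") auto
    qed
    obtain b where "u = (\<Sum>v\<in>(\<lambda>j. fst (\<Phi> j)) ` K. b v *\<^sub>R v)"
      using K(3) span_finite[of "(\<lambda>j. fst (\<Phi> j)) ` K"] K(1) by auto
    then have "u = (\<Sum>j\<in>K. b (fst (\<Phi> j)) *\<^sub>R fst (\<Phi> j))" by (simp add: sum.reindex[OF K(2)])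
    then have uy: "u = fst (\<Sum>j\<in>K. b (fst (\<Phi> j)) *\<^sub>R \<Phi> j)" by (simp add: fst_sum)
    \<comment> \<open>\<open>L2_form\<close> ignores the derivative component, so equality of
      functions permits the substitution. Each resulting term vanishes by the orthogonality to the
      first \<open>n - 1\<close> eigenfunctions inherited from the sequence, contradicting norm
      1.\<close>
    have "L2_form (u, g) (u, g) = L2_form (u, g) (\<Sum>j\<in>K. b (fst (\<Phi> j)) *\<^sub>R \<Phi> j)"
      by (simp add: L2_form_def flip: uy)
    also have "\<dots> = (\<Sum>j\<in>K. b (fst (\<Phi> j)) * L2_form (u, g) (\<Phi> j))"
      using K(1) Kn V(1) by (intro M.sum_right u(1)) auto
    also have "\<dots> = 0"
    proof (intro sum.neutral ballI)
      fix j assume "j \<in> K"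
      then have "1 \<le> j" "\<Phi> j \<in> E" using Kn by (auto simp: E_def)
      then show "b (fst (\<Phi> j)) * L2_form (u, g) (\<Phi> j) = 0" using u(4)[OF V(1) X(3)] by simp
    qed
    finally show False using u(3) by simp
  qed
  moreover have "C > 0" unfolding C_def using A(1) by (intro mult_pos_pos add_nonneg_pos) auto
  ultimately show ?thesis by (rule that[rotated])
qed

theorem eigenvalues_quadratic:
  assumes ev: "eigenvalue_sequence G len a \<kappa> \<alpha> ev"
  shows "\<exists>C\<^sub>1 C\<^sub>2. C\<^sub>1 > 0 \<and> C\<^sub>2 > 0 \<and>
    (\<forall>n::nat. n \<ge> 1 \<longrightarrow> C\<^sub>1 * (real n)\<^sup>2 \<le> ev n \<and> ev n \<le> C\<^sub>2 * (real n)\<^sup>2)"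
proof -
  have mono: "mono_on {1..} ev" using ev by (simp add: eigenvalue_sequence_def)
  obtain \<Phi> where \<Phi>: "eigenbasis ev \<Phi>" using ex_eigenbasis[OF ev] by blast
  obtain C\<^sub>2 where C\<^sub>2: "C\<^sub>2 > 0" "\<And>n. 1 \<le> n \<Longrightarrow> ev n \<le> C\<^sub>2 * (real n)\<^sup>2"
    by (rule eigenvalue_upper_bound[OF \<Phi> mono]) blast
  define N where "N = card (arcs G)"
  have N: "1 \<le> N" using arcs_ne by (simp add: N_def card_gt_0_iff Suc_le_eq)
  define l where "l = Max (len ` arcs G)"
  have l0: "0 < l"
  proof -
    obtain e where e: "e \<in> arcs G" using arcs_ne by blast
    have "len e \<le> l" unfolding l_def using e by (intro Max_ge) auto
    then show ?thesis using len_pos[OF e] by simp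
  qed
  \<comment> \<open>\<open>4 * N\<close> separates two regimes: below it \<open>\<delta>\<close>
    serves as lower bound for the eigenvalues, from there on \<open>n \<le> 4 * N * m\<close> for
    the number \<open>m\<close> of mesh cells per edge.\<close>
  define C\<^sub>1 where "C\<^sub>1 = min (a\<^sub>0 / l\<^sup>2) \<delta> / (4 * real N)\<^sup>2"
  have "C\<^sub>1 > 0" using a\<^sub>0_pos l0 \<delta> N by (simp add: C\<^sub>1_def)
  moreover have "C\<^sub>1 * (real n)\<^sup>2 \<le> ev n" if n: "1 \<le> n" for n
  proof (cases "n < 4 * N")
    case True
    then have "real n \<le> 4 * real N" by simp
    then have "(real n)\<^sup>2 \<le> (4 * real N)\<^sup>2" by (intro power_mono) auto
    then have "C\<^sub>1 * (real n)\<^sup>2 \<le> C\<^sub>1 * (4 * real N)\<^sup>2" using \<open>C\<^sub>1 > 0\<close> by (intro mult_left_mono) auto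
    also have "\<dots> = min (a\<^sub>0 / l\<^sup>2) \<delta>" using N by (simp add: C\<^sub>1_def)
    also have "\<dots> \<le> ev n" using eigenvalue_ge[OF \<Phi> n] by simp
    finally show ?thesis .
  next
    case False
    \<comment> \<open>Dividing by \<open>2 * N\<close> rather than \<open>N\<close> leaves room for
      the additional mesh point on each edge: \<open>N * (m + 1) \<le> 2 * N * m \<le> n - 1\<close>
      once \<open>1 \<le> m\<close>.\<close>
    define m where "m = (n - 1) div (2 * N)"
    have 1: "2 * N * m \<le> n - 1" unfolding m_def by (rule times_div_less_eq_dividend)
    have "n - 1 < 2 * N * m + 2 * N"
      unfolding m_def using dividend_less_times_div[of "2 * N" "n - 1"] N by simp
    then have nm: "n \<le> 4 * N * m" using False by simp
    then have m: "1 \<le> m" using n by (cases m) auto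
    have "N * (m + 1) \<le> 2 * N * m" using m by (simp add: algebra_simps)
    then have "N * (m + 1) < n" using 1 n by linarith
    then have low: "a\<^sub>0 * (real m / l)\<^sup>2 \<le> ev n"
      unfolding l_def N_def by (intro eigenvalue_lower_bound[OF \<Phi> mono m])
    have "real n \<le> 4 * real N * real m" using nm by (metis of_nat_le_iff of_nat_mult of_nat_numeral)
    then have "(real n)\<^sup>2 \<le> (4 * real N * real m)\<^sup>2" by (intro power_mono) auto
    then have "C\<^sub>1 * (real n)\<^sup>2 \<le> C\<^sub>1 * (4 * real N * real m)\<^sup>2" using \<open>C\<^sub>1 > 0\<close> by (intro mult_left_mono) auto
    also have "\<dots> = min (a\<^sub>0 / l\<^sup>2) \<delta> * (real m)\<^sup>2" using N by (simp add: C\<^sub>1_def power_mult_distrib)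
    also have "\<dots> \<le> a\<^sub>0 / l\<^sup>2 * (real m)\<^sup>2" by (intro mult_right_mono) auto
    also have "\<dots> = a\<^sub>0 * (real m / l)\<^sup>2" by (simp add: power_divide)
    finally show ?thesis using low by simp
  qed
  ultimately show ?thesis using C\<^sub>2 by blast
qed

end

text \<open>Truncates the square of \<open>\<kappa>\<close> between
  \<open>\<kappa>\<^sub>0\<^sup>2\<close> and the square of an essential bound: both bounds then
  hold at every point, and only a null set is affected. Positivity of
  \<open>\<kappa>\<^sub>0\<close> carries the lower bound over to squares.\<close>

lemma ex_bounded_potential:
  assumes \<kappa>: "graph_Linf G len \<kappa>" "graph_ess_inf_ge G len \<kappa> \<kappa>\<^sub>0" "0 < \<kappa>\<^sub>0"
  shows "\<exists>k. \<forall>e. (\<forall>x. \<kappa>\<^sub>0\<^sup>2 \<le> k e x) \<and> (e \<in> arcs G \<longrightarrow> bmeas 0 (len e) (k e) \<and>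
    negligible {x \<in> {0<..<len e}. (on_edge G len \<kappa> e x)\<^sup>2 \<noteq> k e x})"
proof (intro choice allI)
  fix e
  show "\<exists>k. (\<forall>x. \<kappa>\<^sub>0\<^sup>2 \<le> k x) \<and> (e \<in> arcs G \<longrightarrow> bmeas 0 (len e) k \<and>
    negligible {x \<in> {0<..<len e}. (on_edge G len \<kappa> e x)\<^sup>2 \<noteq> k x})"
  proof (cases "e \<in> arcs G")
    case True
    define f where "f = on_edge G len \<kappa> e"
    obtain K where m: "f \<in> borel_measurable (lebesgue_on {0<..<len e})"
      and K: "AE x in lebesgue_on {0<..<len e}. \<bar>f x\<bar> \<le> K" and c: "AE x in lebesgue_on {0<..<len e}. \<kappa>\<^sub>0 \<le> f x"
      using \<kappa> True unfolding graph_Linf_def graph_ess_inf_ge_def f_def by blast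
    define h where "h x = (if x \<in> {0<..<len e} then f x else 0)" for x
    have h: "h \<in> borel_measurable lebesgue"
      unfolding h_def using m borel_measurable_if[of "{0<..<len e}" f] by simp
    define k where "k x = max (\<kappa>\<^sub>0\<^sup>2) (min (K\<^sup>2) ((h x)\<^sup>2))" for x
    have "k \<in> borel_measurable lebesgue" unfolding k_def using h by measurable
    then have "k \<in> borel_measurable (lebesgue_on {0..len e})" by (rule measurable_restrict_space1)
    then have "bmeas 0 (len e) k"
      by (rule bmeasI[where K="max (\<kappa>\<^sub>0\<^sup>2) (K\<^sup>2)"]) (auto simp: k_def abs_of_nonneg le_max_iff_disj)
    moreover have "negligible {x \<in> {0<..<len e}. (f x)\<^sup>2 \<noteq> k x}"
    proof (rule negligible_subset)
      show "negligible ({x \<in> {0<..<len e}. \<not> \<bar>f x\<bar> \<le> K} \<union> {x \<in> {0<..<len e}. \<not> \<kappa>\<^sub>0 \<le> f x})"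
        using K c by (intro negligible_Un) (simp_all add: AE_lebesgue_on_negligible)
      have "(f x)\<^sup>2 = k x" if "x \<in> {0<..<len e}" "\<bar>f x\<bar> \<le> K" "\<kappa>\<^sub>0 \<le> f x" for x
      proof -
        have "\<kappa>\<^sub>0\<^sup>2 \<le> (f x)\<^sup>2" using that \<kappa>(3) by (intro power_mono) auto
        moreover have "(f x)\<^sup>2 \<le> K\<^sup>2" using that abs_le_square_iff[of "f x" K] by auto
        ultimately show ?thesis using that(1) by (simp add: k_def h_def)
      qed
      then show "{x \<in> {0<..<len e}. (f x)\<^sup>2 \<noteq> k x} \<subseteq> {x \<in> {0<..<len e}. \<not> \<bar>f x\<bar> \<le> K} \<union> {x \<in> {0<..<len e}. \<not> \<kappa>\<^sub>0 \<le> f x}"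
        by blast
    qed
    ultimately show ?thesis by (intro exI[of _ k]) (auto simp: k_def f_def)
  qed auto
qed

theorem corollary2p11:
  fixes G :: "('v, 'e) pre_digraph"
    and len :: "'e \<Rightarrow> real"
    and \<kappa> a :: "('v, 'e) gpoint \<Rightarrow> real"
    and \<kappa>\<^sub>0 a\<^sub>0 \<alpha> S :: real
    and ev :: "nat \<Rightarrow> real"
  assumes graph: "compact_metric_graph G len"
    and \<kappa>: "graph_Linf G len \<kappa>" "graph_ess_inf_ge G len \<kappa> \<kappa>\<^sub>0" "\<kappa>\<^sub>0 > 0"
    and a: "graph_lipschitz G len a" "\<forall>p\<in>gpoints G len. a p > 0"
    and a0: "a\<^sub>0 \<in> a ` gpoints G len" "\<forall>p\<in>gpoints G len. a\<^sub>0 \<le> a p" "a\<^sub>0 > 0"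
    and S: "S = \<bar>\<alpha>\<bar> / real (Min (vdegree G ` verts G))"
    and cond: "\<alpha> \<ge> 0 \<or> (\<kappa>\<^sub>0\<^sup>2 > 4 * S / Min (len ` arcs G) \<and> 2 * S * Max (len ` arcs G) \<le> a\<^sub>0)"
    and ev: "eigenvalue_sequence G len a \<kappa> \<alpha> ev"
  shows "\<exists>C\<^sub>1 C\<^sub>2. C\<^sub>1 > 0 \<and> C\<^sub>2 > 0 \<and>
    (\<forall>n::nat. n \<ge> 1 \<longrightarrow> C\<^sub>1 * (real n)\<^sup>2 \<le> ev n \<and> ev n \<le> C\<^sub>2 * (real n)\<^sup>2)"
proof -
  have G: "fin_digraph G" "Digraph_Component.connected G" "arcs G \<noteq> {}" "\<And>e. e \<in> arcs G \<Longrightarrow> 0 < len e"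
    using graph by (auto simp: compact_metric_graph_def)
  interpret fin_digraph G by (rule G(1))
  interpret metric_graph G len by unfold_locales (use G in auto)
  obtain k where k: "\<And>e x. \<kappa>\<^sub>0\<^sup>2 \<le> k e x" "\<And>e. e \<in> arcs G \<Longrightarrow> bmeas 0 (len e) (k e)"
    "\<And>e. e \<in> arcs G \<Longrightarrow> negligible {x \<in> {0<..<len e}. (on_edge G len \<kappa> e x)\<^sup>2 \<noteq> k e x}"
    using ex_bounded_potential[OF \<kappa>] by blast
  define d where "d = Min (vdegree G ` verts G)"
  \<comment> \<open>For negative \<open>\<alpha>\<close> this is the slack in the strict inequality
    assumed for \<open>\<kappa>\<^sub>0\<close>; it becomes the coercivity constant.\<close>
  define \<delta> where "\<delta> = (if \<alpha> \<ge> 0 then \<kappa>\<^sub>0\<^sup>2 else \<kappa>\<^sub>0\<^sup>2 - 4 * S / Min (len ` arcs G))"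
  \<comment> \<open>Positive degrees guarantee that the definition of \<open>S\<close> does not
    divide by zero.\<close>
  have deg: "1 \<le> vdegree G v" if v: "v \<in> verts G" for v
  proof -
    obtain e where "e \<in> arcs G" "tail G e = v \<or> head G e = v" using ex_incident_arc[OF v] by blast
    then have "out_arcs G v \<noteq> {} \<or> in_arcs G v \<noteq> {}" by auto
    then have "0 < card (out_arcs G v) \<or> 0 < card (in_arcs G v)" by (auto simp: card_gt_0_iff)
    then show ?thesis by (auto simp: vdegree_def out_degree_def in_degree_def)
  qed
  have "verts G \<noteq> {}" using G(3) tail_in_verts by blast
  then have d: "1 \<le> d" "\<And>v. v \<in> verts G \<Longrightarrow> d \<le> vdegree G v"
    using deg by (auto simp: d_def)
  have S0: "0 \<le> S" by (simp add: S)
  have Sd: "\<bar>\<alpha>\<bar> \<le> S * real (vdegree G v)" if "v \<in> verts G" for v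
  proof -
    have "\<bar>\<alpha>\<bar> = S * real d" using d(1) by (simp add: S d_def)
    also have "\<dots> \<le> S * real (vdegree G v)" using d(2)[OF that] S0 by (intro mult_left_mono) auto
    finally show ?thesis .
  qed
  have lmin: "0 < Min (len ` arcs G)" using G by simp
  have edge: "2 * S * len e \<le> a\<^sub>0 \<and> 4 * S / len e \<le> \<kappa>\<^sub>0\<^sup>2 - \<delta>" if "\<not> 0 \<le> \<alpha>" and e: "e \<in> arcs G" for e
  proof
    have "2 * S * len e \<le> 2 * S * Max (len ` arcs G)" using S0 e by (intro mult_left_mono) auto
    then show "2 * S * len e \<le> a\<^sub>0" using cond that by auto
    have "4 * S / len e \<le> 4 * S / Min (len ` arcs G)" using S0 e lmin by (intro divide_left_mono mult_pos_pos) (auto simp: G)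
    then show "4 * S / len e \<le> \<kappa>\<^sub>0\<^sup>2 - \<delta>" using that by (simp add: \<delta>_def)
  qed
  have "0 < \<delta>" "\<delta> \<le> \<kappa>\<^sub>0\<^sup>2"
    using cond S0 lmin \<kappa>(3) by (auto simp: \<delta>_def)
  then interpret quantum_graph G len a \<kappa> k \<alpha> a\<^sub>0 "\<kappa>\<^sub>0\<^sup>2" S \<delta>
    by unfold_locales (use a(1) a0 k S0 Sd edge in auto)
  show ?thesis by (rule eigenvalues_quadratic[OF ev])
qed

end
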